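(* Let $A$ be a Noetherian commutative monoid object in $(\mathbf C,\otimes,1)$ and let $\mathscr I\subseteq\mathcal E(A)$ be an ideal in $\mathcal E(A)$. Then $A/\mathscr I$ is a Noetherian monoid.
   Context: Standing assumptions: $(\mathbf C,\otimes,1)$ is an abelian symmetric monoidal category with small limits and small colimits such that for every object $X$ the functor $-\otimes X$ preserves colimits. $Comm(\mathbf C)$ is the category of unital commutative monoid objects in $\mathbf C$ (all monoids are unital and commutative), and $A\text{-}Mod$ is the category of modules over $A\in Comm(\mathbf C)$. For every monoid $A$, filtered colimits commute with finite limits in $A\text{-}Mod$. Moreover: (C1) $Hom_{\mathbf C}(1,-)$ preserves filtered colimits, and for every monoid $A$ and every finite (not necessarily filtered) system of $A$-modules of the form $\{A^{r_i}\}_{i\in I}$, $r_i\ge 0$, the canonical map $colim_{i}\,Hom_{A-Mod}(A,A^{r_i})\to Hom_{A-Mod}(A,colim_i A^{r_i})$ is an isomorphism. (C2) For every monoid $A$, every object of $A\text{-}Mod$ is a directed colimit of finitely presented objects, where $M$ is finitely presented if $Hom_{A-Mod}(M,-)$ preserves directed colimits. $\mathcal E(A):=Hom_{A-Mod}(A,A)$, a commutative ring under composition. Quotients: for $t\in\mathcal E(A)$, $A/tA:=colim(A\overset{t}{\leftarrow}A\to 0)$ (colimit in $A\text{-}Mod$, i.e. the cokernel of $t$), which is a commutative monoid such that the canonical morphism $A\to A/tA$ is a morphism of monoids. For an ideal $\mathscr I\subseteq\mathcal E(A)$, $A/\mathscr I:=colim\{A\to A/tA\}_{t\in\mathscr I}$,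 the colimit taken in $Comm(\mathbf C)$ of the diagram consisting of all the canonical morphisms $A\to A/tA$, $t\in\mathscr I$, out of the single object $A$. An object $N$ of $A\text{-}Mod$ is finitely generated if for every filtered inductive system $\{M_i\}_{i}$ in $A\text{-}Mod$ connected by monomorphisms, with $M=colim_iM_i$, the canonical map $colim_i Hom_{A-Mod}(N,M_i)\to Hom_{A-Mod}(N,M)$ is a bijection. A monoid $A$ is Noetherian if every subobject of $A$ in $A\text{-}Mod$ is finitely generated in $A\text{-}Mod$. *)

theory Defs
  imports
    "HOL-Library.Equipollence"
    "HOL-Algebra.Ideal"
    "HOL-Algebra.Generated_Groups"
    "HOL-Algebra.Product_Groups"
begin

section \<open>Categories\<close>

text \<open>
  Categories are given by families of hom-sets, which need not be pairwise disjoint: a morphism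
  of modules or of monoids \<^emph>\<open>is\<close> a morphism of the base category, and is considered together
  with its source and target. Disjointness is a separate condition (\<open>disjoint_homs\<close>), imposed
  where an operation on arrows (a functor, the tensor product) does not mention their sources
  and targets.
\<close>

record ('o, 'm) cat =
  Obj :: "'o set"
  Hom :: "'o \<Rightarrow> 'o \<Rightarrow> 'm set"
  Idt :: "'o \<Rightarrow> 'm"
  Comp :: "'m \<Rightarrow> 'm \<Rightarrow> 'm"  (infixl \<open>\<cdot>\<index>\<close> 70)

locale category =
  fixes C :: "('o, 'm, 'z) cat_scheme" (structure)
  assumes Hom_Obj: "f \<in> Hom C a b \<Longrightarrow> a \<in> Obj C \<and> b \<in> Obj C"
    and Idt_Hom: "a \<in> Obj C \<Longrightarrow> Idt C a \<in> Hom C a a"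
    and Comp_Hom: "f \<in> Hom C a b \<Longrightarrow> g \<in> Hom C b c \<Longrightarrow> g \<cdot> f \<in> Hom C a c"
    and Comp_Idt: "f \<in> Hom C a b \<Longrightarrow> f \<cdot> Idt C a = f"
    and Idt_Comp: "f \<in> Hom C a b \<Longrightarrow> Idt C b \<cdot> f = f"
    and Comp_assoc: "f \<in> Hom C a b \<Longrightarrow> g \<in> Hom C b c \<Longrightarrow> h \<in> Hom C c d \<Longrightarrow>
      (h \<cdot> g) \<cdot> f = h \<cdot> (g \<cdot> f)"

definition disjoint_homs :: "('o, 'm, 'z) cat_scheme \<Rightarrow> bool" where
  "disjoint_homs C \<longleftrightarrow>
    (\<forall>a b a' b' f. f \<in> Hom C a b \<longrightarrow> f \<in> Hom C a' b' \<longrightarrow> a = a' \<and> b = b')"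

definition iso_arr :: "('o, 'm, 'z) cat_scheme \<Rightarrow> 'o \<Rightarrow> 'o \<Rightarrow> 'm \<Rightarrow> bool" where
  "iso_arr C a b f \<longleftrightarrow> f \<in> Hom C a b \<and>
    (\<exists>g \<in> Hom C b a. g \<cdot>\<^bsub>C\<^esub> f = Idt C a \<and> f \<cdot>\<^bsub>C\<^esub> g = Idt C b)"

definition monic :: "('o, 'm, 'z) cat_scheme \<Rightarrow> 'o \<Rightarrow> 'o \<Rightarrow> 'm \<Rightarrow> bool" where
  "monic C a b f \<longleftrightarrow> f \<in> Hom C a b \<and>
    (\<forall>x. \<forall>g \<in> Hom C x a. \<forall>h \<in> Hom C x a. f \<cdot>\<^bsub>C\<^esub> g = f \<cdot>\<^bsub>C\<^esub> h \<longrightarrow> g = h)"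

definition epic :: "('o, 'm, 'z) cat_scheme \<Rightarrow> 'o \<Rightarrow> 'o \<Rightarrow> 'm \<Rightarrow> bool" where
  "epic C a b f \<longleftrightarrow> f \<in> Hom C a b \<and>
    (\<forall>x. \<forall>g \<in> Hom C b x. \<forall>h \<in> Hom C b x. g \<cdot>\<^bsub>C\<^esub> f = h \<cdot>\<^bsub>C\<^esub> f \<longrightarrow> g = h)"

text \<open>A functor, or diagram of shape \<open>J\<close>, is given by its object map \<open>F\<close> and its arrow map \<open>F'\<close>.\<close>

definition is_functor ::
  "('i, 'j, 'y) cat_scheme \<Rightarrow> ('o, 'm, 'z) cat_scheme \<Rightarrow> ('i \<Rightarrow> 'o) \<Rightarrow> ('j \<Rightarrow> 'm) \<Rightarrow> bool" where
  "is_functor J C F F' \<longleftrightarrow>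
    (\<forall>i \<in> Obj J. F i \<in> Obj C \<and> F' (Idt J i) = Idt C (F i)) \<and>
    (\<forall>i j. \<forall>u \<in> Hom J i j. F' u \<in> Hom C (F i) (F j)) \<and>
    (\<forall>i j k. \<forall>u \<in> Hom J i j. \<forall>v \<in> Hom J j k. F' (v \<cdot>\<^bsub>J\<^esub> u) = F' v \<cdot>\<^bsub>C\<^esub> F' u)"

definition is_cocone ::
  "('i, 'j, 'y) cat_scheme \<Rightarrow> ('o, 'm, 'z) cat_scheme \<Rightarrow> ('i \<Rightarrow> 'o) \<Rightarrow> ('j \<Rightarrow> 'm)
    \<Rightarrow> 'o \<Rightarrow> ('i \<Rightarrow> 'm) \<Rightarrow> bool" where
  "is_cocone J C F F' L l \<longleftrightarrow> L \<in> Obj C \<and>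
    (\<forall>i \<in> Obj J. l i \<in> Hom C (F i) L) \<and>
    (\<forall>i j. \<forall>u \<in> Hom J i j. l j \<cdot>\<^bsub>C\<^esub> F' u = l i)"

definition is_colimit ::
  "('i, 'j, 'y) cat_scheme \<Rightarrow> ('o, 'm, 'z) cat_scheme \<Rightarrow> ('i \<Rightarrow> 'o) \<Rightarrow> ('j \<Rightarrow> 'm)
    \<Rightarrow> 'o \<Rightarrow> ('i \<Rightarrow> 'm) \<Rightarrow> bool" where
  "is_colimit J C F F' L l \<longleftrightarrow> is_cocone J C F F' L l \<and>
    (\<forall>X x. is_cocone J C F F' X x \<longrightarrow>
      (\<exists>!h. h \<in> Hom C L X \<and> (\<forall>i \<in> Obj J. h \<cdot>\<^bsub>C\<^esub> l i = x i)))"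

definition is_cone ::
  "('i, 'j, 'y) cat_scheme \<Rightarrow> ('o, 'm, 'z) cat_scheme \<Rightarrow> ('i \<Rightarrow> 'o) \<Rightarrow> ('j \<Rightarrow> 'm)
    \<Rightarrow> 'o \<Rightarrow> ('i \<Rightarrow> 'm) \<Rightarrow> bool" where
  "is_cone J C F F' L l \<longleftrightarrow> L \<in> Obj C \<and>
    (\<forall>i \<in> Obj J. l i \<in> Hom C L (F i)) \<and>
    (\<forall>i j. \<forall>u \<in> Hom J i j. F' u \<cdot>\<^bsub>C\<^esub> l i = l j)"

definition is_limit ::
  "('i, 'j, 'y) cat_scheme \<Rightarrow> ('o, 'm, 'z) cat_scheme \<Rightarrow> ('i \<Rightarrow> 'o) \<Rightarrow> ('j \<Rightarrow> 'm)
    \<Rightarrow> 'o \<Rightarrow> ('i \<Rightarrow> 'm) \<Rightarrow> bool" where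
  "is_limit J C F F' L l \<longleftrightarrow> is_cone J C F F' L l \<and>
    (\<forall>X x. is_cone J C F F' X x \<longrightarrow>
      (\<exists>!h. h \<in> Hom C X L \<and> (\<forall>i \<in> Obj J. l i \<cdot>\<^bsub>C\<^esub> h = x i)))"


section \<open>Index categories\<close>

text \<open>
  Up to isomorphism, only the cardinality of a Grothendieck universe matters for the notion of a small
  category. A universe is therefore represented by a set \<open>U\<close> whose cardinality is that of a
  non-empty Grothendieck universe with an infinite element, or of the universe of hereditarily
  finite sets; a set is small if its cardinality is less than that of \<open>U\<close>. Every small category is
  isomorphic to one with objects and arrows in \<open>U\<close>, so all small categories are captured by the
  type \<open>('u, 'u) cat\<close>.
\<close>

definition universe :: "'u set \<Rightarrow> bool" where
  "universe U \<longleftrightarrow> infinite U \<and>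
    (\<forall>X \<subseteq> U. X \<prec> U \<longrightarrow> Pow X \<prec> U) \<and>
    (\<forall>I F. I \<subseteq> U \<longrightarrow> I \<prec> U \<longrightarrow> (\<forall>i \<in> I. F i \<subseteq> U \<and> F i \<prec> U) \<longrightarrow> (\<Union>i\<in>I. F i) \<prec> U)"

definition small_cat :: "'u set \<Rightarrow> ('i, 'j) cat \<Rightarrow> bool" where
  "small_cat U J \<longleftrightarrow> category J \<and> disjoint_homs J \<and> Obj J \<prec> U \<and> (\<forall>i j. Hom J i j \<prec> U)"

definition finite_cat :: "('i, 'j) cat \<Rightarrow> bool" where
  "finite_cat J \<longleftrightarrow> category J \<and> disjoint_homs J \<and> finite (Obj J) \<and> (\<forall>i j. finite (Hom J i j))"

definition filtered :: "('i, 'j) cat \<Rightarrow> bool" where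
  "filtered J \<longleftrightarrow> Obj J \<noteq> {} \<and>
    (\<forall>i \<in> Obj J. \<forall>j \<in> Obj J. \<exists>k \<in> Obj J. Hom J i k \<noteq> {} \<and> Hom J j k \<noteq> {}) \<and>
    (\<forall>i j. \<forall>u \<in> Hom J i j. \<forall>v \<in> Hom J i j. \<exists>k. \<exists>w \<in> Hom J j k. w \<cdot>\<^bsub>J\<^esub> u = w \<cdot>\<^bsub>J\<^esub> v)"

text \<open>A non-empty directed partially ordered set, as a category.\<close>

definition directed :: "('i, 'j) cat \<Rightarrow> bool" where
  "directed J \<longleftrightarrow> Obj J \<noteq> {} \<and>
    (\<forall>i j. \<forall>u \<in> Hom J i j. \<forall>v \<in> Hom J i j. u = v) \<and>
    (\<forall>i j. Hom J i j \<noteq> {} \<longrightarrow> Hom J j i \<noteq> {} \<longrightarrow> i = j) \<and>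
    (\<forall>i \<in> Obj J. \<forall>j \<in> Obj J. \<exists>k \<in> Obj J. Hom J i k \<noteq> {} \<and> Hom J j k \<noteq> {})"

definition discrete_cat :: "'i set \<Rightarrow> ('i, 'i) cat" where
  "discrete_cat S =
    \<lparr>Obj = S, Hom = (\<lambda>i j. if i = j \<and> i \<in> S then {i} else {}), Idt = (\<lambda>i. i), Comp = (\<lambda>v u. u)\<rparr>"

definition prod_cat :: "('i, 'j) cat \<Rightarrow> ('k, 'l) cat \<Rightarrow> ('i \<times> 'k, 'j \<times> 'l) cat" where
  "prod_cat J K =
    \<lparr>Obj = Obj J \<times> Obj K,
     Hom = (\<lambda>a b. Hom J (fst a) (fst b) \<times> Hom K (snd a) (snd b)),
     Idt = (\<lambda>a. (Idt J (fst a), Idt K (snd a))),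
     Comp = (\<lambda>v u. (fst v \<cdot>\<^bsub>J\<^esub> fst u, snd v \<cdot>\<^bsub>K\<^esub> snd u))\<rparr>"

text \<open>
  The shape of a family of arrows, indexed by \<open>T\<close>, out of a single object: one object \<open>None\<close>,
  objects \<open>Some t\<close>, and as non-identity arrows exactly one arrow from \<open>None\<close> to each \<open>Some t\<close>.
  Every arrow is the pair of its source and target.
\<close>

definition fan_cat :: "'t set \<Rightarrow> ('t option, 't option \<times> 't option) cat" where
  "fan_cat T =
    \<lparr>Obj = insert None (Some ` T),
     Hom = (\<lambda>i j. if j \<in> insert None (Some ` T) \<and> (i = j \<or> i = None \<and> j \<noteq> None)
                  then {(i, j)} else {}),
     Idt = (\<lambda>i. (i, i)),
     Comp = (\<lambda>v u. (fst u, snd v))\<rparr>"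


section \<open>Limits and colimits: existence and preservation\<close>

definition has_small_limits :: "'u set \<Rightarrow> ('o, 'm, 'z) cat_scheme \<Rightarrow> bool" where
  "has_small_limits U C \<longleftrightarrow>
    (\<forall>(J :: ('u, 'u) cat) F F'. small_cat U J \<longrightarrow> is_functor J C F F' \<longrightarrow>
      (\<exists>L l. is_limit J C F F' L l))"

definition has_small_colimits :: "'u set \<Rightarrow> ('o, 'm, 'z) cat_scheme \<Rightarrow> bool" where
  "has_small_colimits U C \<longleftrightarrow>
    (\<forall>(J :: ('u, 'u) cat) F F'. small_cat U J \<longrightarrow> is_functor J C F F' \<longrightarrow>
      (\<exists>L l. is_colimit J C F F' L l))"

text \<open>
  \<open>colim\<^sub>i Hom(N, F i)\<close> in the category of sets: the disjoint union of the \<open>Hom(N, F i)\<close>,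
  modulo the equivalence relation generated by \<open>(i, f) \<sim> (j, F' u \<cdot> f)\<close> for \<open>u : i \<rightarrow> j\<close>.
\<close>

definition colim_Hom_step ::
  "('o, 'm, 'z) cat_scheme \<Rightarrow> 'o \<Rightarrow> ('i, 'j) cat \<Rightarrow> ('i \<Rightarrow> 'o) \<Rightarrow> ('j \<Rightarrow> 'm)
    \<Rightarrow> (('i \<times> 'm) \<times> ('i \<times> 'm)) set" where
  "colim_Hom_step C N J F F' =
    {((i, f), (j, F' u \<cdot>\<^bsub>C\<^esub> f)) | i j u f. u \<in> Hom J i j \<and> f \<in> Hom C N (F i)}"

definition colim_Hom ::
  "('o, 'm, 'z) cat_scheme \<Rightarrow> 'o \<Rightarrow> ('i, 'j) cat \<Rightarrow> ('i \<Rightarrow> 'o) \<Rightarrow> ('j \<Rightarrow> 'm)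
    \<Rightarrow> ('i \<times> 'm) set set" where
  "colim_Hom C N J F F' =
    (SIGMA i : Obj J. Hom C N (F i)) //
      (colim_Hom_step C N J F F' \<union> (colim_Hom_step C N J F F')\<inverse>)\<^sup>*"

text \<open>
  The canonical map \<open>colim\<^sub>i Hom(N, F i) \<rightarrow> Hom(N, L)\<close> induced by a cocone \<open>l\<close>; the function
  \<open>(i, f) \<mapsto> l i \<cdot> f\<close> is constant on equivalence classes.
\<close>

definition colim_Hom_map ::
  "('o, 'm, 'z) cat_scheme \<Rightarrow> ('i \<Rightarrow> 'm) \<Rightarrow> ('i \<times> 'm) set \<Rightarrow> 'm" where
  "colim_Hom_map C l X = the_elem ((\<lambda>(i, f). l i \<cdot>\<^bsub>C\<^esub> f) ` X)"

definition Hom_preserves_colimit ::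
  "('o, 'm, 'z) cat_scheme \<Rightarrow> 'o \<Rightarrow> ('i, 'j) cat \<Rightarrow> ('i \<Rightarrow> 'o) \<Rightarrow> ('j \<Rightarrow> 'm)
    \<Rightarrow> 'o \<Rightarrow> ('i \<Rightarrow> 'm) \<Rightarrow> bool" where
  "Hom_preserves_colimit C N J F F' L l \<longleftrightarrow>
    bij_betw (colim_Hom_map C l) (colim_Hom C N J F F') (Hom C N L)"

definition Hom_preserves_filtered_colimits ::
  "'u set \<Rightarrow> ('o, 'm, 'z) cat_scheme \<Rightarrow> 'o \<Rightarrow> bool" where
  "Hom_preserves_filtered_colimits U C N \<longleftrightarrow>
    (\<forall>(J :: ('u, 'u) cat) F F' L l.
      small_cat U J \<longrightarrow> filtered J \<longrightarrow> is_functor J C F F' \<longrightarrow> is_colimit J C F F' L l \<longrightarrow>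
      Hom_preserves_colimit C N J F F' L l)"

definition finitely_presented :: "'u set \<Rightarrow> ('o, 'm, 'z) cat_scheme \<Rightarrow> 'o \<Rightarrow> bool" where
  "finitely_presented U C N \<longleftrightarrow> N \<in> Obj C \<and>
    (\<forall>(J :: ('u, 'u) cat) F F' L l.
      small_cat U J \<longrightarrow> directed J \<longrightarrow> is_functor J C F F' \<longrightarrow> is_colimit J C F F' L l \<longrightarrow>
      Hom_preserves_colimit C N J F F' L l)"

definition finitely_generated :: "'u set \<Rightarrow> ('o, 'm, 'z) cat_scheme \<Rightarrow> 'o \<Rightarrow> bool" where
  "finitely_generated U C N \<longleftrightarrow> N \<in> Obj C \<and>
    (\<forall>(J :: ('u, 'u) cat) F F' L l.
      small_cat U J \<longrightarrow> filtered J \<longrightarrow> is_functor J C F F' \<longrightarrow>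
      (\<forall>i j. \<forall>u \<in> Hom J i j. monic C (F i) (F j) (F' u)) \<longrightarrow>
      is_colimit J C F F' L l \<longrightarrow>
      Hom_preserves_colimit C N J F F' L l)"

text \<open>
  Filtered colimits commute with finite limits. For \<open>D : J \<times> K \<rightarrow> C\<close> with \<open>J\<close> filtered and
  \<open>K\<close> finite, let \<open>P j = lim\<^sub>k D(j, k)\<close> with projections \<open>p j k\<close> and \<open>Q k = colim\<^sub>j D(j, k)\<close>
  with injections \<open>q k j\<close>, both with the induced functor structure, and let \<open>X = colim\<^sub>j P j\<close>
  and \<open>Y = lim\<^sub>k Q k\<close>. The equations on \<open>c\<close> characterise the canonical morphism \<open>X \<rightarrow> Y\<close>.
\<close>

definition filtered_colimits_commute_with_finite_limits ::
  "'u set \<Rightarrow> ('o, 'm, 'z) cat_scheme \<Rightarrow> bool" where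
  "filtered_colimits_commute_with_finite_limits U C \<longleftrightarrow>
    (\<forall>(J :: ('u, 'u) cat) (K :: ('u, 'u) cat) D D' P P' p Q Q' q X x Y y.
      small_cat U J \<longrightarrow> filtered J \<longrightarrow> finite_cat K \<longrightarrow> is_functor (prod_cat J K) C D D' \<longrightarrow>
      (\<forall>j \<in> Obj J. is_limit K C (\<lambda>k. D (j, k)) (\<lambda>v. D' (Idt J j, v)) (P j) (p j)) \<longrightarrow>
      is_functor J C P P' \<longrightarrow>
      (\<forall>j j'. \<forall>u \<in> Hom J j j'. \<forall>k \<in> Obj K.
        p j' k \<cdot>\<^bsub>C\<^esub> P' u = D' (u, Idt K k) \<cdot>\<^bsub>C\<^esub> p j k) \<longrightarrow>
      (\<forall>k \<in> Obj K. is_colimit J C (\<lambda>j. D (j, k)) (\<lambda>u. D' (u, Idt K k)) (Q k) (q k)) \<longrightarrow>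
      is_functor K C Q Q' \<longrightarrow>
      (\<forall>k k'. \<forall>v \<in> Hom K k k'. \<forall>j \<in> Obj J.
        Q' v \<cdot>\<^bsub>C\<^esub> q k j = q k' j \<cdot>\<^bsub>C\<^esub> D' (Idt J j, v)) \<longrightarrow>
      is_colimit J C P P' X x \<longrightarrow>
      is_limit K C Q Q' Y y \<longrightarrow>
      (\<exists>c. iso_arr C X Y c \<and>
        (\<forall>j \<in> Obj J. \<forall>k \<in> Obj K. y k \<cdot>\<^bsub>C\<^esub> (c \<cdot>\<^bsub>C\<^esub> x j) = q k j \<cdot>\<^bsub>C\<^esub> p j k)))"


section \<open>Abelian categories\<close>

record ('o, 'm) add_cat = "('o, 'm) cat" +
  Add :: "'m \<Rightarrow> 'm \<Rightarrow> 'm"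
  Zero :: "'o \<Rightarrow> 'o \<Rightarrow> 'm"

definition Hom_group :: "('o, 'm, 'z) add_cat_scheme \<Rightarrow> 'o \<Rightarrow> 'o \<Rightarrow> 'm monoid" where
  "Hom_group C a b = \<lparr>carrier = Hom C a b, mult = Add C, one = Zero C a b\<rparr>"

definition is_kernel :: "('o, 'm, 'z) add_cat_scheme \<Rightarrow> 'o \<Rightarrow> 'o \<Rightarrow> 'm \<Rightarrow> 'o \<Rightarrow> 'm \<Rightarrow> bool" where
  "is_kernel C a b f n k \<longleftrightarrow> k \<in> Hom C n a \<and> f \<cdot>\<^bsub>C\<^esub> k = Zero C n b \<and>
    (\<forall>x. \<forall>g \<in> Hom C x a. f \<cdot>\<^bsub>C\<^esub> g = Zero C x b \<longrightarrow> (\<exists>!h. h \<in> Hom C x n \<and> k \<cdot>\<^bsub>C\<^esub> h = g))"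

definition is_cokernel :: "('o, 'm, 'z) add_cat_scheme \<Rightarrow> 'o \<Rightarrow> 'o \<Rightarrow> 'm \<Rightarrow> 'o \<Rightarrow> 'm \<Rightarrow> bool" where
  "is_cokernel C a b f n q \<longleftrightarrow> q \<in> Hom C b n \<and> q \<cdot>\<^bsub>C\<^esub> f = Zero C a n \<and>
    (\<forall>x. \<forall>g \<in> Hom C b x. g \<cdot>\<^bsub>C\<^esub> f = Zero C a x \<longrightarrow> (\<exists>!h. h \<in> Hom C n x \<and> h \<cdot>\<^bsub>C\<^esub> q = g))"

locale preadditive_category = category C for C :: "('o, 'm, 'z) add_cat_scheme" (structure) +
  assumes Hom_comm_group: "a \<in> Obj C \<Longrightarrow> b \<in> Obj C \<Longrightarrow> comm_group (Hom_group C a b)"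
    and Comp_Add: "f \<in> Hom C a b \<Longrightarrow> g \<in> Hom C a b \<Longrightarrow> h \<in> Hom C b c \<Longrightarrow>
      h \<cdot> Add C f g = Add C (h \<cdot> f) (h \<cdot> g)"
    and Add_Comp: "f \<in> Hom C a b \<Longrightarrow> g \<in> Hom C b c \<Longrightarrow> h \<in> Hom C b c \<Longrightarrow>
      Add C g h \<cdot> f = Add C (g \<cdot> f) (h \<cdot> f)"

locale abelian_category = preadditive_category +
  assumes zero_object: "\<exists>z \<in> Obj C. \<forall>a \<in> Obj C. (\<exists>!f. f \<in> Hom C a z) \<and> (\<exists>!f. f \<in> Hom C z a)"
    and biproducts: "a \<in> Obj C \<Longrightarrow> b \<in> Obj C \<Longrightarrow>
      \<exists>s. \<exists>i \<in> Hom C a s. \<exists>j \<in> Hom C b s. \<exists>p \<in> Hom C s a. \<exists>q \<in> Hom C s b.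
        p \<cdot> i = Idt C a \<and> q \<cdot> j = Idt C b \<and> p \<cdot> j = Zero C b a \<and> q \<cdot> i = Zero C a b \<and>
        Add C (i \<cdot> p) (j \<cdot> q) = Idt C s"
    and kernels: "f \<in> Hom C a b \<Longrightarrow> \<exists>n k. is_kernel C a b f n k"
    and cokernels: "f \<in> Hom C a b \<Longrightarrow> \<exists>n q. is_cokernel C a b f n q"
    and monic_kernel: "monic C n a k \<Longrightarrow> \<exists>b. \<exists>f \<in> Hom C a b. is_kernel C a b f n k"
    and epic_cokernel: "epic C b n q \<Longrightarrow> \<exists>a. \<exists>f \<in> Hom C a b. is_cokernel C a b f n q"


section \<open>Symmetric monoidal categories, monoids and modules\<close>

record ('o, 'm) sm_cat = "('o, 'm) add_cat" +
  TensO :: "'o \<Rightarrow> 'o \<Rightarrow> 'o"  (infixl \<open>\<boxtimes>\<index>\<close> 75)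
  TensA :: "'m \<Rightarrow> 'm \<Rightarrow> 'm"  (infixl \<open>\<boxdot>\<index>\<close> 75)
  Unit :: "'o"
  Assoc :: "'o \<Rightarrow> 'o \<Rightarrow> 'o \<Rightarrow> 'm"  \<comment> \<open>\<open>(a \<boxtimes> b) \<boxtimes> c \<rightarrow> a \<boxtimes> (b \<boxtimes> c)\<close>\<close>
  LUnit :: "'o \<Rightarrow> 'm"  \<comment> \<open>\<open>1 \<boxtimes> a \<rightarrow> a\<close>\<close>
  RUnit :: "'o \<Rightarrow> 'm"  \<comment> \<open>\<open>a \<boxtimes> 1 \<rightarrow> a\<close>\<close>
  Sym :: "'o \<Rightarrow> 'o \<Rightarrow> 'm"  \<comment> \<open>\<open>a \<boxtimes> b \<rightarrow> b \<boxtimes> a\<close>\<close>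

locale symmetric_monoidal_category = category C for C :: "('o, 'm, 'z) sm_cat_scheme" (structure) +
  assumes disjoint_homs: "disjoint_homs C"
    and TensO_Obj: "a \<in> Obj C \<Longrightarrow> b \<in> Obj C \<Longrightarrow> a \<boxtimes> b \<in> Obj C"
    and TensA_Hom: "f \<in> Hom C a b \<Longrightarrow> g \<in> Hom C c d \<Longrightarrow> f \<boxdot> g \<in> Hom C (a \<boxtimes> c) (b \<boxtimes> d)"
    and TensA_Idt: "a \<in> Obj C \<Longrightarrow> b \<in> Obj C \<Longrightarrow> Idt C a \<boxdot> Idt C b = Idt C (a \<boxtimes> b)"
    and TensA_Comp: "f \<in> Hom C a b \<Longrightarrow> f' \<in> Hom C b c \<Longrightarrow> g \<in> Hom C a' b' \<Longrightarrow> g' \<in> Hom C b' c' \<Longrightarrow>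
      (f' \<cdot> f) \<boxdot> (g' \<cdot> g) = (f' \<boxdot> g') \<cdot> (f \<boxdot> g)"
    and Unit_Obj: "Unit C \<in> Obj C"
    and Assoc_iso: "a \<in> Obj C \<Longrightarrow> b \<in> Obj C \<Longrightarrow> c \<in> Obj C \<Longrightarrow>
      iso_arr C ((a \<boxtimes> b) \<boxtimes> c) (a \<boxtimes> (b \<boxtimes> c)) (Assoc C a b c)"
    and LUnit_iso: "a \<in> Obj C \<Longrightarrow> iso_arr C (Unit C \<boxtimes> a) a (LUnit C a)"
    and RUnit_iso: "a \<in> Obj C \<Longrightarrow> iso_arr C (a \<boxtimes> Unit C) a (RUnit C a)"
    and Sym_Hom: "a \<in> Obj C \<Longrightarrow> b \<in> Obj C \<Longrightarrow> Sym C a b \<in> Hom C (a \<boxtimes> b) (b \<boxtimes> a)"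
    and Assoc_natural: "f \<in> Hom C a a' \<Longrightarrow> g \<in> Hom C b b' \<Longrightarrow> h \<in> Hom C c c' \<Longrightarrow>
      Assoc C a' b' c' \<cdot> ((f \<boxdot> g) \<boxdot> h) = (f \<boxdot> (g \<boxdot> h)) \<cdot> Assoc C a b c"
    and LUnit_natural: "f \<in> Hom C a b \<Longrightarrow> LUnit C b \<cdot> (Idt C (Unit C) \<boxdot> f) = f \<cdot> LUnit C a"
    and RUnit_natural: "f \<in> Hom C a b \<Longrightarrow> RUnit C b \<cdot> (f \<boxdot> Idt C (Unit C)) = f \<cdot> RUnit C a"
    and Sym_natural: "f \<in> Hom C a a' \<Longrightarrow> g \<in> Hom C b b' \<Longrightarrow>
      Sym C a' b' \<cdot> (f \<boxdot> g) = (g \<boxdot> f) \<cdot> Sym C a b"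
    and pentagon: "a \<in> Obj C \<Longrightarrow> b \<in> Obj C \<Longrightarrow> c \<in> Obj C \<Longrightarrow> d \<in> Obj C \<Longrightarrow>
      Assoc C a b (c \<boxtimes> d) \<cdot> Assoc C (a \<boxtimes> b) c d =
      (Idt C a \<boxdot> Assoc C b c d) \<cdot> (Assoc C a (b \<boxtimes> c) d \<cdot> (Assoc C a b c \<boxdot> Idt C d))"
    and triangle: "a \<in> Obj C \<Longrightarrow> b \<in> Obj C \<Longrightarrow>
      (Idt C a \<boxdot> LUnit C b) \<cdot> Assoc C a (Unit C) b = RUnit C a \<boxdot> Idt C b"
    and hexagon: "a \<in> Obj C \<Longrightarrow> b \<in> Obj C \<Longrightarrow> c \<in> Obj C \<Longrightarrow>
      Assoc C b c a \<cdot> (Sym C a (b \<boxtimes> c) \<cdot> Assoc C a b c) =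
      (Idt C b \<boxdot> Sym C a c) \<cdot> (Assoc C b a c \<cdot> (Sym C a b \<boxdot> Idt C c))"
    and Sym_Sym: "a \<in> Obj C \<Longrightarrow> b \<in> Obj C \<Longrightarrow> Sym C b a \<cdot> Sym C a b = Idt C (a \<boxtimes> b)"

definition tensor_preserves_colimits :: "'u set \<Rightarrow> ('o, 'm, 'z) sm_cat_scheme \<Rightarrow> bool" where
  "tensor_preserves_colimits U C \<longleftrightarrow>
    (\<forall>X \<in> Obj C. \<forall>(J :: ('u, 'u) cat) F F' L l.
      small_cat U J \<longrightarrow> is_functor J C F F' \<longrightarrow> is_colimit J C F F' L l \<longrightarrow>
      is_colimit J C (\<lambda>i. F i \<boxtimes>\<^bsub>C\<^esub> X) (\<lambda>u. F' u \<boxdot>\<^bsub>C\<^esub> Idt C X)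
        (L \<boxtimes>\<^bsub>C\<^esub> X) (\<lambda>i. l i \<boxdot>\<^bsub>C\<^esub> Idt C X))"

record ('o, 'm) mon =
  mobj :: 'o
  mmul :: 'm
  munit :: 'm

definition is_comm_monoid :: "('o, 'm, 'z) sm_cat_scheme \<Rightarrow> ('o, 'm) mon \<Rightarrow> bool" where
  "is_comm_monoid C A \<longleftrightarrow> mobj A \<in> Obj C \<and>
    mmul A \<in> Hom C (mobj A \<boxtimes>\<^bsub>C\<^esub> mobj A) (mobj A) \<and>
    munit A \<in> Hom C (Unit C) (mobj A) \<and>
    mmul A \<cdot>\<^bsub>C\<^esub> (mmul A \<boxdot>\<^bsub>C\<^esub> Idt C (mobj A)) =
      mmul A \<cdot>\<^bsub>C\<^esub> ((Idt C (mobj A) \<boxdot>\<^bsub>C\<^esub> mmul A) \<cdot>\<^bsub>C\<^esub> Assoc C (mobj A) (mobj A) (mobj A)) \<and>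
    mmul A \<cdot>\<^bsub>C\<^esub> (munit A \<boxdot>\<^bsub>C\<^esub> Idt C (mobj A)) = LUnit C (mobj A) \<and>
    mmul A \<cdot>\<^bsub>C\<^esub> (Idt C (mobj A) \<boxdot>\<^bsub>C\<^esub> munit A) = RUnit C (mobj A) \<and>
    mmul A \<cdot>\<^bsub>C\<^esub> Sym C (mobj A) (mobj A) = mmul A"

definition Comm :: "('o, 'm, 'z) sm_cat_scheme \<Rightarrow> (('o, 'm) mon, 'm) cat" where
  "Comm C =
    \<lparr>Obj = {A. is_comm_monoid C A},
     Hom = (\<lambda>A B. {f \<in> Hom C (mobj A) (mobj B). is_comm_monoid C A \<and> is_comm_monoid C B \<and>
       f \<cdot>\<^bsub>C\<^esub> mmul A = mmul B \<cdot>\<^bsub>C\<^esub> (f \<boxdot>\<^bsub>C\<^esub> f) \<and> f \<cdot>\<^bsub>C\<^esub> munit A = munit B}),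
     Idt = (\<lambda>A. Idt C (mobj A)),
     Comp = Comp C\<rparr>"

text \<open>A module is a pair of its underlying object \<open>fst M\<close> and its action \<open>snd M : A \<boxtimes> M \<rightarrow> M\<close>.\<close>

definition is_module :: "('o, 'm, 'z) sm_cat_scheme \<Rightarrow> ('o, 'm) mon \<Rightarrow> 'o \<times> 'm \<Rightarrow> bool" where
  "is_module C A M \<longleftrightarrow> fst M \<in> Obj C \<and>
    snd M \<in> Hom C (mobj A \<boxtimes>\<^bsub>C\<^esub> fst M) (fst M) \<and>
    snd M \<cdot>\<^bsub>C\<^esub> (mmul A \<boxdot>\<^bsub>C\<^esub> Idt C (fst M)) =
      snd M \<cdot>\<^bsub>C\<^esub> ((Idt C (mobj A) \<boxdot>\<^bsub>C\<^esub> snd M) \<cdot>\<^bsub>C\<^esub> Assoc C (mobj A) (mobj A) (fst M)) \<and>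
    snd M \<cdot>\<^bsub>C\<^esub> (munit A \<boxdot>\<^bsub>C\<^esub> Idt C (fst M)) = LUnit C (fst M)"

definition Mod_cat :: "('o, 'm, 'z) sm_cat_scheme \<Rightarrow> ('o, 'm) mon \<Rightarrow> ('o \<times> 'm, 'm) add_cat" where
  "Mod_cat C A =
    \<lparr>Obj = {M. is_module C A M},
     Hom = (\<lambda>M N. {f \<in> Hom C (fst M) (fst N). is_module C A M \<and> is_module C A N \<and>
       f \<cdot>\<^bsub>C\<^esub> snd M = snd N \<cdot>\<^bsub>C\<^esub> (Idt C (mobj A) \<boxdot>\<^bsub>C\<^esub> f)}),
     Idt = (\<lambda>M. Idt C (fst M)),
     Comp = Comp C,
     Add = Add C,
     Zero = (\<lambda>M N. Zero C (fst M) (fst N))\<rparr>"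

definition regular_module :: "('o, 'm) mon \<Rightarrow> 'o \<times> 'm" where
  "regular_module A = (mobj A, mmul A)"

text \<open>A commutative monoid \<open>B\<close> as an \<open>A\<close>-module along a morphism of monoids \<open>f : A \<rightarrow> B\<close>.\<close>

definition algebra_module :: "('o, 'm, 'z) sm_cat_scheme \<Rightarrow> ('o, 'm) mon \<Rightarrow> 'm \<Rightarrow> 'o \<times> 'm" where
  "algebra_module C B f = (mobj B, mmul B \<cdot>\<^bsub>C\<^esub> (f \<boxdot>\<^bsub>C\<^esub> Idt C (mobj B)))"

definition End_ring :: "('o, 'm, 'z) sm_cat_scheme \<Rightarrow> ('o, 'm) mon \<Rightarrow> 'm ring" where
  "End_ring C A =
    \<lparr>carrier = Hom (Mod_cat C A) (regular_module A) (regular_module A),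
     mult = Comp (Mod_cat C A),
     one = Idt (Mod_cat C A) (regular_module A),
     zero = Zero (Mod_cat C A) (regular_module A) (regular_module A),
     add = Add (Mod_cat C A)\<rparr>"


section \<open>Standing assumptions\<close>

text \<open>\<open>X\<close> is a free module \<open>A\<^sup>r\<close>, i.e. a coproduct of \<open>r\<close> copies of \<open>A\<close>.\<close>

definition is_free_module ::
  "('o, 'm, 'z) sm_cat_scheme \<Rightarrow> ('o, 'm) mon \<Rightarrow> nat \<Rightarrow> 'o \<times> 'm \<Rightarrow> bool" where
  "is_free_module C A r X \<longleftrightarrow>
    (\<exists>i. is_colimit (discrete_cat {..<r}) (Mod_cat C A) (\<lambda>_. regular_module A)
      (\<lambda>_. Idt (Mod_cat C A) (regular_module A)) X i)"

text \<open>
  For a finite index category \<open>J\<close>, \<open>colim\<^sub>i Hom(N, F i)\<close> in the category of abelian groups: the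
  direct sum of the \<open>Hom(N, F i)\<close>, modulo the subgroup generated by the differences of \<open>f\<close> in the
  \<open>i\<close>-th summand and \<open>F' u \<cdot> f\<close> in the \<open>j\<close>-th summand, for \<open>u : i \<rightarrow> j\<close>.
\<close>

definition Hom_sum ::
  "('o, 'm, 'z) add_cat_scheme \<Rightarrow> 'o \<Rightarrow> ('i, 'j) cat \<Rightarrow> ('i \<Rightarrow> 'o) \<Rightarrow> ('i \<Rightarrow> 'm) monoid" where
  "Hom_sum C N J F = sum_group (Obj J) (\<lambda>i. Hom_group C N (F i))"

definition Hom_sum_inj ::
  "('o, 'm, 'z) add_cat_scheme \<Rightarrow> 'o \<Rightarrow> ('i, 'j) cat \<Rightarrow> ('i \<Rightarrow> 'o) \<Rightarrow> 'i \<Rightarrow> 'm \<Rightarrow> 'i \<Rightarrow> 'm" where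
  "Hom_sum_inj C N J F i f = (\<lambda>k \<in> Obj J. if k = i then f else Zero C N (F k))"

definition colim_Hom_Ab ::
  "('o, 'm, 'z) add_cat_scheme \<Rightarrow> 'o \<Rightarrow> ('i, 'j) cat \<Rightarrow> ('i \<Rightarrow> 'o) \<Rightarrow> ('j \<Rightarrow> 'm)
    \<Rightarrow> ('i \<Rightarrow> 'm) set monoid" where
  "colim_Hom_Ab C N J F F' =
    Hom_sum C N J F Mod
      generate (Hom_sum C N J F)
        {Hom_sum_inj C N J F i f \<otimes>\<^bsub>Hom_sum C N J F\<^esub>
          inv\<^bsub>Hom_sum C N J F\<^esub> (Hom_sum_inj C N J F j (F' u \<cdot>\<^bsub>C\<^esub> f)) | i j u f.
          u \<in> Hom J i j \<and> f \<in> Hom C N (F i)}"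

text \<open>
  The canonical map \<open>colim\<^sub>i Hom(N, F i) \<rightarrow> Hom(N, L)\<close>; the homomorphism \<open>x \<mapsto> \<Sum>\<^sub>i l i \<cdot> x i\<close>
  is constant on cosets.
\<close>

definition colim_Hom_Ab_map ::
  "('o, 'm, 'z) add_cat_scheme \<Rightarrow> 'o \<Rightarrow> ('i, 'j) cat \<Rightarrow> 'o \<Rightarrow> ('i \<Rightarrow> 'm)
    \<Rightarrow> ('i \<Rightarrow> 'm) set \<Rightarrow> 'm" where
  "colim_Hom_Ab_map C N J L l X =
    the_elem ((\<lambda>x. finprod (Hom_group C N L) (\<lambda>i. l i \<cdot>\<^bsub>C\<^esub> x i) (Obj J)) ` X)"

text \<open>
  The locally small category \<open>C\<close> with all assumptions made on it. For finite, not necessarily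
  filtered, systems of free modules the colimit of the groups \<open>Hom(A, A\<^sup>r)\<close> is that of abelian
  groups.
\<close>

locale base_category = abelian_category C + symmetric_monoidal_category C
  for U :: "'u set" and C :: "('o, 'm) sm_cat" (structure) +
  assumes universe: "universe U"
    and locally_small: "Hom C a b \<prec> U"
    and small_limits: "has_small_limits U C"
    and small_colimits: "has_small_colimits U C"
    and tensor_colimits: "tensor_preserves_colimits U C"
    and filtered_finite: "A \<in> Obj (Comm C) \<Longrightarrow>
      filtered_colimits_commute_with_finite_limits U (Mod_cat C A)"
    and C1_unit: "Hom_preserves_filtered_colimits U C (Unit C)"
    and C1_free: "A \<in> Obj (Comm C) \<Longrightarrow> finite_cat (J :: ('u, 'u) cat) \<Longrightarrow>
      is_functor J (Mod_cat C A) F F' \<Longrightarrow> (\<And>i. i \<in> Obj J \<Longrightarrow> is_free_module C A (r i) (F i)) \<Longrightarrow>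
      is_colimit J (Mod_cat C A) F F' L l \<Longrightarrow>
      colim_Hom_Ab_map (Mod_cat C A) (regular_module A) J L l \<in>
        iso (colim_Hom_Ab (Mod_cat C A) (regular_module A) J F F')
          (Hom_group (Mod_cat C A) (regular_module A) L)"
    and C2: "A \<in> Obj (Comm C) \<Longrightarrow> M \<in> Obj (Mod_cat C A) \<Longrightarrow>
      \<exists>(J :: ('u, 'u) cat) F F' l. small_cat U J \<and> directed J \<and> is_functor J (Mod_cat C A) F F' \<and>
        (\<forall>i \<in> Obj J. finitely_presented U (Mod_cat C A) (F i)) \<and>
        is_colimit J (Mod_cat C A) F F' M l"


section \<open>Quotients and Noetherian monoids\<close>

text \<open>
  \<open>Q\<close> with \<open>q : A \<rightarrow> Q\<close> is a quotient \<open>A/tA\<close>: a cokernel of \<open>t\<close> in the category of \<open>A\<close>-modules,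
  together with the commutative monoid structure making \<open>q\<close> a morphism of monoids. That structure is
  unique, and the \<open>A\<close>-action on the cokernel is necessarily the one along \<open>q\<close>.
\<close>

definition is_quotient_by ::
  "('o, 'm, 'z) sm_cat_scheme \<Rightarrow> ('o, 'm) mon \<Rightarrow> 'm \<Rightarrow> ('o, 'm) mon \<Rightarrow> 'm \<Rightarrow> bool" where
  "is_quotient_by C A t Q q \<longleftrightarrow> q \<in> Hom (Comm C) A Q \<and>
    is_cokernel (Mod_cat C A) (regular_module A) (regular_module A) t (algebra_module C Q q) q"

text \<open>
  \<open>B\<close> is a quotient \<open>A/I\<close>: a colimit, in the category of commutative monoids, of the diagram
  formed by canonical morphisms \<open>q t : A \<rightarrow> Q t = A/tA\<close>, one for every \<open>t \<in> I\<close>.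
\<close>

definition is_ideal_quotient ::
  "('o, 'm, 'z) sm_cat_scheme \<Rightarrow> ('o, 'm) mon \<Rightarrow> 'm set \<Rightarrow> ('o, 'm) mon \<Rightarrow> bool" where
  "is_ideal_quotient C A I B \<longleftrightarrow>
    (\<exists>Q q l. (\<forall>t \<in> I. is_quotient_by C A t (Q t) (q t)) \<and>
      is_colimit (fan_cat I) (Comm C)
        (\<lambda>i. case i of None \<Rightarrow> A | Some t \<Rightarrow> Q t)
        (\<lambda>(i, j). case (i, j) of
            (None, None) \<Rightarrow> Idt (Comm C) A
          | (None, Some t) \<Rightarrow> q t
          | (Some t, _) \<Rightarrow> Idt (Comm C) (Q t))
        B l)"

definition noetherian :: "'u set \<Rightarrow> ('o, 'm, 'z) sm_cat_scheme \<Rightarrow> ('o, 'm) mon \<Rightarrow> bool" where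
  "noetherian U C A \<longleftrightarrow> A \<in> Obj (Comm C) \<and>
    (\<forall>N i. monic (Mod_cat C A) N (regular_module A) i \<longrightarrow> finitely_generated U (Mod_cat C A) N)"

end

(*
  Both A -> A/tA and A -> B = A/I are epic in the base category: their images are again modules,
  respectively monoids, so by the universal property of the target the inclusion of the image has
  a section. Let N be a submodule of B over B and P its preimage in A. Restriction of scalars along
  A -> B is fully faithful and preserves colimits and monomorphisms, P is a subobject of A with
  quotient N, and the kernel K of P -> N is a subobject of A as well. As P and K are finitely
  generated over A, a map from N to a filtered colimit of monomorphisms factors on P through a
  stage, and this factorization vanishes on K, so it descends to N.
*)

theory Submission
  imports Defs
begin

section \<open>Arrows with source and target\<close>

text \<open>The universal properties make \<open>A -> A/tA\<close> and \<open>A -> B\<close> epic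
  only among modules and among monoids, and an epimorphism of monoids need not be surjective, as
  localizations of commutative rings show. Pulling a submodule of \<open>B\<close> back to a
  submodule of \<open>A\<close> that maps onto it requires an epimorphism of the base category; this
  is the purpose of the two image arguments. They work because tensoring preserves epimorphisms, so
  that actions and multiplications pass to images by orthogonality of epic and monic arrows. A
  second obstacle is that finite generation asks for a bijection. The factorization \<open>h\<close>
  on \<open>P\<close> is known to kill \<open>K\<close> only after passing to the colimit, and the
  arrows into the colimit are not shown to be monic. Injectivity for \<open>K\<close>, applied to
  \<open>h\<close> on \<open>K\<close> and the zero arrow at the same stage, takes the place of
  that. Injectivity for \<open>N\<close> is obtained from the one for \<open>P\<close> by descending
  a whole chain of steps from \<open>P\<close> to \<open>N\<close>.\<close>

context symmetric_monoidal_category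
begin

text \<open>Stated with \<open>arr\<close>, \<open>src\<close> and \<open>tgt\<close>,
  well-typedness becomes a side condition that the simplifier can discharge. Disjointness of the
  hom-sets makes source and target functions of the arrow alone.\<close>

definition arr :: "'m \<Rightarrow> bool" where
  "arr f \<longleftrightarrow> (\<exists>a b. f \<in> Hom C a b)"

definition src :: "'m \<Rightarrow> 'o" where
  "src f = (THE a. \<exists>b. f \<in> Hom C a b)"

definition tgt :: "'m \<Rightarrow> 'o" where
  "tgt f = (THE b. \<exists>a. f \<in> Hom C a b)"

lemma Hom_unique: "f \<in> Hom C a b \<Longrightarrow> f \<in> Hom C a' b' \<Longrightarrow> a = a' \<and> b = b'"
  using disjoint_homs unfolding disjoint_homs_def by blast

lemma in_Hom_src_tgt:
  assumes "f \<in> Hom C a b"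
  shows "src f = a" "tgt f = b"
  unfolding src_def tgt_def using assms Hom_unique by (blast intro: the_equality)+

lemma in_Hom_iff: "f \<in> Hom C a b \<longleftrightarrow> arr f \<and> src f = a \<and> tgt f = b"
  using in_Hom_src_tgt by (auto simp: arr_def)

lemma arr_Hom: "arr f \<Longrightarrow> f \<in> Hom C (src f) (tgt f)"
  by (simp add: in_Hom_iff)

lemma src_Obj [simp]: "arr f \<Longrightarrow> src f \<in> Obj C"
  and tgt_Obj [simp]: "arr f \<Longrightarrow> tgt f \<in> Obj C"
  using Hom_Obj arr_Hom by blast+

lemma arr_Idt [simp]:
  assumes "a \<in> Obj C"
  shows "arr (Idt C a)" "src (Idt C a) = a" "tgt (Idt C a) = a"
  using Idt_Hom[OF assms] by (simp_all add: in_Hom_iff)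

lemma arr_Comp [simp]:
  assumes "arr f" "arr g" "tgt f = src g"
  shows "arr (g \<cdot> f)" "src (g \<cdot> f) = src f" "tgt (g \<cdot> f) = tgt g"
  using Comp_Hom[of f "src f" "src g" g "tgt g"] assms by (simp_all add: in_Hom_iff)

lemma Comp_Idt_arr [simp]: "arr f \<Longrightarrow> src f = a \<Longrightarrow> f \<cdot> Idt C a = f"
  using Comp_Idt arr_Hom by blast

lemma Idt_Comp_arr [simp]: "arr f \<Longrightarrow> tgt f = a \<Longrightarrow> Idt C a \<cdot> f = f"
  using Idt_Comp arr_Hom by blast

lemma Comp_assoc_arr [simp]:
  "arr f \<Longrightarrow> arr g \<Longrightarrow> arr h \<Longrightarrow> tgt f = src g \<Longrightarrow> tgt g = src h \<Longrightarrow>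
    (h \<cdot> g) \<cdot> f = h \<cdot> (g \<cdot> f)"
  using Comp_assoc[of f "src f" "src g" g "src h" h "tgt h"] by (simp add: in_Hom_iff)

text \<open>Composites are rewritten to be right-nested, so a known value of
  \<open>g \<cdot> f\<close> no longer occurs literally once a further arrow \<open>x\<close> is
  precomposed.\<close>

lemma Comp_extend:
  "g \<cdot> f = k \<Longrightarrow> arr f \<Longrightarrow> arr g \<Longrightarrow> arr x \<Longrightarrow> tgt x = src f \<Longrightarrow> tgt f = src g \<Longrightarrow>
    g \<cdot> (f \<cdot> x) = k \<cdot> x"
  by (metis Comp_assoc_arr)

lemma monicD:
  assumes "monic C a b m"
  shows "arr m" "src m = a" "tgt m = b"
  using assms by (auto simp: monic_def in_Hom_iff)

lemma monic_cancel:
  "monic C a b m \<Longrightarrow> m \<cdot> g = m \<cdot> h \<Longrightarrow> arr g \<Longrightarrow> arr h \<Longrightarrow> src g = src h \<Longrightarrow>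
    tgt g = a \<Longrightarrow> tgt h = a \<Longrightarrow> g = h"
  unfolding monic_def by (metis arr_Hom)

lemma epicI:
  assumes "arr e" "src e = a" "tgt e = b"
    and "\<And>g h. arr g \<Longrightarrow> arr h \<Longrightarrow> tgt g = tgt h \<Longrightarrow> src g = b \<Longrightarrow> src h = b \<Longrightarrow>
      g \<cdot> e = h \<cdot> e \<Longrightarrow> g = h"
  shows "epic C a b e"
  unfolding epic_def using assms by (auto simp: in_Hom_iff)

lemma epicD:
  assumes "epic C a b e"
  shows "arr e" "src e = a" "tgt e = b"
  using assms by (auto simp: epic_def in_Hom_iff)

lemma epic_cancel:
  "epic C a b e \<Longrightarrow> g \<cdot> e = h \<cdot> e \<Longrightarrow> arr g \<Longrightarrow> arr h \<Longrightarrow> tgt g = tgt h \<Longrightarrow>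
    src g = b \<Longrightarrow> src h = b \<Longrightarrow> g = h"
  unfolding epic_def by (metis arr_Hom)

lemma TensO_Obj' [simp]: "a \<in> Obj C \<Longrightarrow> b \<in> Obj C \<Longrightarrow> a \<boxtimes> b \<in> Obj C"
  by (rule TensO_Obj)

lemma arr_TensA [simp]:
  assumes "arr f" "arr g"
  shows "arr (f \<boxdot> g)" "src (f \<boxdot> g) = src f \<boxtimes> src g" "tgt (f \<boxdot> g) = tgt f \<boxtimes> tgt g"
  using TensA_Hom[OF arr_Hom[OF assms(1)] arr_Hom[OF assms(2)]] by (simp_all add: in_Hom_iff)

lemma TensA_Idt' [simp]: "a \<in> Obj C \<Longrightarrow> b \<in> Obj C \<Longrightarrow> Idt C a \<boxdot> Idt C b = Idt C (a \<boxtimes> b)"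
  by (rule TensA_Idt)

lemma interchange [simp]:
  "arr f \<Longrightarrow> arr f' \<Longrightarrow> arr g \<Longrightarrow> arr g' \<Longrightarrow> tgt f = src f' \<Longrightarrow> tgt g = src g' \<Longrightarrow>
    (f' \<boxdot> g') \<cdot> (f \<boxdot> g) = (f' \<cdot> f) \<boxdot> (g' \<cdot> g)"
  using TensA_Comp[of f "src f" "src f'" f' "tgt f'" g "src g" "src g'" g' "tgt g'"]
  by (simp add: in_Hom_iff)

lemma interchange_extend [simp]:
  assumes "arr f" "arr f'" "arr g" "arr g'" "tgt f = src f'" "tgt g = src g'"
    "arr x" "tgt x = src f \<boxtimes> src g"
  shows "(f' \<boxdot> g') \<cdot> ((f \<boxdot> g) \<cdot> x) = ((f' \<cdot> f) \<boxdot> (g' \<cdot> g)) \<cdot> x"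
  using assms by (intro Comp_extend) simp_all

lemma Unit_Obj' [simp]: "Unit C \<in> Obj C"
  by (rule Unit_Obj)

lemma arr_Assoc [simp]:
  assumes "a \<in> Obj C" "b \<in> Obj C" "c \<in> Obj C"
  shows "arr (Assoc C a b c)" "src (Assoc C a b c) = (a \<boxtimes> b) \<boxtimes> c"
    "tgt (Assoc C a b c) = a \<boxtimes> (b \<boxtimes> c)"
  using Assoc_iso[OF assms] by (simp_all add: iso_arr_def in_Hom_iff)

lemma arr_LUnit [simp]:
  assumes "a \<in> Obj C"
  shows "arr (LUnit C a)" "src (LUnit C a) = Unit C \<boxtimes> a" "tgt (LUnit C a) = a"
  using LUnit_iso[OF assms] by (simp_all add: iso_arr_def in_Hom_iff)

lemma arr_RUnit [simp]:
  assumes "a \<in> Obj C"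
  shows "arr (RUnit C a)" "src (RUnit C a) = a \<boxtimes> Unit C" "tgt (RUnit C a) = a"
  using RUnit_iso[OF assms] by (simp_all add: iso_arr_def in_Hom_iff)

lemma arr_Sym [simp]:
  assumes "a \<in> Obj C" "b \<in> Obj C"
  shows "arr (Sym C a b)" "src (Sym C a b) = a \<boxtimes> b" "tgt (Sym C a b) = b \<boxtimes> a"
  using Sym_Hom[OF assms] by (simp_all add: in_Hom_iff)

lemma Assoc_natural_arr:
  "arr f \<Longrightarrow> arr g \<Longrightarrow> arr h \<Longrightarrow> tgt f = a \<Longrightarrow> tgt g = b \<Longrightarrow> tgt h = c \<Longrightarrow>
    Assoc C a b c \<cdot> ((f \<boxdot> g) \<boxdot> h) = (f \<boxdot> (g \<boxdot> h)) \<cdot> Assoc C (src f) (src g) (src h)"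
  using Assoc_natural arr_Hom by blast

lemma Sym_natural_arr:
  "arr f \<Longrightarrow> arr g \<Longrightarrow> tgt f = a \<Longrightarrow> tgt g = b \<Longrightarrow>
    Sym C a b \<cdot> (f \<boxdot> g) = (g \<boxdot> f) \<cdot> Sym C (src f) (src g)"
  using Sym_natural arr_Hom by blast

lemma LUnit_natural_arr:
  "arr f \<Longrightarrow> tgt f = b \<Longrightarrow> LUnit C b \<cdot> (Idt C (Unit C) \<boxdot> f) = f \<cdot> LUnit C (src f)"
  using LUnit_natural arr_Hom by blast

lemma RUnit_natural_arr:
  "arr f \<Longrightarrow> tgt f = b \<Longrightarrow> RUnit C b \<cdot> (f \<boxdot> Idt C (Unit C)) = f \<cdot> RUnit C (src f)"
  using RUnit_natural arr_Hom by blast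

end


section \<open>Abelian categories\<close>

context preadditive_category
begin

lemma Zero_Hom: "a \<in> Obj C \<Longrightarrow> b \<in> Obj C \<Longrightarrow> Zero C a b \<in> Hom C a b"
  using comm_group.axioms(2)[OF Hom_comm_group, THEN group.is_monoid, THEN monoid.one_closed]
  by (simp add: Hom_group_def)

lemma Add_Hom:
  assumes "f \<in> Hom C a b" "g \<in> Hom C a b"
  shows "Add C f g \<in> Hom C a b"
proof -
  interpret comm_group "Hom_group C a b"
    using assms Hom_Obj Hom_comm_group by blast
  show ?thesis
    using m_closed[of f g] assms by (simp add: Hom_group_def)
qed

lemma Add_Zero:
  assumes "f \<in> Hom C a b"
  shows "Add C f (Zero C a b) = f" "Add C (Zero C a b) f = f"
proof -
  interpret comm_group "Hom_group C a b"
    using assms Hom_Obj Hom_comm_group by blast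
  show "Add C f (Zero C a b) = f" "Add C (Zero C a b) f = f"
    using r_one[of f] l_one[of f] assms by (simp_all add: Hom_group_def)
qed

lemma Add_idem_Zero:
  assumes "f \<in> Hom C a b" "Add C f f = f"
  shows "f = Zero C a b"
proof -
  interpret comm_group "Hom_group C a b"
    using assms Hom_Obj Hom_comm_group by blast
  show ?thesis
    using r_cancel_one[of f f] assms by (simp add: Hom_group_def)
qed

text \<open>By distributivity the composite added to itself is itself, and in a group only the
  neutral element has this property.\<close>

lemma Comp_Zero:
  assumes "h \<in> Hom C b c" "a \<in> Obj C"
  shows "h \<cdot> Zero C a b = Zero C a c"
proof -
  have z: "Zero C a b \<in> Hom C a b"
    using assms Hom_Obj Zero_Hom by blast
  show ?thesis
    using Add_idem_Zero[OF Comp_Hom[OF z assms(1)]] Comp_Add[OF z z assms(1)] Add_Zero(1)[OF z]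
    by simp
qed

lemma Zero_Comp:
  assumes "h \<in> Hom C a b" "c \<in> Obj C"
  shows "Zero C b c \<cdot> h = Zero C a c"
proof -
  have z: "Zero C b c \<in> Hom C b c"
    using assms Hom_Obj Zero_Hom by blast
  show ?thesis
    using Add_idem_Zero[OF Comp_Hom[OF assms(1) z]] Add_Comp[OF assms(1) z z] Add_Zero(1)[OF z]
    by simp
qed

lemma Comp_eq_Zero:
  assumes "f \<in> Hom C a b" "g \<in> Hom C b c"
  shows "f = Zero C a b \<Longrightarrow> g \<cdot> f = Zero C a c" "g = Zero C b c \<Longrightarrow> g \<cdot> f = Zero C a c"
proof -
  have "a \<in> Obj C" "c \<in> Obj C"
    using assms Hom_Obj by blast+
  then show "f = Zero C a b \<Longrightarrow> g \<cdot> f = Zero C a c" "g = Zero C b c \<Longrightarrow> g \<cdot> f = Zero C a c"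
    using Comp_Zero[OF assms(2)] Zero_Comp[OF assms(1)] by simp_all
qed

text \<open>The record has a sum but no negation; \<open>f - g\<close> is only ever used through the
  equation obtained here.\<close>

lemma difference:
  assumes "f \<in> Hom C a b" "g \<in> Hom C a b"
  obtains d where "d \<in> Hom C a b" "f = Add C d g"
proof -
  interpret comm_group "Hom_group C a b"
    using assms Hom_Obj Hom_comm_group by blast
  have "f \<otimes>\<^bsub>Hom_group C a b\<^esub> inv\<^bsub>Hom_group C a b\<^esub> g \<in> carrier (Hom_group C a b)"
    "f = (f \<otimes>\<^bsub>Hom_group C a b\<^esub> inv\<^bsub>Hom_group C a b\<^esub> g) \<otimes>\<^bsub>Hom_group C a b\<^esub> g"
    using assms by (simp_all add: Hom_group_def m_assoc[unfolded Hom_group_def, simplified]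
        inv_closed[unfolded Hom_group_def, simplified] m_closed[unfolded Hom_group_def, simplified]
        l_inv[unfolded Hom_group_def, simplified] r_one[unfolded Hom_group_def, simplified])
  then show ?thesis
    using that by (simp add: Hom_group_def)
qed

lemma Add_cancel:
  assumes "f \<in> Hom C a b" "g \<in> Hom C a b" "h \<in> Hom C a b" "Add C f h = Add C g h"
  shows "f = g"
proof -
  interpret comm_group "Hom_group C a b"
    using assms Hom_Obj Hom_comm_group by blast
  show ?thesis
    using right_cancel[of h f g] assms by (simp add: Hom_group_def)
qed

text \<open>If two arrows have the same composite with \<open>m\<close>, then \<open>m\<close> kills
  their difference.\<close>

lemma monic_if_zero:
  assumes m: "m \<in> Hom C a b"
    and zero: "\<And>x g. g \<in> Hom C x a \<Longrightarrow> m \<cdot> g = Zero C x b \<Longrightarrow> g = Zero C x a"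
  shows "monic C a b m"
  unfolding monic_def
proof (intro conjI m allI ballI impI)
  fix x g h
  assume g: "g \<in> Hom C x a" and h: "h \<in> Hom C x a" and eq: "m \<cdot> g = m \<cdot> h"
  obtain d where d: "d \<in> Hom C x a" "g = Add C d h"
    using difference[OF g h] by blast
  have mh: "m \<cdot> h \<in> Hom C x b" and md: "m \<cdot> d \<in> Hom C x b"
    using Comp_Hom m h d by blast+
  have z: "Zero C x b \<in> Hom C x b"
    using Zero_Hom Hom_Obj mh by blast
  have "Add C (m \<cdot> d) (m \<cdot> h) = Add C (Zero C x b) (m \<cdot> h)"
    using Comp_Add[OF d(1) h m] d(2) eq Add_Zero(2)[OF mh] by simp
  then have "m \<cdot> d = Zero C x b"
    using Add_cancel[OF md z mh] by blast
  then show "g = h"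
    using zero d Add_Zero(2)[OF h] by simp
qed

lemma epic_if_zero:
  assumes e: "e \<in> Hom C a b"
    and zero: "\<And>x g. g \<in> Hom C b x \<Longrightarrow> g \<cdot> e = Zero C a x \<Longrightarrow> g = Zero C b x"
  shows "epic C a b e"
  unfolding epic_def
proof (intro conjI e allI ballI impI)
  fix x g h
  assume g: "g \<in> Hom C b x" and h: "h \<in> Hom C b x" and eq: "g \<cdot> e = h \<cdot> e"
  obtain d where d: "d \<in> Hom C b x" "g = Add C d h"
    using difference[OF g h] by blast
  have he: "h \<cdot> e \<in> Hom C a x" and de: "d \<cdot> e \<in> Hom C a x"
    using Comp_Hom e h d by blast+
  have z: "Zero C a x \<in> Hom C a x"
    using Zero_Hom Hom_Obj he by blast
  have "Add C (d \<cdot> e) (h \<cdot> e) = Add C (Zero C a x) (h \<cdot> e)"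
    using Add_Comp[OF e d(1) h] d(2) eq Add_Zero(2)[OF he] by simp
  then have "d \<cdot> e = Zero C a x"
    using Add_cancel[OF de z he] by blast
  then show "g = h"
    using zero d Add_Zero(2)[OF h] by simp
qed

lemma monic_zero:
  assumes "monic C a b m" "g \<in> Hom C x a" "m \<cdot> g = Zero C x b"
  shows "g = Zero C x a"
proof -
  have "m \<in> Hom C a b"
    using assms(1) by (simp add: monic_def)
  then have "m \<cdot> Zero C x a = Zero C x b" "Zero C x a \<in> Hom C x a"
    using assms(2) Comp_Zero Zero_Hom Hom_Obj by blast+
  then show ?thesis
    using assms unfolding monic_def by metis
qed

lemma epic_zero:
  assumes "epic C a b e" "g \<in> Hom C b x" "g \<cdot> e = Zero C a x"
  shows "g = Zero C b x"
proof -
  have "e \<in> Hom C a b"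
    using assms(1) by (simp add: epic_def)
  then have "Zero C b x \<cdot> e = Zero C a x" "Zero C b x \<in> Hom C b x"
    using assms(2) Zero_Comp Zero_Hom Hom_Obj by blast+
  then show ?thesis
    using assms unfolding epic_def by metis
qed

text \<open>If \<open>k \<cdot> g\<close> is zero, then \<open>g\<close> and the zero arrow are two
  lifts of one arrow through the kernel.\<close>

lemma kernel_monic:
  assumes k: "is_kernel C a b f n k" and f: "f \<in> Hom C a b"
  shows "monic C n a k"
proof (rule monic_if_zero)
  show k': "k \<in> Hom C n a"
    using k by (simp add: is_kernel_def)
  fix x g
  assume g: "g \<in> Hom C x n" and kg: "k \<cdot> g = Zero C x a"
  have obj: "x \<in> Obj C" "n \<in> Obj C"
    using g Hom_Obj by blast+
  have kg': "k \<cdot> g \<in> Hom C x a"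
    using Comp_Hom g k' by blast
  have "f \<cdot> (k \<cdot> g) = Zero C x b"
    by (rule Comp_eq_Zero(1)[OF kg' f kg])
  then have "\<exists>!h. h \<in> Hom C x n \<and> k \<cdot> h = k \<cdot> g"
    using k kg' unfolding is_kernel_def by blast
  moreover have "Zero C x n \<in> Hom C x n" "k \<cdot> Zero C x n = k \<cdot> g"
    using Zero_Hom obj Comp_Zero[OF k' obj(1)] kg by simp_all
  ultimately show "g = Zero C x n"
    using g by blast
qed

lemma kernel_lift:
  assumes "is_kernel C a b f n k" "g \<in> Hom C x a" "f \<cdot> g = Zero C x b"
  obtains h where "h \<in> Hom C x n" "k \<cdot> h = g"
  using assms unfolding is_kernel_def by blast

lemma cokernel_extend:
  assumes "is_cokernel C a b f n q" "g \<in> Hom C b x" "g \<cdot> f = Zero C a x"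
  obtains h where "h \<in> Hom C n x" "h \<cdot> q = g"
  using assms unfolding is_cokernel_def by blast

end

section \<open>Composites of epic and of monic arrows\<close>

context category
begin

lemma epic_Comp:
  assumes "epic C a b f" "epic C b c g"
  shows "epic C a c (g \<cdot> f)"
proof -
  have f: "f \<in> Hom C a b" and g: "g \<in> Hom C b c"
    using assms by (auto simp: epic_def)
  show ?thesis
    unfolding epic_def
  proof (intro conjI Comp_Hom[OF f g] allI ballI impI)
    fix x u v
    assume u: "u \<in> Hom C c x" and v: "v \<in> Hom C c x" and "u \<cdot> (g \<cdot> f) = v \<cdot> (g \<cdot> f)"
    then have "(u \<cdot> g) \<cdot> f = (v \<cdot> g) \<cdot> f"
      using Comp_assoc[OF f g] by simp
    moreover have "u \<cdot> g \<in> Hom C b x" "v \<cdot> g \<in> Hom C b x"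
      using Comp_Hom g u v by blast+
    ultimately have "u \<cdot> g = v \<cdot> g"
      using assms(1) unfolding epic_def by blast
    then show "u = v"
      using u v assms(2) unfolding epic_def by blast
  qed
qed

lemma monic_Comp:
  assumes "monic C a b f" "monic C b c g"
  shows "monic C a c (g \<cdot> f)"
proof -
  have f: "f \<in> Hom C a b" and g: "g \<in> Hom C b c"
    using assms by (auto simp: monic_def)
  show ?thesis
    unfolding monic_def
  proof (intro conjI Comp_Hom[OF f g] allI ballI impI)
    fix x u v
    assume u: "u \<in> Hom C x a" and v: "v \<in> Hom C x a" and "(g \<cdot> f) \<cdot> u = (g \<cdot> f) \<cdot> v"
    then have "g \<cdot> (f \<cdot> u) = g \<cdot> (f \<cdot> v)"
      using Comp_assoc[OF _ f g] by simp
    moreover have "f \<cdot> u \<in> Hom C x b" "f \<cdot> v \<in> Hom C x b"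
      using Comp_Hom f u v by blast+
    ultimately have "f \<cdot> u = f \<cdot> v"
      using assms(2) unfolding monic_def by blast
    then show "u = v"
      using u v assms(1) unfolding monic_def by blast
  qed
qed

lemma split_epic:
  assumes f: "f \<in> Hom C a b" and s: "s \<in> Hom C b a" and "f \<cdot> s = Idt C b"
  shows "epic C a b f"
  unfolding epic_def
proof (intro conjI f allI ballI impI)
  fix x u v
  assume u: "u \<in> Hom C b x" and v: "v \<in> Hom C b x" and eq: "u \<cdot> f = v \<cdot> f"
  have "u \<cdot> (f \<cdot> s) = v \<cdot> (f \<cdot> s)"
    using eq Comp_assoc[OF s f u] Comp_assoc[OF s f v] by simp
  then show "u = v"
    using assms(3) Comp_Idt u v by simp
qed

end

section \<open>Colimits through existence of factorizations and joint cancellation\<close>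

lemma is_colimitI:
  assumes "is_cocone J C F F' L l"
    and "\<And>X x. is_cocone J C F F' X x \<Longrightarrow> \<exists>h \<in> Hom C L X. \<forall>i \<in> Obj J. h \<cdot>\<^bsub>C\<^esub> l i = x i"
    and "\<And>X g h. g \<in> Hom C L X \<Longrightarrow> h \<in> Hom C L X \<Longrightarrow>
      (\<And>i. i \<in> Obj J \<Longrightarrow> g \<cdot>\<^bsub>C\<^esub> l i = h \<cdot>\<^bsub>C\<^esub> l i) \<Longrightarrow> g = h"
  shows "is_colimit J C F F' L l"
  unfolding is_colimit_def
proof (intro conjI allI impI ex_ex1I)
  fix X x assume x: "is_cocone J C F F' X x"
  show "\<exists>h. h \<in> Hom C L X \<and> (\<forall>i\<in>Obj J. h \<cdot>\<^bsub>C\<^esub> l i = x i)"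
    using assms(2)[OF x] by blast
  fix g h
  assume "g \<in> Hom C L X \<and> (\<forall>i\<in>Obj J. g \<cdot>\<^bsub>C\<^esub> l i = x i)"
    and "h \<in> Hom C L X \<and> (\<forall>i\<in>Obj J. h \<cdot>\<^bsub>C\<^esub> l i = x i)"
  then show "g = h"
    using assms(3)[of g X h] by metis
qed (rule assms(1))

lemma is_colimit_cocone: "is_colimit J C F F' L l \<Longrightarrow> is_cocone J C F F' L l"
  by (simp add: is_colimit_def)

lemma colimit_factor:
  assumes "is_colimit J C F F' L l" "is_cocone J C F F' X x"
  obtains h where "h \<in> Hom C L X" "\<And>i. i \<in> Obj J \<Longrightarrow> h \<cdot>\<^bsub>C\<^esub> l i = x i"
proof -
  have "\<exists>h. h \<in> Hom C L X \<and> (\<forall>i\<in>Obj J. h \<cdot>\<^bsub>C\<^esub> l i = x i)"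
    using assms unfolding is_colimit_def by (metis (no_types, lifting))
  then show thesis
    using that by blast
qed

lemma (in category) cocone_Comp:
  assumes J: "category J" and F: "is_functor J C F F'" and l: "is_cocone J C F F' L l"
    and h: "h \<in> Hom C L X"
  shows "is_cocone J C F F' X (\<lambda>i. h \<cdot> l i)"
  unfolding is_cocone_def
proof (intro conjI allI ballI)
  show "X \<in> Obj C"
    using h Hom_Obj by blast
  show "h \<cdot> l i \<in> Hom C (F i) X" if "i \<in> Obj J" for i
    using l h that Comp_Hom unfolding is_cocone_def by blast
  fix i j u
  assume u: "u \<in> Hom J i j"
  then have "j \<in> Obj J"
    using category.Hom_Obj[OF J] by blast
  then have "l j \<in> Hom C (F j) L" "F' u \<in> Hom C (F i) (F j)" "l j \<cdot> F' u = l i"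
    using l F u unfolding is_cocone_def is_functor_def by blast+
  then show "(h \<cdot> l j) \<cdot> F' u = h \<cdot> l i"
    using Comp_assoc h by metis
qed

text \<open>The composites of \<open>g\<close> with the injections form a cocone, and both arrows
  factor it.\<close>

lemma (in category) colimit_cancel:
  assumes J: "category J" and F: "is_functor J C F F'" and l: "is_colimit J C F F' L l"
    and g: "g \<in> Hom C L X" and h: "h \<in> Hom C L X"
    and eq: "\<And>i. i \<in> Obj J \<Longrightarrow> g \<cdot> l i = h \<cdot> l i"
  shows "g = h"
proof -
  have "is_cocone J C F F' X (\<lambda>i. g \<cdot> l i)"
    using cocone_Comp[OF J F is_colimit_cocone[OF l] g] .
  then have "\<exists>!k. k \<in> Hom C L X \<and> (\<forall>i\<in>Obj J. k \<cdot> l i = g \<cdot> l i)"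
    using l unfolding is_colimit_def by blast
  then show ?thesis
    using g h eq by (metis (no_types, lifting))
qed

section \<open>Images, orthogonality and pullbacks in an abelian category\<close>

context abelian_category
begin

text \<open>The epic \<open>e\<close> is the cokernel of some \<open>w\<close>. Since
  \<open>w\<close> factors through the kernel of \<open>e\<close>, an arrow that kills this kernel
  kills \<open>w\<close>.\<close>

lemma epic_extend_kernel:
  assumes e: "epic C a b e" and k: "is_kernel C a b e n k"
    and h: "h \<in> Hom C a c" "h \<cdot> k = Zero C n c"
  obtains h' where "h' \<in> Hom C b c" "h' \<cdot> e = h"
proof -
  obtain x w where w: "w \<in> Hom C x a" and coker: "is_cokernel C x a w b e"
    using epic_cokernel[OF e] by blast
  have "e \<cdot> w = Zero C x b"
    using coker by (simp add: is_cokernel_def)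
  then obtain s where s: "s \<in> Hom C x n" "k \<cdot> s = w"
    using kernel_lift[OF k w] by blast
  have kn: "k \<in> Hom C n a"
    using k by (simp add: is_kernel_def)
  have "h \<cdot> w = (h \<cdot> k) \<cdot> s"
    using s Comp_assoc[OF s(1) kn h(1)] by simp
  then have "h \<cdot> w = Zero C x c"
    using Comp_eq_Zero(2)[OF s(1) Comp_Hom[OF kn h(1)] h(2)] by simp
  then show thesis
    using cokernel_extend[OF coker h(1)] that by blast
qed

text \<open>Write \<open>e\<close> as the cokernel of \<open>w\<close>. As
  \<open>m \<cdot> f\<close> kills \<open>w\<close> and \<open>m\<close> is monic, \<open>f\<close>
  kills it as well and extends along \<open>e\<close>. This orthogonality carries actions,
  multiplications and arrows out of quotients over to images.\<close>

lemma diagonal_filler: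
  assumes e: "epic C a b e" and m: "monic C c d m"
    and f: "f \<in> Hom C a c" and g: "g \<in> Hom C b d" and eq: "m \<cdot> f = g \<cdot> e"
  obtains h where "h \<in> Hom C b c" "h \<cdot> e = f" "m \<cdot> h = g"
proof -
  have e': "e \<in> Hom C a b" and m': "m \<in> Hom C c d"
    using e m by (simp_all add: epic_def monic_def)
  obtain x w where w: "w \<in> Hom C x a" and coker: "is_cokernel C x a w b e"
    using epic_cokernel[OF e] by blast
  have "m \<cdot> (f \<cdot> w) = g \<cdot> (e \<cdot> w)"
    using eq Comp_assoc[OF w f m'] Comp_assoc[OF w e' g] by simp
  also have "\<dots> = Zero C x d"
    using coker Comp_eq_Zero(1)[OF Comp_Hom[OF w e'] g] by (simp add: is_cokernel_def)
  finally have "f \<cdot> w = Zero C x c"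
    using monic_zero[OF m] Comp_Hom w f by blast
  then obtain h where h: "h \<in> Hom C b c" "h \<cdot> e = f"
    using cokernel_extend[OF coker f] by blast
  have "(m \<cdot> h) \<cdot> e = g \<cdot> e"
    using Comp_assoc[OF e' h(1) m'] h(2) eq by simp
  then have "m \<cdot> h = g"
    using e g Comp_Hom[OF h(1) m'] unfolding epic_def by blast
  with h show thesis
    using that by blast
qed

text \<open>The image is the kernel of the cokernel of \<open>f\<close>. The point is that the first
  factor is epic: an arrow vanishing on it has a kernel through which that factor passes, and this
  kernel turns out to be the whole image.\<close>

lemma image_factorization:
  assumes f: "f \<in> Hom C a b"
  obtains c e m where "epic C a c e" "monic C c b m" "m \<cdot> e = f"
proof -
  obtain n q where q: "is_cokernel C a b f n q"
    using cokernels[OF f] by blast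
  have q': "q \<in> Hom C b n" and qf: "q \<cdot> f = Zero C a n"
    using q by (simp_all add: is_cokernel_def)
  obtain c m where m: "is_kernel C b n q c m"
    using kernels[OF q'] by blast
  have m': "m \<in> Hom C c b" and qm: "q \<cdot> m = Zero C c n"
    using m by (simp_all add: is_kernel_def)
  note monic_m = kernel_monic[OF m q']
  obtain e where e: "e \<in> Hom C a c" "m \<cdot> e = f"
    using kernel_lift[OF m f qf] by blast
  have "epic C a c e"
  proof (rule epic_if_zero[OF e(1)])
    fix x g
    assume g: "g \<in> Hom C c x" "g \<cdot> e = Zero C a x"
    obtain p k where k: "is_kernel C c x g p k"
      using kernels[OF g(1)] by blast
    have k': "k \<in> Hom C p c" and gk: "g \<cdot> k = Zero C p x"
      using k by (simp_all add: is_kernel_def)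
    obtain e' where e': "e' \<in> Hom C a p" "k \<cdot> e' = e"
      using kernel_lift[OF k e(1) g(2)] by blast
    \<comment> \<open>\<open>m \<cdot> k\<close> is a subobject of \<open>b\<close> through which
      \<open>f\<close> factors. Being itself the kernel of some \<open>w\<close>, it contains
      everything that \<open>q\<close> kills, in particular the image.\<close>
    obtain y w where w: "w \<in> Hom C b y" and ker: "is_kernel C b y w p (m \<cdot> k)"
      using monic_kernel[OF monic_Comp[OF kernel_monic[OF k g(1)] monic_m]] by blast
    have mk: "m \<cdot> k \<in> Hom C p b"
      using Comp_Hom k' m' by blast
    have "w \<cdot> f = w \<cdot> ((m \<cdot> k) \<cdot> e')"
      using e e' Comp_assoc[OF e'(1) k' m'] by simp
    also have "\<dots> = (w \<cdot> (m \<cdot> k)) \<cdot> e'"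
      using Comp_assoc[OF e'(1) mk w] by simp
    also have "\<dots> = Zero C a y"
        using ker Comp_eq_Zero(2)[OF e'(1) Comp_Hom[OF mk w]] by (simp add: is_kernel_def)
    finally obtain w' where w': "w' \<in> Hom C n y" "w' \<cdot> q = w"
      using cokernel_extend[OF q w] by blast
    have "w \<cdot> m = w' \<cdot> (q \<cdot> m)"
      using w' Comp_assoc[OF m' q' w'(1)] by simp
    also have "\<dots> = Zero C c y"
      by (rule Comp_eq_Zero(1)[OF Comp_Hom[OF m' q'] w'(1) qm])
    finally obtain s where s: "s \<in> Hom C c p" "(m \<cdot> k) \<cdot> s = m"
      using kernel_lift[OF ker m'] by blast
    have c: "c \<in> Obj C"
      using m' Hom_Obj by blast
    have "m \<cdot> (k \<cdot> s) = m \<cdot> Idt C c"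
      using s Comp_assoc[OF s(1) k' m'] Comp_Idt[OF m'] by simp
    then have ks: "k \<cdot> s = Idt C c"
      using monic_m Comp_Hom[OF s(1) k'] Idt_Hom[OF c] unfolding monic_def by blast
    have "g = (g \<cdot> k) \<cdot> s"
      using ks Comp_assoc[OF s(1) k' g(1)] Comp_Idt[OF g(1)] by simp
    then show "g = Zero C c x"
      using Comp_eq_Zero(2)[OF s(1) Comp_Hom[OF k' g(1)] gk] by simp
  qed
  then show thesis
    using that monic_m e by blast
qed

text \<open>
  The pullback of \<open>f : a \<rightarrow> c\<close> and \<open>i : b \<rightarrow> c\<close> is the kernel \<open>K\<close> of \<open>d = (f, -i) : a \<oplus> b \<rightarrow> c\<close>.
  If \<open>f\<close> is epic, then so is \<open>d\<close>, which is therefore the cokernel of \<open>K \<rightarrow> a \<oplus> b\<close>.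
\<close>

lemma pullback_epic_monic:
  assumes f: "epic C a c f" and i: "monic C b c i"
  obtains P k p where "monic C P a k" "epic C P b p" "f \<cdot> k = i \<cdot> p"
    "\<And>x u v. u \<in> Hom C x a \<Longrightarrow> v \<in> Hom C x b \<Longrightarrow> f \<cdot> u = i \<cdot> v \<Longrightarrow>
      \<exists>w \<in> Hom C x P. k \<cdot> w = u \<and> p \<cdot> w = v"
proof -
  have f': "f \<in> Hom C a c" and i': "i \<in> Hom C b c"
    using f i by (simp_all add: epic_def monic_def)
  have a: "a \<in> Obj C" and b: "b \<in> Obj C" and c: "c \<in> Obj C"
    using f' i' Hom_Obj by blast+
  obtain s i1 i2 p1 p2 where
    i1: "i1 \<in> Hom C a s" and i2: "i2 \<in> Hom C b s" and p1: "p1 \<in> Hom C s a" and p2: "p2 \<in> Hom C s b"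
    and eqs: "p1 \<cdot> i1 = Idt C a" "p2 \<cdot> i2 = Idt C b" "p1 \<cdot> i2 = Zero C b a" "p2 \<cdot> i1 = Zero C a b"
    and sum: "Add C (i1 \<cdot> p1) (i2 \<cdot> p2) = Idt C s"
    using biproducts[OF a b] by blast
  have s: "s \<in> Obj C"
    using i1 Hom_Obj by blast
  have fp: "f \<cdot> p1 \<in> Hom C s c" and ip: "i \<cdot> p2 \<in> Hom C s c"
    using Comp_Hom f' i' p1 p2 by blast+
  \<comment> \<open>\<open>d\<close> plays the role of \<open>f \<cdot> p1 - i \<cdot> p2\<close>;
    an arrow into the biproduct is killed by it iff the two legs agree.\<close>
  obtain d where d: "d \<in> Hom C s c" and fp_eq: "f \<cdot> p1 = Add C d (i \<cdot> p2)"
    using difference[OF fp ip] by blast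
  have split: "f \<cdot> (p1 \<cdot> g) = Add C (d \<cdot> g) (i \<cdot> (p2 \<cdot> g))" if "g \<in> Hom C x s" for x g
    using Add_Comp[OF that d ip] Comp_assoc[OF that p1 f'] Comp_assoc[OF that p2 i'] fp_eq by simp
  have d_zero: "d \<cdot> g = Zero C x c \<longleftrightarrow> f \<cdot> (p1 \<cdot> g) = i \<cdot> (p2 \<cdot> g)" if g: "g \<in> Hom C x s" for x g
  proof -
    have dg: "d \<cdot> g \<in> Hom C x c" and ipg: "i \<cdot> (p2 \<cdot> g) \<in> Hom C x c"
      using Comp_Hom g d p2 i' by blast+
    have z: "Zero C x c \<in> Hom C x c"
      using Zero_Hom Hom_Obj dg by blast
    have "d \<cdot> g = Zero C x c \<longleftrightarrow> Add C (d \<cdot> g) (i \<cdot> (p2 \<cdot> g)) = Add C (Zero C x c) (i \<cdot> (p2 \<cdot> g))"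
      using Add_cancel[OF dg z ipg] by (auto simp only:)
    then show ?thesis
      unfolding split[OF g] Add_Zero(2)[OF ipg] .
  qed
  have di1: "d \<cdot> i1 = f"
    using split[OF i1] eqs Comp_Idt[OF f'] Comp_Zero[OF i' a] Add_Zero(1)[OF Comp_Hom[OF i1 d]] by simp
  have epic_d: "epic C s c d"
  proof (rule epic_if_zero[OF d])
    fix x g
    assume g: "g \<in> Hom C c x" "g \<cdot> d = Zero C s x"
    have "g \<cdot> f = Zero C a x"
      using Comp_assoc[OF i1 d g(1)] di1 Comp_eq_Zero(2)[OF i1 Comp_Hom[OF d g(1)] g(2)] by simp
    then show "g = Zero C c x"
      using epic_zero[OF f g(1)] by blast
  qed
  obtain P \<kappa> where ker: "is_kernel C s c d P \<kappa>"
    using kernels[OF d] by blast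
  have \<kappa>: "\<kappa> \<in> Hom C P s" and d\<kappa>: "d \<cdot> \<kappa> = Zero C P c"
    using ker by (simp_all add: is_kernel_def)
  define k p where "k = p1 \<cdot> \<kappa>" and "p = p2 \<cdot> \<kappa>"
  have k: "k \<in> Hom C P a" and p: "p \<in> Hom C P b"
    unfolding k_def p_def using Comp_Hom \<kappa> p1 p2 by blast+
  have fk: "f \<cdot> k = i \<cdot> p"
    unfolding k_def p_def using d_zero[OF \<kappa>] d\<kappa> by simp
  have decomp: "g = Add C (i1 \<cdot> (p1 \<cdot> g)) (i2 \<cdot> (p2 \<cdot> g))" if g: "g \<in> Hom C x s" for x g
    using Add_Comp[OF g Comp_Hom[OF p1 i1] Comp_Hom[OF p2 i2]] sum Idt_Comp[OF g]
      Comp_assoc[OF g p1 i1] Comp_assoc[OF g p2 i2] by simp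
  have "monic C P a k"
    unfolding monic_def
  proof (intro conjI k allI ballI impI)
    fix x g h
    assume g: "g \<in> Hom C x P" and h: "h \<in> Hom C x P" and eq: "k \<cdot> g = k \<cdot> h"
    \<comment> \<open>As \<open>i\<close> is monic, the component in \<open>b\<close> is determined
      by the one in \<open>a\<close>.\<close>
    have "i \<cdot> (p \<cdot> g) = i \<cdot> (p \<cdot> h)"
      using eq fk Comp_assoc[OF g k f'] Comp_assoc[OF h k f'] Comp_assoc[OF g p i']
        Comp_assoc[OF h p i'] by simp
    then have "p \<cdot> g = p \<cdot> h"
      using i Comp_Hom[OF g p] Comp_Hom[OF h p] unfolding monic_def by blast
    then have "p1 \<cdot> (\<kappa> \<cdot> g) = p1 \<cdot> (\<kappa> \<cdot> h)" "p2 \<cdot> (\<kappa> \<cdot> g) = p2 \<cdot> (\<kappa> \<cdot> h)"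
      using eq Comp_assoc[OF g \<kappa> p1] Comp_assoc[OF h \<kappa> p1] Comp_assoc[OF g \<kappa> p2]
        Comp_assoc[OF h \<kappa> p2] by (simp_all add: k_def p_def)
    then have "\<kappa> \<cdot> g = \<kappa> \<cdot> h"
      using decomp[OF Comp_Hom[OF g \<kappa>]] decomp[OF Comp_Hom[OF h \<kappa>]] by presburger
    then show "g = h"
      using kernel_monic[OF ker d] g h unfolding monic_def by blast
  qed
  moreover have "epic C P b p"
  proof (rule epic_if_zero[OF p])
    fix x g
    assume g: "g \<in> Hom C b x" "g \<cdot> p = Zero C P x"
    have gp2: "g \<cdot> p2 \<in> Hom C s x"
      using Comp_Hom p2 g by blast
    have "(g \<cdot> p2) \<cdot> \<kappa> = Zero C P x"
      using Comp_assoc[OF \<kappa> p2 g(1)] g(2) by (simp add: p_def)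
    \<comment> \<open>\<open>g \<cdot> p2\<close> vanishes on the kernel of the epic
      \<open>d\<close>, so it factors through \<open>d\<close>. It also vanishes on
      \<open>i1\<close>, where \<open>d\<close> restricts to the epic \<open>f\<close>; hence
      \<open>h\<close> is zero, and restricting to \<open>i2\<close> shows that \<open>g\<close> is
      zero.\<close>
    then obtain h where h: "h \<in> Hom C c x" "h \<cdot> d = g \<cdot> p2"
      using epic_extend_kernel[OF epic_d ker gp2] by blast
    have "h \<cdot> f = (g \<cdot> p2) \<cdot> i1"
      using h di1 Comp_assoc[OF i1 d h(1)] by simp
    also have "\<dots> = Zero C a x"
      using Comp_assoc[OF i1 p2 g(1)] eqs(4) Comp_Zero[OF g(1) a] by simp
    finally have "h = Zero C c x"
      using epic_zero[OF f h(1)] by blast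
    then have "g \<cdot> p2 = Zero C s x"
      using h Comp_eq_Zero(2)[OF d h(1)] by simp
    then have "(g \<cdot> p2) \<cdot> i2 = Zero C b x"
      using Comp_eq_Zero(2)[OF i2 gp2] by simp
    then show "g = Zero C b x"
      using Comp_assoc[OF i2 p2 g(1)] eqs(2) Comp_Idt[OF g(1)] by simp
  qed
  moreover have "\<exists>w \<in> Hom C x P. k \<cdot> w = u \<and> p \<cdot> w = v"
    if u: "u \<in> Hom C x a" and v: "v \<in> Hom C x b" and eq: "f \<cdot> u = i \<cdot> v" for x u v
  proof -
    define z where "z = Add C (i1 \<cdot> u) (i2 \<cdot> v)"
    have iu: "i1 \<cdot> u \<in> Hom C x s" and iv: "i2 \<cdot> v \<in> Hom C x s"
      using Comp_Hom u v i1 i2 by blast+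
    have z: "z \<in> Hom C x s"
      unfolding z_def by (rule Add_Hom[OF iu iv])
    have p1z: "p1 \<cdot> z = u"
      using Comp_Add[OF iu iv p1] Comp_assoc[OF u i1 p1] Comp_assoc[OF v i2 p1] eqs
        Idt_Comp[OF u] Zero_Comp[OF v a] Add_Zero[OF u] by (simp add: z_def)
    have p2z: "p2 \<cdot> z = v"
      using Comp_Add[OF iu iv p2] Comp_assoc[OF u i1 p2] Comp_assoc[OF v i2 p2] eqs
        Idt_Comp[OF v] Zero_Comp[OF u b] Add_Zero[OF v] by (simp add: z_def)
    have "d \<cdot> z = Zero C x c"
      using d_zero[OF z] p1z p2z eq by simp
    then obtain w where w: "w \<in> Hom C x P" "\<kappa> \<cdot> w = z"
      using kernel_lift[OF ker z] by blast
    have "k \<cdot> w = u" "p \<cdot> w = v"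
      using w p1z p2z Comp_assoc[OF w(1) \<kappa> p1] Comp_assoc[OF w(1) \<kappa> p2]
      by (simp_all add: k_def p_def)
    with w(1) show ?thesis
      by blast
  qed
  ultimately show thesis
    using that fk by blast
qed

end


section \<open>The tensor product and colimits\<close>

text \<open>
  A cocone over \<open>b \<leftarrow> a \<rightarrow> b\<close>, with both arrows equal to \<open>e\<close>, is a pair of arrows out of \<open>b\<close> that \<open>e\<close>
  equalises. Hence \<open>e\<close> is epic iff \<open>b\<close> with the identities is a colimit, and functors that preserve
  colimits preserve epimorphisms. The arrows of the shape are elements of the universe.
\<close>

definition span_cat :: "(nat \<Rightarrow> 'u) \<Rightarrow> ('u, 'u) cat" where
  "span_cat n =
    \<lparr>Obj = {n 0, n 1, n 2},
     Hom = (\<lambda>i j. if i = j \<and> i \<in> {n 0, n 1, n 2} then {i}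
       else if i = n 0 \<and> j = n 1 then {n 3}
       else if i = n 0 \<and> j = n 2 then {n 4} else {}),
     Idt = (\<lambda>i. i),
     Comp = (\<lambda>v u. if v \<in> {n 3, n 4} then v else u)\<rparr>"

lemma small_span_cat:
  assumes "infinite U" "inj n" "range n \<subseteq> U"
  shows "small_cat U (span_cat n)"
proof -
  have n: "n i = n j \<longleftrightarrow> i = j" for i j
    using assms(2) by (simp add: inj_eq)
  have "category (span_cat n)"
    by unfold_locales (auto simp: span_cat_def n split: if_splits)
  moreover have "disjoint_homs (span_cat n)"
    unfolding disjoint_homs_def by (auto simp: span_cat_def n split: if_splits)
  moreover have "A \<prec> U" if "finite A" for A :: "'a set"
    using that assms(1) finite_lesspoll_infinite by blast
  ultimately show ?thesis
    unfolding small_cat_def by (simp add: span_cat_def)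
qed

lemma small_empty_cat: "infinite U \<Longrightarrow> small_cat U (discrete_cat {})"
  by (auto simp: small_cat_def discrete_cat_def category_def disjoint_homs_def
      intro: finite_lesspoll_infinite)

context base_category
begin

lemma Zero_Hom_arr [simp]:
  assumes "a \<in> Obj C" "b \<in> Obj C"
  shows "arr (Zero C a b)" "src (Zero C a b) = a" "tgt (Zero C a b) = b"
  using Zero_Hom[OF assms] by (simp_all add: in_Hom_iff)

lemma epic_TensA_Idt:
  assumes e: "epic C a b e" and X: "X \<in> Obj C"
  shows "epic C (a \<boxtimes> X) (b \<boxtimes> X) (e \<boxdot> Idt C X)"
proof -
  have inf: "infinite U"
    using universe by (simp add: universe_def)
  then obtain n :: "nat \<Rightarrow> 'u" where n: "inj n" "range n \<subseteq> U"
    using infinite_countable_subset by blast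
  have n_eq [simp]: "n i = n j \<longleftrightarrow> i = j" for i j
    using n(1) by (simp add: inj_eq)
  note [simp] = epicD[OF e] X
  have [simp]: "a \<in> Obj C" "b \<in> Obj C"
    using e src_Obj tgt_Obj epicD by metis+
  let ?J = "span_cat n"
  let ?F = "\<lambda>i. if i = n 0 then a else b"
  let ?F' = "\<lambda>u. if u = n 0 then Idt C a else if u = n 3 \<or> u = n 4 then e else Idt C b"
  let ?l = "\<lambda>i. if i = n 0 then e else Idt C b"
  have diagram: "is_functor ?J C ?F ?F'"
    by (auto simp: is_functor_def span_cat_def in_Hom_iff split: if_splits)
  have colim: "is_colimit ?J C ?F ?F' b ?l"
    unfolding is_colimit_def
  proof (intro conjI allI impI)
    show "is_cocone ?J C ?F ?F' b ?l"
      by (auto simp: is_cocone_def span_cat_def in_Hom_iff split: if_splits)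
    fix Y y
    assume y: "is_cocone ?J C ?F ?F' Y y"
    have H: "y (n 0) \<in> Hom C a Y" "y (n 1) \<in> Hom C b Y" "y (n 2) \<in> Hom C b Y"
      using y by (auto simp: is_cocone_def span_cat_def)
    have y1: "y (n 1) \<cdot> e = y (n 0)"
      using y[unfolded is_cocone_def, THEN conjunct2, THEN conjunct2, rule_format, of "n 3" "n 0" "n 1"]
      by (simp add: span_cat_def)
    have y2: "y (n 2) \<cdot> e = y (n 0)"
      using y[unfolded is_cocone_def, THEN conjunct2, THEN conjunct2, rule_format, of "n 4" "n 0" "n 2"]
      by (simp add: span_cat_def)
    \<comment> \<open>This is where \<open>e\<close> is cancelled: the two legs of a cocone at the
      copies of \<open>b\<close> coincide.\<close>
    have y12: "y (n 1) = y (n 2)"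
      using e H y1 y2 unfolding epic_def by metis
    show "\<exists>!h. h \<in> Hom C b Y \<and> (\<forall>i\<in>Obj ?J. h \<cdot> ?l i = y i)"
    proof (rule ex1I[of _ "y (n 1)"], intro conjI ballI)
      fix i
      assume "i \<in> Obj ?J"
      then have "i = n 0 \<or> i = n 1 \<or> i = n 2"
        by (simp add: span_cat_def)
      then show "y (n 1) \<cdot> ?l i = y i"
        using H(2) y1 y12 Comp_Idt by auto
    next
      fix h
      assume h: "h \<in> Hom C b Y \<and> (\<forall>i\<in>Obj ?J. h \<cdot> ?l i = y i)"
      then have "h \<cdot> ?l (n 1) = y (n 1)"
        by (simp add: span_cat_def)
      then show "h = y (n 1)"
        using h Comp_Idt[of h b Y] by simp
    qed (rule H(2))
  qed
  have colim': "is_colimit ?J C (\<lambda>i. ?F i \<boxtimes> X) (\<lambda>u. ?F' u \<boxdot> Idt C X) (b \<boxtimes> X) (\<lambda>i. ?l i \<boxdot> Idt C X)"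
    using tensor_colimits[unfolded tensor_preserves_colimits_def, rule_format,
        OF X small_span_cat[OF inf n] diagram colim] .
  show ?thesis
  proof (rule epicI)
    fix g h
    assume gh [simp]: "arr g" "arr h" "tgt g = tgt h" "src g = b \<boxtimes> X" "src h = b \<boxtimes> X"
      and eq: "g \<cdot> e \<boxdot> Idt C X = h \<cdot> e \<boxdot> Idt C X"
    \<comment> \<open>\<open>g\<close> and \<open>h\<close> are put on the two legs. The injections
      there are identities, so the mediating arrow equals both.\<close>
    let ?y = "\<lambda>i. if i = n 0 then g \<cdot> e \<boxdot> Idt C X else if i = n 1 then g else h"
    have "is_cocone ?J C (\<lambda>i. ?F i \<boxtimes> X) (\<lambda>u. ?F' u \<boxdot> Idt C X) (tgt h) ?y"
      using eq by (auto simp: is_cocone_def span_cat_def in_Hom_iff split: if_splits)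
    then obtain k where k: "k \<in> Hom C (b \<boxtimes> X) (tgt h)"
      and eqs: "\<forall>i\<in>Obj ?J. k \<cdot> (?l i \<boxdot> Idt C X) = ?y i"
      using colim' unfolding is_colimit_def by blast
    have "k \<cdot> (?l (n 1) \<boxdot> Idt C X) = g" "k \<cdot> (?l (n 2) \<boxdot> Idt C X) = h"
      using eqs by (auto simp: span_cat_def)
    then show "g = h"
      using k by (simp add: in_Hom_iff)
  qed simp_all
qed

text \<open>The symmetry moves the identity to the other factor, and it can be cancelled afterwards
  because \<open>Sym_Sym\<close> inverts it.\<close>

lemma epic_Idt_TensA:
  assumes e: "epic C a b e" and X: "X \<in> Obj C"
  shows "epic C (X \<boxtimes> a) (X \<boxtimes> b) (Idt C X \<boxdot> e)"
proof -
  note [simp] = epicD[OF e] X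
  have [simp]: "a \<in> Obj C" "b \<in> Obj C"
    using e src_Obj tgt_Obj epicD by metis+
  show ?thesis
  proof (rule epicI)
    fix g h
    assume gh [simp]: "arr g" "arr h" "tgt g = tgt h" "src g = X \<boxtimes> b" "src h = X \<boxtimes> b"
      and eq: "g \<cdot> Idt C X \<boxdot> e = h \<cdot> Idt C X \<boxdot> e"
    have "(k \<cdot> Sym C b X) \<cdot> e \<boxdot> Idt C X = (k \<cdot> Idt C X \<boxdot> e) \<cdot> Sym C a X"
      if "arr k" "src k = X \<boxtimes> b" for k
      using that by (simp add: Sym_natural_arr)
    then have "(g \<cdot> Sym C b X) \<cdot> e \<boxdot> Idt C X = (h \<cdot> Sym C b X) \<cdot> e \<boxdot> Idt C X"
      using eq gh by metis
    then have "g \<cdot> Sym C b X = h \<cdot> Sym C b X"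
      by (rule epic_cancel[OF epic_TensA_Idt[OF e X]]) simp_all
    then have "(g \<cdot> Sym C b X) \<cdot> Sym C X b = (h \<cdot> Sym C b X) \<cdot> Sym C X b"
      by simp
    then show "g = h"
      by (simp add: Sym_Sym)
  qed simp_all
qed

lemma epic_TensA:
  assumes "epic C a b f" "epic C c d g"
  shows "epic C (a \<boxtimes> c) (b \<boxtimes> d) (f \<boxdot> g)"
proof -
  note [simp] = epicD[OF assms(1)] epicD[OF assms(2)]
  have obj: "b \<in> Obj C" "c \<in> Obj C"
    using assms src_Obj tgt_Obj epicD by metis+
  then show ?thesis
    using epic_Comp[OF epic_TensA_Idt[OF assms(1) obj(2)] epic_Idt_TensA[OF assms(2) obj(1)]]
    by simp
qed

text \<open>\<open>tensor_colimits\<close> fixes the right factor, while actions have the monoid on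
  the left. Conjugating cocones and mediating arrows with the symmetry changes sides.\<close>

lemma TensA_colimit:
  assumes X: "X \<in> Obj C" and J: "small_cat U (J :: ('u, 'u) cat)" and F: "is_functor J C F F'"
    and L: "is_colimit J C F F' L l"
  shows "is_colimit J C (\<lambda>i. X \<boxtimes> F i) (\<lambda>u. Idt C X \<boxdot> F' u) (X \<boxtimes> L) (\<lambda>i. Idt C X \<boxdot> l i)"
proof -
  have cocone: "is_cocone J C F F' L l"
    using L by (simp add: is_colimit_def)
  have cat: "category J"
    using J by (simp add: small_cat_def)
  have L_Obj [simp]: "L \<in> Obj C" and l: "\<And>i. i \<in> Obj J \<Longrightarrow> arr (l i) \<and> src (l i) = F i \<and> tgt (l i) = L"
    and lF: "\<And>i j u. u \<in> Hom J i j \<Longrightarrow> l j \<cdot> F' u = l i"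
    using cocone by (auto simp: is_cocone_def in_Hom_iff)
  have F_Obj: "\<And>i. i \<in> Obj J \<Longrightarrow> F i \<in> Obj C"
    and F': "\<And>i j u. u \<in> Hom J i j \<Longrightarrow> arr (F' u) \<and> src (F' u) = F i \<and> tgt (F' u) = F j"
    using F by (auto simp: is_functor_def in_Hom_iff)
  have J_Obj: "\<And>i j u. u \<in> Hom J i j \<Longrightarrow> i \<in> Obj J \<and> j \<in> Obj J"
    using category.Hom_Obj[OF cat] by blast
  note [simp] = X
  have colim: "is_colimit J C (\<lambda>i. F i \<boxtimes> X) (\<lambda>u. F' u \<boxdot> Idt C X) (L \<boxtimes> X) (\<lambda>i. l i \<boxdot> Idt C X)"
    using tensor_colimits[unfolded tensor_preserves_colimits_def, rule_format, OF X J F L] .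
  have J_diagram: "F i \<in> Obj C \<and> F' (Idt J i) = Idt C (F i)" if "i \<in> Obj J" for i
    using F that by (simp add: is_functor_def)
  have diagram: "is_functor J C (\<lambda>i. F i \<boxtimes> X) (\<lambda>u. F' u \<boxdot> Idt C X)"
    unfolding is_functor_def
  proof (intro conjI allI ballI)
    fix i j k u v
    assume u: "u \<in> Hom J i j" and v: "v \<in> Hom J j k"
    then have "F' (v \<cdot>\<^bsub>J\<^esub> u) = F' v \<cdot> F' u"
      using F unfolding is_functor_def by blast
    then show "F' (v \<cdot>\<^bsub>J\<^esub> u) \<boxdot> Idt C X = F' v \<boxdot> Idt C X \<cdot> F' u \<boxdot> Idt C X"
      using F'[OF u] F'[OF v] by simp
  qed (use J_diagram F' in \<open>simp_all add: in_Hom_iff\<close>)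
  show ?thesis
  proof (rule is_colimitI)
    show "is_cocone J C (\<lambda>i. X \<boxtimes> F i) (\<lambda>u. Idt C X \<boxdot> F' u) (X \<boxtimes> L) (\<lambda>i. Idt C X \<boxdot> l i)"
      unfolding is_cocone_def
    proof (intro conjI allI ballI)
      fix i j u
      assume u: "u \<in> Hom J i j"
      show "Idt C X \<boxdot> l j \<cdot> Idt C X \<boxdot> F' u = Idt C X \<boxdot> l i"
        using F'[OF u] l J_Obj[OF u] lF[OF u] by simp
    qed (use l F_Obj in \<open>auto simp: in_Hom_iff\<close>)
    fix Y y
    assume y: "is_cocone J C (\<lambda>i. X \<boxtimes> F i) (\<lambda>u. Idt C X \<boxdot> F' u) Y y"
    have y_arr: "\<And>i. i \<in> Obj J \<Longrightarrow> arr (y i) \<and> src (y i) = X \<boxtimes> F i \<and> tgt (y i) = Y"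
      and yF: "\<And>i j u. u \<in> Hom J i j \<Longrightarrow> y j \<cdot> Idt C X \<boxdot> F' u = y i"
      and Y: "Y \<in> Obj C"
      using y by (auto simp: is_cocone_def in_Hom_iff)
    have "is_cocone J C (\<lambda>i. F i \<boxtimes> X) (\<lambda>u. F' u \<boxdot> Idt C X) Y (\<lambda>i. y i \<cdot> Sym C (F i) X)"
      unfolding is_cocone_def
    proof (intro conjI allI ballI Y)
      fix i assume "i \<in> Obj J"
      then show "y i \<cdot> Sym C (F i) X \<in> Hom C (F i \<boxtimes> X) Y"
        using y_arr F_Obj by (simp add: in_Hom_iff)
    next
      fix i j u
      assume u: "u \<in> Hom J i j"
      have "(y j \<cdot> Idt C X \<boxdot> F' u) \<cdot> Sym C (F i) X = y i \<cdot> Sym C (F i) X"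
        using yF[OF u] by simp
      then show "y j \<cdot> Sym C (F j) X \<cdot> F' u \<boxdot> Idt C X = y i \<cdot> Sym C (F i) X"
        using F'[OF u] J_Obj[OF u] F_Obj y_arr by (simp add: Sym_natural_arr)
    qed
    then obtain h where h: "h \<in> Hom C (L \<boxtimes> X) Y"
      "\<And>i. i \<in> Obj J \<Longrightarrow> h \<cdot> l i \<boxdot> Idt C X = y i \<cdot> Sym C (F i) X"
      using colimit_factor[OF colim] by blast
    show "\<exists>h \<in> Hom C (X \<boxtimes> L) Y. \<forall>i\<in>Obj J. h \<cdot> Idt C X \<boxdot> l i = y i"
    proof (intro bexI[of _ "h \<cdot> Sym C X L"] ballI)
      show "h \<cdot> Sym C X L \<in> Hom C (X \<boxtimes> L) Y"
        using h(1) by (simp add: in_Hom_iff)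
      fix i assume i: "i \<in> Obj J"
      have "(h \<cdot> l i \<boxdot> Idt C X) \<cdot> Sym C X (F i) = (y i \<cdot> Sym C (F i) X) \<cdot> Sym C X (F i)"
        using h(2)[OF i] by simp
      then show "(h \<cdot> Sym C X L) \<cdot> Idt C X \<boxdot> l i = y i"
        using h(1) l[OF i] F_Obj[OF i] y_arr[OF i] by (simp add: in_Hom_iff Sym_natural_arr Sym_Sym)
    qed
  next
    fix Y g h
    assume g: "g \<in> Hom C (X \<boxtimes> L) Y" and h: "h \<in> Hom C (X \<boxtimes> L) Y"
      and eq: "\<And>i. i \<in> Obj J \<Longrightarrow> g \<cdot> Idt C X \<boxdot> l i = h \<cdot> Idt C X \<boxdot> l i"
    have "g \<cdot> Sym C L X = h \<cdot> Sym C L X"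
    proof (rule colimit_cancel[OF cat diagram colim])
      show "g \<cdot> Sym C L X \<in> Hom C (L \<boxtimes> X) Y" "h \<cdot> Sym C L X \<in> Hom C (L \<boxtimes> X) Y"
        using g h by (simp_all add: in_Hom_iff)
      fix i assume i: "i \<in> Obj J"
      have "(k \<cdot> Sym C L X) \<cdot> l i \<boxdot> Idt C X = (k \<cdot> Idt C X \<boxdot> l i) \<cdot> Sym C (F i) X"
        if "k \<in> Hom C (X \<boxtimes> L) Y" for k
        using that l[OF i] F_Obj[OF i] by (simp add: in_Hom_iff Sym_natural_arr)
      then show "(g \<cdot> Sym C L X) \<cdot> l i \<boxdot> Idt C X = (h \<cdot> Sym C L X) \<cdot> l i \<boxdot> Idt C X"
        using eq[OF i] g h by metis
    qed
    then have "(g \<cdot> Sym C L X) \<cdot> Sym C X L = (h \<cdot> Sym C L X) \<cdot> Sym C X L"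
      by simp
    then show "g = h"
      using g h by (simp add: in_Hom_iff Sym_Sym)
  qed
qed

text \<open>\<open>TensA\<close> is not given as additive. The zero object \<open>z\<close> is the
  colimit of the empty diagram, so \<open>X \<boxtimes> z\<close> is initial, and the tensored zero
  arrow passes through it because a zero arrow passes through \<open>z\<close>.\<close>

lemma Idt_TensA_Zero:
  assumes X: "X \<in> Obj C" and a: "a \<in> Obj C" and b: "b \<in> Obj C"
  shows "Idt C X \<boxdot> Zero C a b = Zero C (X \<boxtimes> a) (X \<boxtimes> b)"
proof -
  from zero_object obtain z where z: "z \<in> Obj C"
    and "\<forall>a \<in> Obj C. (\<exists>!f. f \<in> Hom C a z) \<and> (\<exists>!f. f \<in> Hom C z a)"
    by (rule bexE)
  then have initial: "\<exists>!f. f \<in> Hom C z a" if "a \<in> Obj C" for a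
    using that by simp
  note [simp] = X a b z
  let ?J = "discrete_cat {} :: ('u, 'u) cat"
  have J: "small_cat U ?J"
    using universe by (intro small_empty_cat) (simp add: universe_def)
  have diagram: "is_functor ?J C (\<lambda>_. z) (\<lambda>_. Idt C z)"
    by (simp add: is_functor_def discrete_cat_def)
  have "is_colimit ?J C (\<lambda>_. z) (\<lambda>_. Idt C z) z (\<lambda>_. Idt C z)"
    using initial z by (simp add: is_colimit_def is_cocone_def discrete_cat_def)
  from TensA_colimit[OF X J diagram this]
  have *: "\<exists>!f. f \<in> Hom C (X \<boxtimes> z) Y" if "Y \<in> Obj C" for Y
    using that by (simp add: is_colimit_def is_cocone_def discrete_cat_def)
  have ex1_unique: "f = g" if "\<exists>!f. f \<in> H" "f \<in> H" "g \<in> H" for f g and H :: "'m set"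
    using that by blast
  have "Idt C X \<boxdot> Zero C z b = Zero C (X \<boxtimes> z) (X \<boxtimes> b)"
    by (rule ex1_unique[OF *[of "X \<boxtimes> b"]]) (simp_all add: in_Hom_iff)
  moreover have "Zero C a b = Zero C z b \<cdot> Zero C a z"
    using Comp_Zero[OF Zero_Hom[OF z b] a] by simp
  then have "Idt C X \<boxdot> Zero C a b = (Idt C X \<boxdot> Zero C z b) \<cdot> (Idt C X \<boxdot> Zero C a z)"
    by simp
  ultimately show ?thesis
    using Zero_Comp[of "Idt C X \<boxdot> Zero C a z" "X \<boxtimes> a" "X \<boxtimes> z" "X \<boxtimes> b"]
    by (simp add: in_Hom_iff)
qed

end

section \<open>Modules\<close>

context base_category
begin

text \<open>The simplifier merges \<open>Idt C a \<boxdot> Idt C b\<close> into a single identity,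
  after which \<open>Assoc_natural\<close> no longer matches; this is its merged form.\<close>

lemma Assoc_natural_Idt:
  assumes "a \<in> Obj C" "b \<in> Obj C" "arr h" "tgt h = c"
  shows "Assoc C a b c \<cdot> (Idt C (a \<boxtimes> b) \<boxdot> h) =
    (Idt C a \<boxdot> (Idt C b \<boxdot> h)) \<cdot> Assoc C a b (src h)"
  using Assoc_natural[OF Idt_Hom[OF assms(1)] Idt_Hom[OF assms(2)] arr_Hom[OF assms(3)]] assms
  by simp

lemma Mod_Obj_iff: "M \<in> Obj (Mod_cat C A) \<longleftrightarrow> is_module C A M"
  by (simp add: Mod_cat_def)

lemma Mod_Hom_iff:
  "f \<in> Hom (Mod_cat C A) M N \<longleftrightarrow> f \<in> Hom C (fst M) (fst N) \<and> is_module C A M \<and> is_module C A N \<and>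
    f \<cdot> snd M = snd N \<cdot> (Idt C (mobj A) \<boxdot> f)"
  by (auto simp: Mod_cat_def)

lemma Mod_Comp: "Comp (Mod_cat C A) = Comp C"
  by (simp add: Mod_cat_def)

lemma Mod_Zero: "Zero (Mod_cat C A) M N = Zero C (fst M) (fst N)"
  by (simp add: Mod_cat_def)

lemma monoid_arr:
  assumes "is_comm_monoid C A"
  shows "mobj A \<in> Obj C"
    "arr (mmul A)" "src (mmul A) = mobj A \<boxtimes> mobj A" "tgt (mmul A) = mobj A"
    "arr (munit A)" "src (munit A) = Unit C" "tgt (munit A) = mobj A"
  using assms by (auto simp: is_comm_monoid_def in_Hom_iff)

lemma module_arr:
  assumes "is_module C A M"
  shows "fst M \<in> Obj C"
    "arr (snd M)" "src (snd M) = mobj A \<boxtimes> fst M" "tgt (snd M) = fst M"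
  using assms by (auto simp: is_module_def in_Hom_iff)

lemma category_Mod:
  assumes A: "is_comm_monoid C A"
  shows "category (Mod_cat C A)"
proof
  note [simp] = monoid_arr[OF A]
  fix f g h M N P Q
  show "f \<in> Hom (Mod_cat C A) M N \<Longrightarrow> M \<in> Obj (Mod_cat C A) \<and> N \<in> Obj (Mod_cat C A)"
    by (simp add: Mod_Obj_iff Mod_Hom_iff)
  show "Idt (Mod_cat C A) M \<in> Hom (Mod_cat C A) M M" if "M \<in> Obj (Mod_cat C A)"
    using that module_arr[of A M] by (simp add: Mod_cat_def in_Hom_iff)
  show "g \<cdot>\<^bsub>Mod_cat C A\<^esub> f \<in> Hom (Mod_cat C A) M P"
    if f: "f \<in> Hom (Mod_cat C A) M N" and g: "g \<in> Hom (Mod_cat C A) N P"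
  proof -
    have M: "is_module C A M" and N: "is_module C A N" and P: "is_module C A P"
      and [simp]: "arr f" "src f = fst M" "tgt f = fst N" "arr g" "src g = fst N" "tgt g = fst P"
      and fM: "f \<cdot> snd M = snd N \<cdot> (Idt C (mobj A) \<boxdot> f)"
      and gN: "g \<cdot> snd N = snd P \<cdot> (Idt C (mobj A) \<boxdot> g)"
      using f g by (auto simp: Mod_Hom_iff in_Hom_iff)
    note [simp] = module_arr[OF M] module_arr[OF N] module_arr[OF P]
    have "(g \<cdot> f) \<cdot> snd M = (g \<cdot> snd N) \<cdot> (Idt C (mobj A) \<boxdot> f)"
      using fM by simp
    also have "\<dots> = snd P \<cdot> (Idt C (mobj A) \<boxdot> (g \<cdot> f))"
      unfolding gN by simp
    finally show ?thesis
      using M P by (simp add: Mod_Hom_iff in_Hom_iff Mod_Comp)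
  qed
  show "f \<in> Hom (Mod_cat C A) M N \<Longrightarrow> f \<cdot>\<^bsub>Mod_cat C A\<^esub> Idt (Mod_cat C A) M = f"
    "f \<in> Hom (Mod_cat C A) M N \<Longrightarrow> Idt (Mod_cat C A) N \<cdot>\<^bsub>Mod_cat C A\<^esub> f = f"
    by (simp_all add: Mod_cat_def in_Hom_iff)
  show "f \<in> Hom (Mod_cat C A) M N \<Longrightarrow> g \<in> Hom (Mod_cat C A) N P \<Longrightarrow>
      h \<in> Hom (Mod_cat C A) P Q \<Longrightarrow>
      (h \<cdot>\<^bsub>Mod_cat C A\<^esub> g) \<cdot>\<^bsub>Mod_cat C A\<^esub> f = h \<cdot>\<^bsub>Mod_cat C A\<^esub> (g \<cdot>\<^bsub>Mod_cat C A\<^esub> f)"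
    by (simp add: Mod_Hom_iff Mod_Comp in_Hom_iff)
qed

lemma regular_module: "is_comm_monoid C A \<Longrightarrow> is_module C A (regular_module A)"
  by (simp add: is_module_def is_comm_monoid_def regular_module_def)

text \<open>Composed with \<open>m\<close>, the module laws for \<open>a\<close> become those of
  \<open>M\<close>, and \<open>m\<close> can be cancelled.\<close>

lemma submodule:
  assumes A: "is_comm_monoid C A" and M: "is_module C A M"
    and m: "monic C x (fst M) m" and a: "a \<in> Hom C (mobj A \<boxtimes> x) x"
    and eq: "m \<cdot> a = snd M \<cdot> (Idt C (mobj A) \<boxdot> m)"
  shows "is_module C A (x, a)"
proof -
  have [simp]: "x \<in> Obj C" "arr a" "src a = mobj A \<boxtimes> x" "tgt a = x"
    using a Hom_Obj by (auto simp: in_Hom_iff)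
  note [simp] = monicD[OF m] monoid_arr[OF A] module_arr[OF M]
  let ?A = "mobj A"
  have assoc: "snd M \<cdot> (mmul A \<boxdot> Idt C (fst M)) =
      snd M \<cdot> ((Idt C ?A \<boxdot> snd M) \<cdot> Assoc C ?A ?A (fst M))"
    and unit: "snd M \<cdot> (munit A \<boxdot> Idt C (fst M)) = LUnit C (fst M)"
    using M by (simp_all add: is_module_def)
  have "a \<cdot> (mmul A \<boxdot> Idt C x) = a \<cdot> ((Idt C ?A \<boxdot> a) \<cdot> Assoc C ?A ?A x)"
  proof (rule monic_cancel[OF m])
    have "m \<cdot> (a \<cdot> (mmul A \<boxdot> Idt C x)) = (snd M \<cdot> (Idt C ?A \<boxdot> m)) \<cdot> (mmul A \<boxdot> Idt C x)"
      unfolding eq[symmetric] by simp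
    also have "\<dots> = (snd M \<cdot> (mmul A \<boxdot> Idt C (fst M))) \<cdot> (Idt C (?A \<boxtimes> ?A) \<boxdot> m)"
      by simp
    also have "\<dots> = snd M \<cdot> ((Idt C ?A \<boxdot> snd M) \<cdot> (Assoc C ?A ?A (fst M) \<cdot> (Idt C (?A \<boxtimes> ?A) \<boxdot> m)))"
      unfolding assoc by simp
    also have "Assoc C ?A ?A (fst M) \<cdot> (Idt C (?A \<boxtimes> ?A) \<boxdot> m) =
        (Idt C ?A \<boxdot> (Idt C ?A \<boxdot> m)) \<cdot> Assoc C ?A ?A x"
      by (simp add: Assoc_natural_Idt)
    also have "snd M \<cdot> ((Idt C ?A \<boxdot> snd M) \<cdot> \<dots>) =
        snd M \<cdot> ((Idt C ?A \<boxdot> (snd M \<cdot> (Idt C ?A \<boxdot> m))) \<cdot> Assoc C ?A ?A x)"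
      by simp
    also have "\<dots> = (snd M \<cdot> (Idt C ?A \<boxdot> m)) \<cdot> ((Idt C ?A \<boxdot> a) \<cdot> Assoc C ?A ?A x)"
      by (simp add: eq)
    also have "\<dots> = m \<cdot> (a \<cdot> ((Idt C ?A \<boxdot> a) \<cdot> Assoc C ?A ?A x))"
      unfolding eq[symmetric] by simp
    finally show "m \<cdot> (a \<cdot> (mmul A \<boxdot> Idt C x)) = \<dots>" .
  qed simp_all
  moreover have "a \<cdot> (munit A \<boxdot> Idt C x) = LUnit C x"
  proof (rule monic_cancel[OF m])
    have "m \<cdot> (a \<cdot> (munit A \<boxdot> Idt C x)) = (snd M \<cdot> (Idt C ?A \<boxdot> m)) \<cdot> (munit A \<boxdot> Idt C x)"
      unfolding eq[symmetric] by simp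
    also have "\<dots> = (snd M \<cdot> (munit A \<boxdot> Idt C (fst M))) \<cdot> (Idt C (Unit C) \<boxdot> m)"
      by simp
    also have "\<dots> = m \<cdot> LUnit C x"
      unfolding unit by (simp add: LUnit_natural_arr)
    finally show "m \<cdot> (a \<cdot> (munit A \<boxdot> Idt C x)) = \<dots>" .
  qed simp_all
  ultimately show ?thesis
    using a by (simp add: is_module_def)
qed

text \<open>Linearity of \<open>h\<close> may be tested after precomposition with
  \<open>Idt C (mobj A) \<boxdot> e\<close>, which is still epic.\<close>

lemma Mod_Hom_cancel_epic:
  assumes A: "is_comm_monoid C A" and e: "e \<in> Hom (Mod_cat C A) M N" "epic C (fst M) (fst N) e"
    and P: "is_module C A P" and h: "h \<in> Hom C (fst N) (fst P)"
    and he: "h \<cdot> e \<in> Hom (Mod_cat C A) M P"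
  shows "h \<in> Hom (Mod_cat C A) N P"
proof -
  have M: "is_module C A M" and N: "is_module C A N"
    and eM: "e \<cdot> snd M = snd N \<cdot> (Idt C (mobj A) \<boxdot> e)"
    and heM: "(h \<cdot> e) \<cdot> snd M = snd P \<cdot> (Idt C (mobj A) \<boxdot> (h \<cdot> e))"
    using e he by (auto simp: Mod_Hom_iff)
  note [simp] = epicD[OF e(2)] monoid_arr[OF A] module_arr[OF M] module_arr[OF N] module_arr[OF P]
  have [simp]: "arr h" "src h = fst N" "tgt h = fst P"
    using h by (auto simp: in_Hom_iff)
  have "h \<cdot> snd N = snd P \<cdot> (Idt C (mobj A) \<boxdot> h)"
  proof (rule epic_cancel[OF epic_Idt_TensA[OF e(2)]])
    have "(h \<cdot> snd N) \<cdot> (Idt C (mobj A) \<boxdot> e) = (h \<cdot> e) \<cdot> snd M"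
      using eM by simp
    also have "\<dots> = (snd P \<cdot> (Idt C (mobj A) \<boxdot> h)) \<cdot> (Idt C (mobj A) \<boxdot> e)"
      unfolding heM by simp
    finally show "(h \<cdot> snd N) \<cdot> (Idt C (mobj A) \<boxdot> e) = \<dots>" .
  qed simp_all
  then show ?thesis
    using N P h by (simp add: Mod_Hom_iff)
qed

lemma Mod_monic_if_monic:
  "f \<in> Hom (Mod_cat C A) M N \<Longrightarrow> monic C (fst M) (fst N) f \<Longrightarrow> monic (Mod_cat C A) M N f"
  unfolding monic_def Mod_Comp by (auto simp: Mod_Hom_iff simp del: split_paired_All)

lemma Mod_Zero_Hom:
  assumes A: "is_comm_monoid C A" and M: "is_module C A M" and N: "is_module C A N"
  shows "Zero C (fst M) (fst N) \<in> Hom (Mod_cat C A) M N"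
proof -
  note [simp] = monoid_arr[OF A] module_arr[OF M] module_arr[OF N]
  have "Zero C (fst M) (fst N) \<cdot> snd M = snd N \<cdot> (Idt C (mobj A) \<boxdot> Zero C (fst M) (fst N))"
    using Comp_Zero[of "snd N" "mobj A \<boxtimes> fst N" "fst N" "mobj A \<boxtimes> fst M"]
      Zero_Comp[of "snd M" "mobj A \<boxtimes> fst M" "fst M" "fst N"]
    by (simp add: Idt_TensA_Zero in_Hom_iff)
  then show ?thesis
    using M N by (simp add: Mod_Hom_iff in_Hom_iff)
qed

text \<open>As \<open>f\<close> is linear and tensoring preserves zero arrows, \<open>f\<close>
  kills the action of \<open>M\<close> on the kernel, so this action lifts through
  \<open>k\<close>.\<close>

lemma Mod_kernel:
  assumes A: "is_comm_monoid C A" and f: "f \<in> Hom (Mod_cat C A) M N"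
    and k: "is_kernel C (fst M) (fst N) f x k"
  obtains a where "is_module C A (x, a)" "k \<in> Hom (Mod_cat C A) (x, a) M"
proof -
  have M: "is_module C A M" and N: "is_module C A N" and f': "f \<in> Hom C (fst M) (fst N)"
    and fM: "f \<cdot> snd M = snd N \<cdot> (Idt C (mobj A) \<boxdot> f)"
    using f by (auto simp: Mod_Hom_iff)
  have k': "k \<in> Hom C x (fst M)" and fk: "f \<cdot> k = Zero C x (fst N)"
    using k by (auto simp: is_kernel_def)
  note mk = kernel_monic[OF k f']
  have [simp]: "arr f" "src f = fst M" "tgt f = fst N" "arr k" "src k = x" "tgt k = fst M" "x \<in> Obj C"
    using f' k' Hom_Obj by (auto simp: in_Hom_iff)
  note [simp] = monoid_arr[OF A] module_arr[OF M] module_arr[OF N]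
  have "f \<cdot> (snd M \<cdot> (Idt C (mobj A) \<boxdot> k)) = (f \<cdot> snd M) \<cdot> (Idt C (mobj A) \<boxdot> k)"
    by simp
  also have "\<dots> = snd N \<cdot> (Idt C (mobj A) \<boxdot> (f \<cdot> k))"
    unfolding fM by simp
  also have "\<dots> = Zero C (mobj A \<boxtimes> x) (fst N)"
    unfolding fk using Comp_Zero[of "snd N" "mobj A \<boxtimes> fst N" "fst N" "mobj A \<boxtimes> x"]
    by (simp add: Idt_TensA_Zero in_Hom_iff)
  finally obtain a where a: "a \<in> Hom C (mobj A \<boxtimes> x) x" "k \<cdot> a = snd M \<cdot> (Idt C (mobj A) \<boxdot> k)"
    using kernel_lift[OF k, of "snd M \<cdot> (Idt C (mobj A) \<boxdot> k)" "mobj A \<boxtimes> x"]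
    by (auto simp: in_Hom_iff)
  then have "is_module C A (x, a)"
    using submodule[OF A M mk] by blast
  with that M k' a show thesis
    by (simp add: Mod_Hom_iff)
qed

text \<open>A monic of modules cancels linear arrows only. The kernel in \<open>C\<close> is itself
  a module with linear inclusion, so the cancellation applies to this inclusion and shows that it is
  zero.\<close>

lemma monic_if_Mod_monic:
  assumes A: "is_comm_monoid C A" and f: "monic (Mod_cat C A) M N f"
  shows "monic C (fst M) (fst N) f"
proof -
  have f_Mod: "f \<in> Hom (Mod_cat C A) M N"
    using f by (simp add: monic_def)
  then have M: "is_module C A M" and f': "f \<in> Hom C (fst M) (fst N)"
    by (auto simp: Mod_Hom_iff)
  obtain x k where k: "is_kernel C (fst M) (fst N) f x k"
    using kernels[OF f'] by blast
  obtain a where a: "is_module C A (x, a)" "k \<in> Hom (Mod_cat C A) (x, a) M"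
    using Mod_kernel[OF A f_Mod k] by blast
  have k': "k \<in> Hom C x (fst M)" and fk: "f \<cdot> k = Zero C x (fst N)"
    using k by (auto simp: is_kernel_def)
  have z: "Zero C x (fst M) \<in> Hom (Mod_cat C A) (x, a) M"
    using Mod_Zero_Hom[OF A a(1) M] by simp
  have "f \<cdot> Zero C x (fst M) = Zero C x (fst N)"
    using Comp_Zero[OF f'] k' Hom_Obj by blast
  then have k_zero: "k = Zero C x (fst M)"
    using f a(2) z fk unfolding monic_def Mod_Comp by metis
  show ?thesis
  proof (rule monic_if_zero[OF f'])
    fix y g
    assume g: "g \<in> Hom C y (fst M)" "f \<cdot> g = Zero C y (fst N)"
    then obtain h where "h \<in> Hom C y x" "k \<cdot> h = g"
      using kernel_lift[OF k] by blast
    then show "g = Zero C y (fst M)"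
      using Zero_Comp[of h y x "fst M"] k_zero module_arr(1)[OF M] by simp
  qed
qed


section \<open>Quotient monoids\<close>

lemma Comm_Hom_iff:
  "f \<in> Hom (Comm C) A B \<longleftrightarrow> f \<in> Hom C (mobj A) (mobj B) \<and> is_comm_monoid C A \<and> is_comm_monoid C B \<and>
    f \<cdot> mmul A = mmul B \<cdot> (f \<boxdot> f) \<and> f \<cdot> munit A = munit B"
  by (auto simp: Comm_def)

lemma Comm_Comp: "Comp (Comm C) = Comp C"
  by (simp add: Comm_def)

lemma Comm_Idt_Hom: "is_comm_monoid C A \<Longrightarrow> Idt C (mobj A) \<in> Hom (Comm C) A A"
  using monoid_arr[of A] by (simp add: Comm_Hom_iff in_Hom_iff)

lemma Comm_Comp_Hom:
  assumes f: "f \<in> Hom (Comm C) A B" and g: "g \<in> Hom (Comm C) B D"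
  shows "g \<cdot> f \<in> Hom (Comm C) A D"
proof -
  have A: "is_comm_monoid C A" and B: "is_comm_monoid C B" and D: "is_comm_monoid C D"
    and [simp]: "arr f" "src f = mobj A" "tgt f = mobj B" "arr g" "src g = mobj B" "tgt g = mobj D"
    and f_mul: "f \<cdot> mmul A = mmul B \<cdot> (f \<boxdot> f)" and f_unit: "f \<cdot> munit A = munit B"
    and g_mul: "g \<cdot> mmul B = mmul D \<cdot> (g \<boxdot> g)" and g_unit: "g \<cdot> munit B = munit D"
    using f g by (auto simp: Comm_Hom_iff in_Hom_iff)
  note [simp] = monoid_arr[OF A] monoid_arr[OF B] monoid_arr[OF D]
  have "(g \<cdot> f) \<cdot> mmul A = (g \<cdot> mmul B) \<cdot> (f \<boxdot> f)"
    using f_mul by simp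
  also have "\<dots> = mmul D \<cdot> ((g \<cdot> f) \<boxdot> (g \<cdot> f))"
    unfolding g_mul by simp
  finally have "(g \<cdot> f) \<cdot> mmul A = \<dots>" .
  moreover have "(g \<cdot> f) \<cdot> munit A = munit D"
    using f_unit g_unit by simp
  ultimately show ?thesis
    using A D unfolding Comm_Hom_iff by (simp add: in_Hom_iff)
qed

lemma Comm_Hom_cancel_monic:
  assumes m: "m \<in> Hom (Comm C) B D" "monic C (mobj B) (mobj D) m"
    and A: "is_comm_monoid C A" and h: "h \<in> Hom C (mobj A) (mobj B)"
    and mh: "m \<cdot> h \<in> Hom (Comm C) A D"
  shows "h \<in> Hom (Comm C) A B"
proof -
  have B: "is_comm_monoid C B" and D: "is_comm_monoid C D"
    and m_mul: "m \<cdot> mmul B = mmul D \<cdot> (m \<boxdot> m)" and m_unit: "m \<cdot> munit B = munit D"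
    and mh_mul: "(m \<cdot> h) \<cdot> mmul A = mmul D \<cdot> ((m \<cdot> h) \<boxdot> (m \<cdot> h))"
    and mh_unit: "(m \<cdot> h) \<cdot> munit A = munit D"
    using m mh by (auto simp: Comm_Hom_iff)
  note [simp] = monicD[OF m(2)] monoid_arr[OF A] monoid_arr[OF B] monoid_arr[OF D]
  have [simp]: "arr h" "src h = mobj A" "tgt h = mobj B"
    using h by (auto simp: in_Hom_iff)
  have "h \<cdot> mmul A = mmul B \<cdot> (h \<boxdot> h)"
  proof (rule monic_cancel[OF m(2)])
    have "m \<cdot> (h \<cdot> mmul A) = (mmul D \<cdot> (m \<boxdot> m)) \<cdot> (h \<boxdot> h)"
      using mh_mul by simp
    also have "\<dots> = m \<cdot> (mmul B \<cdot> (h \<boxdot> h))"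
      unfolding m_mul[symmetric] by simp
    finally show "m \<cdot> (h \<cdot> mmul A) = \<dots>" .
  qed simp_all
  moreover have "h \<cdot> munit A = munit B"
    by (rule monic_cancel[OF m(2)]) (use mh_unit m_unit in simp_all)
  ultimately show ?thesis
    using A B h by (simp add: Comm_Hom_iff)
qed

text \<open>As \<open>e \<boxdot> e\<close> is epic, the product in \<open>B\<close> of two copies
  of \<open>x\<close> lifts through \<open>m\<close> by orthogonality; the unit is the image of that
  of \<open>A\<close>. The monoid laws follow from those of \<open>B\<close> by cancelling
  \<open>m\<close>.\<close>

lemma image_monoid:
  assumes e: "epic C (mobj A) x e" and m: "monic C x (mobj B) m"
    and me: "m \<cdot> e \<in> Hom (Comm C) A B"
  obtains E where "mobj E = x" "e \<in> Hom (Comm C) A E" "m \<in> Hom (Comm C) E B"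
proof -
  have A: "is_comm_monoid C A" and B: "is_comm_monoid C B"
    and me_mul: "(m \<cdot> e) \<cdot> mmul A = mmul B \<cdot> ((m \<cdot> e) \<boxdot> (m \<cdot> e))"
    and me_unit: "(m \<cdot> e) \<cdot> munit A = munit B"
    using me by (auto simp: Comm_Hom_iff)
  note [simp] = monicD[OF m] epicD[OF e] monoid_arr[OF A] monoid_arr[OF B]
  have x [simp]: "x \<in> Obj C"
    using tgt_Obj[of e] by simp
  have assoc: "mmul B \<cdot> (mmul B \<boxdot> Idt C (mobj B)) =
      mmul B \<cdot> ((Idt C (mobj B) \<boxdot> mmul B) \<cdot> Assoc C (mobj B) (mobj B) (mobj B))"
    and lunit: "mmul B \<cdot> (munit B \<boxdot> Idt C (mobj B)) = LUnit C (mobj B)"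
    and runit: "mmul B \<cdot> (Idt C (mobj B) \<boxdot> munit B) = RUnit C (mobj B)"
    and comm: "mmul B \<cdot> Sym C (mobj B) (mobj B) = mmul B"
    using B by (simp_all add: is_comm_monoid_def)
  have "m \<cdot> (e \<cdot> mmul A) = (mmul B \<cdot> (m \<boxdot> m)) \<cdot> (e \<boxdot> e)"
    using me_mul by simp
  then obtain \<mu> where \<mu>: "\<mu> \<in> Hom C (x \<boxtimes> x) x"
    and \<mu>e: "\<mu> \<cdot> (e \<boxdot> e) = e \<cdot> mmul A" and m\<mu>: "m \<cdot> \<mu> = mmul B \<cdot> (m \<boxdot> m)"
    using diagonal_filler[OF epic_TensA[OF e e] m, of "e \<cdot> mmul A" "mmul B \<cdot> (m \<boxdot> m)"]
    by (auto simp: in_Hom_iff)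
  have [simp]: "arr \<mu>" "src \<mu> = x \<boxtimes> x" "tgt \<mu> = x"
    using \<mu> by (auto simp: in_Hom_iff)
  define \<eta> where "\<eta> = e \<cdot> munit A"
  have [simp]: "arr \<eta>" "src \<eta> = Unit C" "tgt \<eta> = x"
    by (simp_all add: \<eta>_def)
  have m\<eta>: "m \<cdot> \<eta> = munit B"
    using me_unit by (simp add: \<eta>_def)
  have "\<mu> \<cdot> (\<mu> \<boxdot> Idt C x) = \<mu> \<cdot> ((Idt C x \<boxdot> \<mu>) \<cdot> Assoc C x x x)"
  proof (rule monic_cancel[OF m])
    have "m \<cdot> (\<mu> \<cdot> (\<mu> \<boxdot> Idt C x)) = (mmul B \<cdot> (m \<boxdot> m)) \<cdot> (\<mu> \<boxdot> Idt C x)"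
      unfolding m\<mu>[symmetric] by simp
    also have "\<dots> = (mmul B \<cdot> (mmul B \<boxdot> Idt C (mobj B))) \<cdot> ((m \<boxdot> m) \<boxdot> m)"
      by (simp add: m\<mu>)
    also have "\<dots> = mmul B \<cdot> ((Idt C (mobj B) \<boxdot> mmul B) \<cdot>
        (Assoc C (mobj B) (mobj B) (mobj B) \<cdot> ((m \<boxdot> m) \<boxdot> m)))"
      unfolding assoc by simp
    also have "\<dots> = (mmul B \<cdot> (m \<boxdot> (m \<cdot> \<mu>))) \<cdot> Assoc C x x x"
      by (simp add: Assoc_natural_arr m\<mu>)
    also have "\<dots> = (mmul B \<cdot> (m \<boxdot> m)) \<cdot> ((Idt C x \<boxdot> \<mu>) \<cdot> Assoc C x x x)"
      by simp
    also have "\<dots> = m \<cdot> (\<mu> \<cdot> ((Idt C x \<boxdot> \<mu>) \<cdot> Assoc C x x x))"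
      unfolding m\<mu>[symmetric] by simp
    finally show "m \<cdot> (\<mu> \<cdot> (\<mu> \<boxdot> Idt C x)) = \<dots>" .
  qed simp_all
  moreover have "\<mu> \<cdot> (\<eta> \<boxdot> Idt C x) = LUnit C x"
  proof (rule monic_cancel[OF m])
    have "m \<cdot> (\<mu> \<cdot> (\<eta> \<boxdot> Idt C x)) = (mmul B \<cdot> (m \<boxdot> m)) \<cdot> (\<eta> \<boxdot> Idt C x)"
      unfolding m\<mu>[symmetric] by simp
    also have "\<dots> = (mmul B \<cdot> (munit B \<boxdot> Idt C (mobj B))) \<cdot> (Idt C (Unit C) \<boxdot> m)"
      by (simp add: m\<eta>)
    also have "\<dots> = m \<cdot> LUnit C x"
      unfolding lunit by (simp add: LUnit_natural_arr)
    finally show "m \<cdot> (\<mu> \<cdot> (\<eta> \<boxdot> Idt C x)) = \<dots>" .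
  qed simp_all
  moreover have "\<mu> \<cdot> (Idt C x \<boxdot> \<eta>) = RUnit C x"
  proof (rule monic_cancel[OF m])
    have "m \<cdot> (\<mu> \<cdot> (Idt C x \<boxdot> \<eta>)) = (mmul B \<cdot> (m \<boxdot> m)) \<cdot> (Idt C x \<boxdot> \<eta>)"
      unfolding m\<mu>[symmetric] by simp
    also have "\<dots> = (mmul B \<cdot> (Idt C (mobj B) \<boxdot> munit B)) \<cdot> (m \<boxdot> Idt C (Unit C))"
      by (simp add: m\<eta>)
    also have "\<dots> = m \<cdot> RUnit C x"
      unfolding runit by (simp add: RUnit_natural_arr)
    finally show "m \<cdot> (\<mu> \<cdot> (Idt C x \<boxdot> \<eta>)) = \<dots>" .
  qed simp_all
  moreover have "\<mu> \<cdot> Sym C x x = \<mu>"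
  proof (rule monic_cancel[OF m])
    have "m \<cdot> (\<mu> \<cdot> Sym C x x) = (mmul B \<cdot> (m \<boxdot> m)) \<cdot> Sym C x x"
      unfolding m\<mu>[symmetric] by simp
    also have "\<dots> = (mmul B \<cdot> Sym C (mobj B) (mobj B)) \<cdot> (m \<boxdot> m)"
      by (simp add: Sym_natural_arr)
    also have "\<dots> = m \<cdot> \<mu>"
      unfolding comm m\<mu> ..
    finally show "m \<cdot> (\<mu> \<cdot> Sym C x x) = \<dots>" .
  qed simp_all
  ultimately have E: "is_comm_monoid C \<lparr>mobj = x, mmul = \<mu>, munit = \<eta>\<rparr>"
    by (simp add: is_comm_monoid_def in_Hom_iff)
  show thesis
  proof (rule that)
    show "e \<in> Hom (Comm C) A \<lparr>mobj = x, mmul = \<mu>, munit = \<eta>\<rparr>"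
      using A E \<mu>e unfolding Comm_Hom_iff by (simp add: in_Hom_iff \<eta>_def)
    show "m \<in> Hom (Comm C) \<lparr>mobj = x, mmul = \<mu>, munit = \<eta>\<rparr> B"
      using B E m\<mu> m\<eta> unfolding Comm_Hom_iff by (simp add: in_Hom_iff)
  qed simp
qed

text \<open>
  The image of \<open>q\<close> in \<open>C\<close> is a module through which \<open>q\<close> factors; as it is killed by \<open>t\<close>, its
  inclusion has a section.
\<close>

lemma quotient_epic:
  assumes A: "is_comm_monoid C A"
    and t: "t \<in> Hom (Mod_cat C A) (regular_module A) (regular_module A)"
    and Q: "is_quotient_by C A t Q q"
  shows "epic C (mobj A) (mobj Q) q"
proof -
  let ?R = "regular_module A"
  let ?M = "algebra_module C Q q"
  have coker: "is_cokernel (Mod_cat C A) ?R ?R t ?M q"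
    using Q by (simp add: is_quotient_by_def)
  have q_Mod: "q \<in> Hom (Mod_cat C A) ?R ?M" and qt: "q \<cdot> t = Zero C (mobj A) (mobj Q)"
    using coker by (auto simp: is_cokernel_def Mod_Comp Mod_Zero regular_module_def algebra_module_def)
  have fst_R [simp]: "fst ?R = mobj A" and fst_M [simp]: "fst ?M = mobj Q"
    and snd_R [simp]: "snd ?R = mmul A"
    by (simp_all add: regular_module_def algebra_module_def)
  have q: "q \<in> Hom C (mobj A) (mobj Q)" and t': "t \<in> Hom C (mobj A) (mobj A)"
    and M: "is_module C A ?M" and R: "is_module C A ?R"
    and q_lin: "q \<cdot> mmul A = snd ?M \<cdot> (Idt C (mobj A) \<boxdot> q)"
    using q_Mod t by (auto simp: Mod_Hom_iff)
  obtain x e m where e: "epic C (mobj A) x e" and m: "monic C x (mobj Q) m" and me: "m \<cdot> e = q"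
    using image_factorization[OF q] by blast
  note [simp] = monoid_arr[OF A] epicD[OF e] monicD[OF m] module_arr[OF M, simplified]
  have [simp]: "x \<in> Obj C" "arr t" "src t = mobj A" "tgt t = mobj A"
    using tgt_Obj[of e] t' by (simp_all add: in_Hom_iff)
  have "m \<cdot> (e \<cdot> mmul A) = q \<cdot> mmul A"
    unfolding me[symmetric] by simp
  also have "\<dots> = (snd ?M \<cdot> (Idt C (mobj A) \<boxdot> m)) \<cdot> (Idt C (mobj A) \<boxdot> e)"
    unfolding q_lin by (simp add: me)
  \<comment> \<open>Since \<open>Idt C (mobj A) \<boxdot> e\<close> is epic, the action on
    \<open>A/tA\<close>, restricted along \<open>m\<close>, takes values in the image.\<close>
  finally obtain a where a: "a \<in> Hom C (mobj A \<boxtimes> x) x"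
    and ae: "a \<cdot> (Idt C (mobj A) \<boxdot> e) = e \<cdot> mmul A"
    and ma: "m \<cdot> a = snd ?M \<cdot> (Idt C (mobj A) \<boxdot> m)"
    using diagonal_filler[OF epic_Idt_TensA[OF e] m, of "mobj A" "e \<cdot> mmul A"
        "snd ?M \<cdot> (Idt C (mobj A) \<boxdot> m)"]
    by (auto simp: in_Hom_iff)
  have E: "is_module C A (x, a)"
    using submodule[OF A M _ a] m ma by simp
  have e_Mod: "e \<in> Hom (Mod_cat C A) ?R (x, a)"
    using R E ae by (simp add: Mod_Hom_iff in_Hom_iff)
  have m_Mod: "m \<in> Hom (Mod_cat C A) (x, a) ?M"
    using M E ma by (simp add: Mod_Hom_iff in_Hom_iff)
  have "m \<cdot> (e \<cdot> t) = Zero C (mobj A) (mobj Q)"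
    using me qt Comp_assoc_arr[of t e m] by simp
  then have "e \<cdot> t = Zero C (mobj A) x"
    using monic_zero[OF m, of "e \<cdot> t" "mobj A"] by (simp add: in_Hom_iff)
  \<comment> \<open>The universal property speaks of linear arrows only, which is why the image was
    first made into a module.\<close>
  then obtain u where u: "u \<in> Hom (Mod_cat C A) ?M (x, a)" and uq: "u \<cdot> q = e"
    using coker[unfolded is_cokernel_def Mod_Comp Mod_Zero, THEN conjunct2, THEN conjunct2,
        rule_format, OF e_Mod] by auto
  interpret Mod: category "Mod_cat C A"
    by (rule category_Mod[OF A])
  have u': "u \<in> Hom C (mobj Q) x"
    using u by (simp add: Mod_Hom_iff)
  \<comment> \<open>Linear endomorphisms of the quotient that fix \<open>q\<close> coincide;
    \<open>m \<cdot> u\<close> is one of them and the identity another.\<close>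
  have "\<exists>!h. h \<in> Hom (Mod_cat C A) ?M ?M \<and> h \<cdot> q = q"
    using coker[unfolded is_cokernel_def Mod_Comp Mod_Zero, THEN conjunct2, THEN conjunct2,
        rule_format, OF q_Mod] qt by simp
  moreover have "m \<cdot> u \<in> Hom (Mod_cat C A) ?M ?M"
    using Mod.Comp_Hom[OF u m_Mod] by (simp add: Mod_Comp)
  moreover have "(m \<cdot> u) \<cdot> q = q"
    using Comp_assoc[OF q u', of m "mobj Q"] uq me by (simp add: in_Hom_iff)
  moreover have "Idt C (mobj Q) \<in> Hom (Mod_cat C A) ?M ?M" "Idt C (mobj Q) \<cdot> q = q"
    using M q by (simp_all add: Mod_Hom_iff in_Hom_iff)
  ultimately have "m \<cdot> u = Idt C (mobj Q)"
    by blast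
  then have "epic C x (mobj Q) m"
    using split_epic[of m x "mobj Q" u] u' by (simp add: in_Hom_iff)
  from epic_Comp[OF e this] show ?thesis
    by (simp add: me)
qed

text \<open>
  The image \<open>E\<close> of \<open>A \<rightarrow> B\<close> in \<open>C\<close> is a monoid through which every \<open>A/tA \<rightarrow> B\<close> factors, because
  \<open>A \<rightarrow> A/tA\<close> is epic in \<open>C\<close>. By the universal property of \<open>B\<close>, the inclusion of \<open>E\<close> has a section.
\<close>

lemma ideal_quotient_epic:
  assumes A: "is_comm_monoid C A" and B: "is_ideal_quotient C A I B"
    and I: "I \<subseteq> Hom (Mod_cat C A) (regular_module A) (regular_module A)"
  obtains \<pi> where "\<pi> \<in> Hom (Comm C) A B" "epic C (mobj A) (mobj B) \<pi>"
proof -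
  let ?F = "\<lambda>Q i. case i of None \<Rightarrow> A | Some t \<Rightarrow> Q t"
  let ?F' = "\<lambda>Q q (i, j). case (i, j) of
            (None, None) \<Rightarrow> Idt (Comm C) A
          | (None, Some t) \<Rightarrow> q t
          | (Some t, _) \<Rightarrow> Idt (Comm C) (Q t)"
  obtain Q q l where q: "\<And>t. t \<in> I \<Longrightarrow> is_quotient_by C A t (Q t) (q t)"
    and colim: "is_colimit (fan_cat I) (Comm C) (?F Q) (?F' Q q) B l"
    using B unfolding is_ideal_quotient_def by blast
  have cocone: "is_cocone (fan_cat I) (Comm C) (?F Q) (?F' Q q) B l"
    using colim by (rule is_colimit_cocone)
  have B': "is_comm_monoid C B"
    using cocone by (simp add: is_cocone_def Comm_def)
  have q_Comm: "q t \<in> Hom (Comm C) A (Q t)" and q_epic: "epic C (mobj A) (mobj (Q t)) (q t)"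
    if "t \<in> I" for t
    using q[OF that] quotient_epic[OF A _ q[OF that]] I that by (auto simp: is_quotient_by_def)
  have l_Hom: "\<forall>i\<in>Obj (fan_cat I). l i \<in> Hom (Comm C) (?F Q i) B"
    and l_comm: "\<And>i j u. u \<in> Hom (fan_cat I) i j \<Longrightarrow> l j \<cdot> ?F' Q q u = l i"
    using cocone by (simp_all add: is_cocone_def Comm_Comp)
  have \<pi>: "l None \<in> Hom (Comm C) A B"
    using l_Hom by (simp add: fan_cat_def)
  have l_Some: "l (Some t) \<in> Hom (Comm C) (Q t) B" if "t \<in> I" for t
    using l_Hom that by (simp add: fan_cat_def)
  have lq: "l (Some t) \<cdot> q t = l None" if "t \<in> I" for t
    using l_comm[of "(None, Some t)" None "Some t"] that by (simp add: fan_cat_def)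
  obtain x e m where e: "epic C (mobj A) x e" and m: "monic C x (mobj B) m" and me: "m \<cdot> e = l None"
    using image_factorization[of "l None" "mobj A" "mobj B"] \<pi> by (metis Comm_Hom_iff)
  obtain E where x: "mobj E = x" and e_Comm: "e \<in> Hom (Comm C) A E" and m_Comm: "m \<in> Hom (Comm C) E B"
    using image_monoid[OF e m] \<pi> me by auto
  have E: "is_comm_monoid C E"
    using e_Comm by (simp add: Comm_Hom_iff)
  have "\<exists>h. h \<in> Hom (Comm C) (Q t) E \<and> h \<cdot> q t = e \<and> m \<cdot> h = l (Some t)" if t: "t \<in> I" for t
  proof -
    \<comment> \<open>Orthogonality of the epic \<open>q t\<close> and the monic \<open>m\<close>
      provides the arrow out of \<open>A/tA\<close>. It is a morphism of monoids because its
      composite with \<open>m\<close> is one.\<close>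
    obtain h where h: "h \<in> Hom C (mobj (Q t)) x" "h \<cdot> q t = e" "m \<cdot> h = l (Some t)"
      using diagonal_filler[OF q_epic[OF t] m, of e "l (Some t)"] epicD[OF e] me lq[OF t] l_Some[OF t]
      by (auto simp: Comm_Hom_iff in_Hom_iff)
    have "h \<in> Hom (Comm C) (Q t) E"
      by (rule Comm_Hom_cancel_monic[OF m_Comm])
        (use m h x l_Some[OF t] in \<open>auto simp: Comm_Hom_iff\<close>)
    with h show ?thesis
      by blast
  qed
  then obtain h where h: "\<And>t. t \<in> I \<Longrightarrow> h t \<in> Hom (Comm C) (Q t) E"
    and hq: "\<And>t. t \<in> I \<Longrightarrow> h t \<cdot> q t = e" and mh: "\<And>t. t \<in> I \<Longrightarrow> m \<cdot> h t = l (Some t)"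
    by metis
  let ?h = "\<lambda>i. case i of None \<Rightarrow> e | Some t \<Rightarrow> h t"
  have "is_cocone (fan_cat I) (Comm C) (?F Q) (?F' Q q) E ?h"
    unfolding is_cocone_def
  proof (intro conjI ballI allI)
    show "E \<in> Obj (Comm C)"
      using E by (simp add: Comm_def)
    show "?h i \<in> Hom (Comm C) (?F Q i) E" if "i \<in> Obj (fan_cat I)" for i
      using that e_Comm h by (auto simp: fan_cat_def split: option.split)
    fix i j u
    assume u: "u \<in> Hom (fan_cat I) i j"
    \<comment> \<open>All arrows of the fan, except those from \<open>None\<close> to
      \<open>Some t\<close>, are sent to identities.\<close>
    have "?h j \<cdot> Idt C (mobj (?F Q j)) = ?h j" if "j \<in> Obj (fan_cat I)"
      using that h e_Comm by (auto simp: fan_cat_def Comm_Hom_iff in_Hom_iff split: option.split)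
    then show "?h j \<cdot>\<^bsub>Comm C\<^esub> ?F' Q q u = ?h i"
      using u hq by (auto simp: fan_cat_def Comm_def split: if_splits option.splits)
  qed
  then obtain u where u: "u \<in> Hom (Comm C) B E"
    and ul: "\<And>i. i \<in> Obj (fan_cat I) \<Longrightarrow> u \<cdot> l i = ?h i"
    using colimit_factor[OF colim] unfolding Comm_Comp by blast
  have u': "u \<in> Hom C (mobj B) x"
    using u x by (simp add: Comm_Hom_iff)
  \<comment> \<open>The cocone \<open>l\<close> factors through itself in only one way, and both
    \<open>m \<cdot> u\<close> and the identity achieve it.\<close>
  have "\<exists>!h. h \<in> Hom (Comm C) B B \<and> (\<forall>i \<in> Obj (fan_cat I). h \<cdot> l i = l i)"
    using colim cocone unfolding is_colimit_def Comm_Comp by blast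
  moreover have "(m \<cdot> u) \<cdot> l i = l i" if i: "i \<in> Obj (fan_cat I)" for i
  proof -
    have "(m \<cdot> u) \<cdot> l i = m \<cdot> (u \<cdot> l i)"
      using l_Hom i u' monicD[OF m] by (auto simp: Comm_Hom_iff in_Hom_iff)
    also have "\<dots> = l i"
      using i ul[OF i] me mh by (auto simp: fan_cat_def)
    finally show ?thesis .
  qed
  moreover have "Idt C (mobj B) \<cdot> l i = l i" if i: "i \<in> Obj (fan_cat I)" for i
    using l_Hom i by (auto simp: Comm_Hom_iff in_Hom_iff)
  ultimately have "m \<cdot> u = Idt C (mobj B)"
    using Comm_Comp_Hom[OF u m_Comm] Comm_Idt_Hom[OF B'] by blast
  then have "epic C x (mobj B) m"
    using split_epic[of m x "mobj B" u] u' monicD[OF m] by (simp add: in_Hom_iff)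
  from epic_Comp[OF e this] have "epic C (mobj A) (mobj B) (l None)"
    by (simp add: me)
  with \<pi> show thesis
    using that by blast
qed


section \<open>Restriction of scalars\<close>

text \<open>Morphisms of modules are arrows of \<open>C\<close>, so restriction is the identity on
  arrows and gets no arrow map. The same \<open>F'\<close> and \<open>l\<close> then serve for a
  diagram over \<open>B\<close> and for its restriction to \<open>A\<close>.\<close>

definition restrict_scalars :: "'m \<Rightarrow> 'o \<times> 'm \<Rightarrow> 'o \<times> 'm" where
  "restrict_scalars f M = (fst M, snd M \<cdot> (f \<boxdot> Idt C (fst M)))"

lemma fst_restrict_scalars [simp]: "fst (restrict_scalars f M) = fst M"
  by (simp add: restrict_scalars_def)

lemma restrict_scalars_module:
  assumes f: "f \<in> Hom (Comm C) A B" and M: "is_module C B M"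
  shows "is_module C A (restrict_scalars f M)"
proof -
  have A: "is_comm_monoid C A" and B: "is_comm_monoid C B"
    and [simp]: "arr f" "src f = mobj A" "tgt f = mobj B"
    and f_mul: "f \<cdot> mmul A = mmul B \<cdot> (f \<boxdot> f)" and f_unit: "f \<cdot> munit A = munit B"
    using f by (auto simp: Comm_Hom_iff in_Hom_iff)
  note [simp] = monoid_arr[OF A] monoid_arr[OF B] module_arr[OF M]
  let ?A = "mobj A" and ?B = "mobj B" and ?x = "fst M" and ?a = "snd M \<cdot> (f \<boxdot> Idt C (fst M))"
  have assoc: "snd M \<cdot> (mmul B \<boxdot> Idt C ?x) =
      snd M \<cdot> ((Idt C ?B \<boxdot> snd M) \<cdot> Assoc C ?B ?B ?x)"
    and unit: "snd M \<cdot> (munit B \<boxdot> Idt C ?x) = LUnit C ?x"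
    using M by (simp_all add: is_module_def)
  have "?a \<cdot> (mmul A \<boxdot> Idt C ?x) = (snd M \<cdot> (mmul B \<boxdot> Idt C ?x)) \<cdot> ((f \<boxdot> f) \<boxdot> Idt C ?x)"
    by (simp add: f_mul)
  also have "\<dots> = snd M \<cdot> ((Idt C ?B \<boxdot> snd M) \<cdot> (Assoc C ?B ?B ?x \<cdot> ((f \<boxdot> f) \<boxdot> Idt C ?x)))"
    unfolding assoc by simp
  also have "\<dots> = ?a \<cdot> ((Idt C ?A \<boxdot> ?a) \<cdot> Assoc C ?A ?A ?x)"
    by (simp add: Assoc_natural_arr)
  finally have "?a \<cdot> (mmul A \<boxdot> Idt C ?x) = \<dots>" .
  moreover have "?a \<cdot> (munit A \<boxdot> Idt C ?x) = LUnit C ?x"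
    using unit by (simp add: f_unit)
  ultimately show ?thesis
    by (simp add: is_module_def restrict_scalars_def in_Hom_iff)
qed

lemma restrict_scalars_Hom:
  assumes f: "f \<in> Hom (Comm C) A B" and g: "g \<in> Hom (Mod_cat C B) M N"
  shows "g \<in> Hom (Mod_cat C A) (restrict_scalars f M) (restrict_scalars f N)"
proof -
  have A: "is_comm_monoid C A" and B: "is_comm_monoid C B"
    and [simp]: "arr f" "src f = mobj A" "tgt f = mobj B"
    using f by (auto simp: Comm_Hom_iff in_Hom_iff)
  have M: "is_module C B M" and N: "is_module C B N"
    and [simp]: "arr g" "src g = fst M" "tgt g = fst N"
    and g_lin: "g \<cdot> snd M = snd N \<cdot> (Idt C (mobj B) \<boxdot> g)"
    using g by (auto simp: Mod_Hom_iff in_Hom_iff)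
  note [simp] = monoid_arr[OF A] monoid_arr[OF B] module_arr[OF M] module_arr[OF N]
  have "(g \<cdot> snd M) \<cdot> (f \<boxdot> Idt C (fst M)) = (snd N \<cdot> (f \<boxdot> Idt C (fst N))) \<cdot> (Idt C (mobj A) \<boxdot> g)"
    unfolding g_lin by simp
  then show ?thesis
    using restrict_scalars_module[OF f M] restrict_scalars_module[OF f N]
    by (simp add: Mod_Hom_iff in_Hom_iff restrict_scalars_def)
qed

text \<open>\<open>A\<close>-linearity is \<open>B\<close>-linearity precomposed with
  \<open>f \<boxdot> Idt C (fst M)\<close>, and this arrow is epic.\<close>

lemma restrict_scalars_full:
  assumes f: "f \<in> Hom (Comm C) A B" "epic C (mobj A) (mobj B) f"
    and M: "is_module C B M" and N: "is_module C B N"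
    and g: "g \<in> Hom (Mod_cat C A) (restrict_scalars f M) (restrict_scalars f N)"
  shows "g \<in> Hom (Mod_cat C B) M N"
proof -
  have A: "is_comm_monoid C A" and B: "is_comm_monoid C B"
    using f by (auto simp: Comm_Hom_iff)
  have [simp]: "arr g" "src g = fst M" "tgt g = fst N"
    and g_lin: "g \<cdot> (snd M \<cdot> (f \<boxdot> Idt C (fst M))) =
      (snd N \<cdot> (f \<boxdot> Idt C (fst N))) \<cdot> (Idt C (mobj A) \<boxdot> g)"
    using g by (auto simp: Mod_Hom_iff in_Hom_iff restrict_scalars_def)
  note [simp] = epicD[OF f(2)] monoid_arr[OF A] monoid_arr[OF B] module_arr[OF M] module_arr[OF N]
  have "g \<cdot> snd M = snd N \<cdot> (Idt C (mobj B) \<boxdot> g)"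
    by (rule epic_cancel[OF epic_TensA_Idt[OF f(2), of "fst M"]]) (use g_lin in simp_all)
  then show ?thesis
    using M N by (simp add: Mod_Hom_iff in_Hom_iff)
qed


section \<open>Colimits of modules\<close>

lemma functor_Idt_TensA:
  assumes X: "X \<in> Obj C" and F: "is_functor J C F F'"
  shows "is_functor J C (\<lambda>i. X \<boxtimes> F i) (\<lambda>u. Idt C X \<boxdot> F' u)"
  unfolding is_functor_def
proof (intro conjI allI ballI)
  have F': "arr (F' u) \<and> src (F' u) = F i \<and> tgt (F' u) = F j" if "u \<in> Hom J i j" for i j u
    using F that by (auto simp: is_functor_def in_Hom_iff)
  show "X \<boxtimes> F i \<in> Obj C" "Idt C X \<boxdot> F' (Idt J i) = Idt C (X \<boxtimes> F i)" if "i \<in> Obj J" for i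
    using F X that by (simp_all add: is_functor_def)
  fix i j k u v
  assume u: "u \<in> Hom J i j"
  show "Idt C X \<boxdot> F' u \<in> Hom C (X \<boxtimes> F i) (X \<boxtimes> F j)"
    using F'[OF u] X by (simp add: in_Hom_iff)
  assume v: "v \<in> Hom J j k"
  have "F' (v \<cdot>\<^bsub>J\<^esub> u) = F' v \<cdot> F' u"
    using F u v unfolding is_functor_def by blast
  then show "Idt C X \<boxdot> F' (v \<cdot>\<^bsub>J\<^esub> u) = (Idt C X \<boxdot> F' v) \<cdot> (Idt C X \<boxdot> F' u)"
    using F'[OF u] F'[OF v] X by simp
qed

lemma TensA_colimit_cancel:
  assumes X: "X \<in> Obj C" and J: "small_cat U (J :: ('u, 'u) cat)" and F: "is_functor J C F F'"
    and L: "is_colimit J C F F' L l"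
    and g: "g \<in> Hom C (X \<boxtimes> L) Y" and h: "h \<in> Hom C (X \<boxtimes> L) Y"
    and eq: "\<And>i. i \<in> Obj J \<Longrightarrow> g \<cdot> (Idt C X \<boxdot> l i) = h \<cdot> (Idt C X \<boxdot> l i)"
  shows "g = h"
  using colimit_cancel[OF _ functor_Idt_TensA[OF X F] TensA_colimit[OF X J F L] g h eq] J
  by (simp add: small_cat_def)

lemma Mod_functor_forget:
  "is_functor J (Mod_cat C A) F F' \<Longrightarrow> is_functor J C (\<lambda>i. fst (F i)) F'"
  by (simp add: is_functor_def Mod_Hom_iff Mod_Comp Mod_Obj_iff is_module_def) (simp add: Mod_cat_def)

lemma Mod_cocone_forget:
  "is_cocone J (Mod_cat C A) F F' L l \<Longrightarrow> is_cocone J C (\<lambda>i. fst (F i)) F' (fst L) l"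
  by (simp add: is_cocone_def Mod_Hom_iff Mod_Comp Mod_Obj_iff is_module_def)

text \<open>The arrows \<open>Idt C (mobj A) \<boxdot> l i\<close> are jointly epic, and precomposed
  with them the linearity of \<open>h\<close> reduces to that of \<open>l i\<close> and
  \<open>x i\<close>.\<close>

lemma Mod_colimit_Hom:
  assumes A: "is_comm_monoid C A" and J: "small_cat U (J :: ('u, 'u) cat)"
    and F: "is_functor J (Mod_cat C A) F F'"
    and l: "is_cocone J (Mod_cat C A) F F' L l"
    and colim: "is_colimit J C (\<lambda>i. fst (F i)) F' (fst L) l"
    and x: "is_cocone J (Mod_cat C A) F F' X x"
    and h: "h \<in> Hom C (fst L) (fst X)" and hl: "\<And>i. i \<in> Obj J \<Longrightarrow> h \<cdot> l i = x i"
  shows "h \<in> Hom (Mod_cat C A) L X"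
proof -
  have L: "is_module C A L" and X: "is_module C A X"
    using l x by (auto simp: is_cocone_def Mod_Obj_iff)
  have [simp]: "arr h" "src h = fst L" "tgt h = fst X"
    using h by (auto simp: in_Hom_iff)
  note [simp] = monoid_arr[OF A] module_arr[OF L] module_arr[OF X]
  have "h \<cdot> snd L = snd X \<cdot> (Idt C (mobj A) \<boxdot> h)"
  proof (rule TensA_colimit_cancel[OF _ J Mod_functor_forget[OF F] colim])
    fix i assume i: "i \<in> Obj J"
    have Fi: "is_module C A (F i)"
      using F i by (simp add: is_functor_def Mod_Obj_iff)
    have [simp]: "arr (l i)" "src (l i) = fst (F i)" "tgt (l i) = fst L"
      and l_lin: "l i \<cdot> snd (F i) = snd L \<cdot> (Idt C (mobj A) \<boxdot> l i)"
      using l i by (auto simp: is_cocone_def Mod_Hom_iff in_Hom_iff)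
    have x_lin: "x i \<cdot> snd (F i) = snd X \<cdot> (Idt C (mobj A) \<boxdot> x i)"
      using x i by (auto simp: is_cocone_def Mod_Hom_iff)
    note [simp] = module_arr[OF Fi]
    have "(h \<cdot> snd L) \<cdot> (Idt C (mobj A) \<boxdot> l i) = (h \<cdot> l i) \<cdot> snd (F i)"
      by (simp add: l_lin)
    also have "\<dots> = snd X \<cdot> (Idt C (mobj A) \<boxdot> (h \<cdot> l i))"
      unfolding hl[OF i] by (rule x_lin)
    also have "\<dots> = (snd X \<cdot> (Idt C (mobj A) \<boxdot> h)) \<cdot> (Idt C (mobj A) \<boxdot> l i)"
      by simp
    finally show "(h \<cdot> snd L) \<cdot> (Idt C (mobj A) \<boxdot> l i) = \<dots>" .
  qed (simp_all add: in_Hom_iff)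
  then show ?thesis
    using L X h by (simp add: Mod_Hom_iff)
qed

lemma Mod_colimit_reflect:
  assumes A: "is_comm_monoid C A" and J: "small_cat U (J :: ('u, 'u) cat)"
    and F: "is_functor J (Mod_cat C A) F F'"
    and l: "is_cocone J (Mod_cat C A) F F' L l"
    and colim: "is_colimit J C (\<lambda>i. fst (F i)) F' (fst L) l"
  shows "is_colimit J (Mod_cat C A) F F' L l"
proof (rule is_colimitI[OF l])
  fix X x
  assume x: "is_cocone J (Mod_cat C A) F F' X x"
  obtain h where h: "h \<in> Hom C (fst L) (fst X)" "\<And>i. i \<in> Obj J \<Longrightarrow> h \<cdot> l i = x i"
    using colimit_factor[OF colim Mod_cocone_forget[OF x]] by blast
  then have "h \<in> Hom (Mod_cat C A) L X"
    using Mod_colimit_Hom[OF A J F l colim x] by blast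
  with h(2) show "\<exists>h \<in> Hom (Mod_cat C A) L X. \<forall>i \<in> Obj J. h \<cdot>\<^bsub>Mod_cat C A\<^esub> l i = x i"
    by (auto simp: Mod_Comp)
next
  fix X g h
  assume "g \<in> Hom (Mod_cat C A) L X" "h \<in> Hom (Mod_cat C A) L X"
    and "\<And>i. i \<in> Obj J \<Longrightarrow> g \<cdot>\<^bsub>Mod_cat C A\<^esub> l i = h \<cdot>\<^bsub>Mod_cat C A\<^esub> l i"
  then show "g = h"
    using colimit_cancel[OF _ Mod_functor_forget[OF F] colim, of g "fst X" h] J
    by (simp add: Mod_Hom_iff Mod_Comp small_cat_def)
qed

text \<open>
  The colimit in \<open>C\<close> carries a module structure, since \<open>A \<boxtimes> -\<close> preserves colimits. It is then a
  colimit of modules, so that \<open>L\<close> is isomorphic to it.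
\<close>

lemma Mod_colimit_forget:
  assumes A: "is_comm_monoid C A" and J: "small_cat U (J :: ('u, 'u) cat)"
    and F: "is_functor J (Mod_cat C A) F F'"
    and colim: "is_colimit J (Mod_cat C A) F F' L l"
  shows "is_colimit J C (\<lambda>i. fst (F i)) F' (fst L) l"
proof -
  have J_cat: "category J"
    using J by (simp add: small_cat_def)
  note F_C = Mod_functor_forget[OF F]
  note l = is_colimit_cocone[OF colim]
  obtain L\<^sub>0 l\<^sub>0 where colim\<^sub>0: "is_colimit J C (\<lambda>i. fst (F i)) F' L\<^sub>0 l\<^sub>0"
    using small_colimits J F_C unfolding has_small_colimits_def by blast
  note l\<^sub>0 = is_colimit_cocone[OF colim\<^sub>0]
  have L\<^sub>0 [simp]: "L\<^sub>0 \<in> Obj C"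
    using l\<^sub>0 by (simp add: is_cocone_def)
  let ?A = "mobj A"
  note [simp] = monoid_arr[OF A]
  have A_Obj: "?A \<in> Obj C" and AA_Obj: "?A \<boxtimes> ?A \<in> Obj C"
    by simp_all
  have F_mod: "is_module C A (F i)" if "i \<in> Obj J" for i
    using F that by (simp add: is_functor_def Mod_Obj_iff)
  have l\<^sub>0_arr: "arr (l\<^sub>0 i)" "src (l\<^sub>0 i) = fst (F i)" "tgt (l\<^sub>0 i) = L\<^sub>0" if "i \<in> Obj J" for i
    using l\<^sub>0 that by (auto simp: is_cocone_def in_Hom_iff)
  \<comment> \<open>The actions followed by the injections form a cocone because the transition
    arrows are linear; it induces the action on \<open>L\<^sub>0\<close>.\<close>
  have "is_cocone J C (\<lambda>i. ?A \<boxtimes> fst (F i)) (\<lambda>u. Idt C ?A \<boxdot> F' u) L\<^sub>0 (\<lambda>i. l\<^sub>0 i \<cdot> snd (F i))"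
    unfolding is_cocone_def
  proof (intro conjI ballI allI)
    show "l\<^sub>0 i \<cdot> snd (F i) \<in> Hom C (?A \<boxtimes> fst (F i)) L\<^sub>0" if "i \<in> Obj J" for i
      using that l\<^sub>0_arr module_arr[OF F_mod] by (simp add: in_Hom_iff)
    fix i j u
    assume u: "u \<in> Hom J i j"
    then have i: "i \<in> Obj J" and j: "j \<in> Obj J"
      using category.Hom_Obj[OF J_cat] by blast+
    have "F' u \<in> Hom (Mod_cat C A) (F i) (F j)"
      using F u unfolding is_functor_def by blast
    then have [simp]: "arr (F' u)" "src (F' u) = fst (F i)" "tgt (F' u) = fst (F j)"
      and F'_lin: "F' u \<cdot> snd (F i) = snd (F j) \<cdot> (Idt C ?A \<boxdot> F' u)"
      by (auto simp: Mod_Hom_iff in_Hom_iff)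
    have "l\<^sub>0 j \<cdot> F' u = l\<^sub>0 i"
      using l\<^sub>0 u unfolding is_cocone_def by blast
    then have "l\<^sub>0 i \<cdot> snd (F i) = (l\<^sub>0 j \<cdot> F' u) \<cdot> snd (F i)"
      by simp
    also have "\<dots> = (l\<^sub>0 j \<cdot> snd (F j)) \<cdot> (Idt C ?A \<boxdot> F' u)"
      using l\<^sub>0_arr[OF j] module_arr[OF F_mod[OF i]] module_arr[OF F_mod[OF j]] F'_lin by simp
    finally show "(l\<^sub>0 j \<cdot> snd (F j)) \<cdot> (Idt C ?A \<boxdot> F' u) = l\<^sub>0 i \<cdot> snd (F i)" ..
  qed simp
  then obtain a where a: "a \<in> Hom C (?A \<boxtimes> L\<^sub>0) L\<^sub>0"
    and al: "\<And>i. i \<in> Obj J \<Longrightarrow> a \<cdot> (Idt C ?A \<boxdot> l\<^sub>0 i) = l\<^sub>0 i \<cdot> snd (F i)"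
    using colimit_factor[OF TensA_colimit[OF A_Obj J F_C colim\<^sub>0]] by blast
  have [simp]: "arr a" "src a = ?A \<boxtimes> L\<^sub>0" "tgt a = L\<^sub>0"
    using a by (auto simp: in_Hom_iff)
  \<comment> \<open>Both sides start at \<open>(A \<boxtimes> A) \<boxtimes> L\<^sub>0\<close>,
    which is again a colimit, so associativity may be checked on each \<open>F i\<close>.\<close>
  have "a \<cdot> (mmul A \<boxdot> Idt C L\<^sub>0) = a \<cdot> ((Idt C ?A \<boxdot> a) \<cdot> Assoc C ?A ?A L\<^sub>0)"
  proof (rule TensA_colimit_cancel[OF AA_Obj J F_C colim\<^sub>0])
    fix i assume i: "i \<in> Obj J"
    note [simp] = l\<^sub>0_arr[OF i] module_arr[OF F_mod[OF i]]
    have assoc: "snd (F i) \<cdot> (mmul A \<boxdot> Idt C (fst (F i))) =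
        snd (F i) \<cdot> ((Idt C ?A \<boxdot> snd (F i)) \<cdot> Assoc C ?A ?A (fst (F i)))"
      using F_mod[OF i] by (simp add: is_module_def)
    have "(a \<cdot> (mmul A \<boxdot> Idt C L\<^sub>0)) \<cdot> (Idt C (?A \<boxtimes> ?A) \<boxdot> l\<^sub>0 i) =
        (a \<cdot> (Idt C ?A \<boxdot> l\<^sub>0 i)) \<cdot> (mmul A \<boxdot> Idt C (fst (F i)))"
      by simp
    also have "\<dots> = (l\<^sub>0 i \<cdot> snd (F i)) \<cdot> ((Idt C ?A \<boxdot> snd (F i)) \<cdot> Assoc C ?A ?A (fst (F i)))"
      unfolding al[OF i] using assoc by simp
    also have "\<dots> = (a \<cdot> (Idt C ?A \<boxdot> l\<^sub>0 i)) \<cdot> ((Idt C ?A \<boxdot> snd (F i)) \<cdot> Assoc C ?A ?A (fst (F i)))"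
      unfolding al[OF i] ..
    also have "\<dots> = (a \<cdot> (Idt C ?A \<boxdot> (l\<^sub>0 i \<cdot> snd (F i)))) \<cdot> Assoc C ?A ?A (fst (F i))"
      by simp
    also have "\<dots> = (a \<cdot> ((Idt C ?A \<boxdot> a) \<cdot> Assoc C ?A ?A L\<^sub>0)) \<cdot> (Idt C (?A \<boxtimes> ?A) \<boxdot> l\<^sub>0 i)"
      by (simp add: Assoc_natural_Idt al[OF i])
    finally show "(a \<cdot> (mmul A \<boxdot> Idt C L\<^sub>0)) \<cdot> (Idt C (?A \<boxtimes> ?A) \<boxdot> l\<^sub>0 i) = \<dots>" .
  qed (simp_all add: in_Hom_iff)
  moreover have "a \<cdot> (munit A \<boxdot> Idt C L\<^sub>0) = LUnit C L\<^sub>0"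
  proof (rule TensA_colimit_cancel[OF Unit_Obj J F_C colim\<^sub>0])
    fix i assume i: "i \<in> Obj J"
    note [simp] = l\<^sub>0_arr[OF i] module_arr[OF F_mod[OF i]]
    have unit: "snd (F i) \<cdot> (munit A \<boxdot> Idt C (fst (F i))) = LUnit C (fst (F i))"
      using F_mod[OF i] by (simp add: is_module_def)
    have "(a \<cdot> (munit A \<boxdot> Idt C L\<^sub>0)) \<cdot> (Idt C (Unit C) \<boxdot> l\<^sub>0 i) =
        (a \<cdot> (Idt C ?A \<boxdot> l\<^sub>0 i)) \<cdot> (munit A \<boxdot> Idt C (fst (F i)))"
      by simp
    also have "\<dots> = LUnit C L\<^sub>0 \<cdot> (Idt C (Unit C) \<boxdot> l\<^sub>0 i)"
      unfolding al[OF i] using unit by (simp add: LUnit_natural_arr)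
    finally show "(a \<cdot> (munit A \<boxdot> Idt C L\<^sub>0)) \<cdot> (Idt C (Unit C) \<boxdot> l\<^sub>0 i) = \<dots>" .
  qed (simp_all add: in_Hom_iff)
  ultimately have L\<^sub>0_mod: "is_module C A (L\<^sub>0, a)"
    by (simp add: is_module_def in_Hom_iff)
  have l\<^sub>0_Mod: "is_cocone J (Mod_cat C A) F F' (L\<^sub>0, a) l\<^sub>0"
    using l\<^sub>0 L\<^sub>0_mod al F_mod by (simp add: is_cocone_def Mod_Obj_iff Mod_Hom_iff Mod_Comp)
  obtain u where u: "u \<in> Hom (Mod_cat C A) L (L\<^sub>0, a)" and ul: "\<And>i. i \<in> Obj J \<Longrightarrow> u \<cdot> l i = l\<^sub>0 i"
    using colimit_factor[OF colim l\<^sub>0_Mod] unfolding Mod_Comp by blast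
  obtain v where v: "v \<in> Hom C L\<^sub>0 (fst L)" and vl: "\<And>i. i \<in> Obj J \<Longrightarrow> v \<cdot> l\<^sub>0 i = l i"
    using colimit_factor[OF colim\<^sub>0 Mod_cocone_forget[OF l]] by blast
  have v_Mod: "v \<in> Hom (Mod_cat C A) (L\<^sub>0, a) L"
    using Mod_colimit_Hom[OF A J F l\<^sub>0_Mod _ l] colim\<^sub>0 v vl by simp
  have u_C: "u \<in> Hom C (fst L) L\<^sub>0"
    using u by (simp add: Mod_Hom_iff)
  have l_C: "l i \<in> Hom C (fst (F i)) (fst L)" if "i \<in> Obj J" for i
    using Mod_cocone_forget[OF l] that by (simp add: is_cocone_def)
  interpret Mod: category "Mod_cat C A"
    by (rule category_Mod[OF A])
  have L_Obj: "L \<in> Obj (Mod_cat C A)"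
    using l by (simp add: is_cocone_def)
  \<comment> \<open>The universal property of \<open>L\<close> among modules makes it a retract of
    \<open>L\<^sub>0\<close>. This suffices, since factorizations are transported along
    \<open>u\<close> and equality is tested along \<open>v\<close>.\<close>
  have "v \<cdot> u = Idt (Mod_cat C A) L"
  proof (rule Mod.colimit_cancel[OF J_cat F colim])
    show "v \<cdot> u \<in> Hom (Mod_cat C A) L L"
      using Mod.Comp_Hom[OF u v_Mod] by (simp add: Mod_Comp)
    show "Idt (Mod_cat C A) L \<in> Hom (Mod_cat C A) L L"
      using Mod.Idt_Hom[OF L_Obj] .
    fix i assume i: "i \<in> Obj J"
    have "l i \<in> Hom (Mod_cat C A) (F i) L"
      using l i by (simp add: is_cocone_def)
    then show "(v \<cdot> u) \<cdot>\<^bsub>Mod_cat C A\<^esub> l i = Idt (Mod_cat C A) L \<cdot>\<^bsub>Mod_cat C A\<^esub> l i"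
      using Mod.Idt_Comp Comp_assoc[OF l_C[OF i] u_C v] ul[OF i] vl[OF i] by (simp add: Mod_Comp)
  qed
  then have vu: "v \<cdot> u = Idt C (fst L)"
    by (simp add: Mod_cat_def)
  show ?thesis
  proof (rule is_colimitI[OF Mod_cocone_forget[OF l]])
    fix X x
    assume "is_cocone J C (\<lambda>i. fst (F i)) F' X x"
    then obtain h where h: "h \<in> Hom C L\<^sub>0 X" "\<And>i. i \<in> Obj J \<Longrightarrow> h \<cdot> l\<^sub>0 i = x i"
      using colimit_factor[OF colim\<^sub>0] by blast
    have "(h \<cdot> u) \<cdot> l i = x i" if "i \<in> Obj J" for i
      using Comp_assoc[OF l_C[OF that] u_C h(1)] ul h that by simp
    then show "\<exists>h\<in>Hom C (fst L) X. \<forall>i\<in>Obj J. h \<cdot> l i = x i"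
      using Comp_Hom[OF u_C h(1)] by blast
  next
    fix X g h
    assume g: "g \<in> Hom C (fst L) X" and h: "h \<in> Hom C (fst L) X"
      and eq: "\<And>i. i \<in> Obj J \<Longrightarrow> g \<cdot> l i = h \<cdot> l i"
    have "g \<cdot> v = h \<cdot> v"
    proof (rule colimit_cancel[OF J_cat F_C colim\<^sub>0 Comp_Hom[OF v g] Comp_Hom[OF v h]])
      fix i assume i: "i \<in> Obj J"
      have "l\<^sub>0 i \<in> Hom C (fst (F i)) L\<^sub>0"
        using l\<^sub>0_arr[OF i] by (simp add: in_Hom_iff)
      then show "(g \<cdot> v) \<cdot> l\<^sub>0 i = (h \<cdot> v) \<cdot> l\<^sub>0 i"
        using Comp_assoc v g h vl[OF i] eq[OF i] by metis
    qed
    then have "g \<cdot> (v \<cdot> u) = h \<cdot> (v \<cdot> u)"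
      using Comp_assoc[OF u_C v g] Comp_assoc[OF u_C v h] by simp
    then show "g = h"
      using vu Comp_Idt[OF g] Comp_Idt[OF h] by simp
  qed
qed

text \<open>Both module categories compute colimits in \<open>C\<close>: the colimit over
  \<open>B\<close> is forgotten to \<open>C\<close> and from there reflected to
  \<open>A\<close>.\<close>

lemma restrict_scalars_colimit:
  assumes f: "f \<in> Hom (Comm C) A B" and J: "small_cat U (J :: ('u, 'u) cat)"
    and F: "is_functor J (Mod_cat C B) F F'"
    and colim: "is_colimit J (Mod_cat C B) F F' L l"
  shows "is_functor J (Mod_cat C A) (\<lambda>i. restrict_scalars f (F i)) F'"
    and "is_colimit J (Mod_cat C A) (\<lambda>i. restrict_scalars f (F i)) F' (restrict_scalars f L) l"
proof -
  have A: "is_comm_monoid C A" and B: "is_comm_monoid C B"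
    using f by (auto simp: Comm_Hom_iff)
  show F_A: "is_functor J (Mod_cat C A) (\<lambda>i. restrict_scalars f (F i)) F'"
    unfolding is_functor_def
  proof (intro conjI ballI allI)
    show "restrict_scalars f (F i) \<in> Obj (Mod_cat C A)"
      "F' (Idt J i) = Idt (Mod_cat C A) (restrict_scalars f (F i))" if "i \<in> Obj J" for i
      using F that restrict_scalars_module[OF f] by (auto simp: is_functor_def Mod_cat_def)
    show "F' u \<in> Hom (Mod_cat C A) (restrict_scalars f (F i)) (restrict_scalars f (F j))"
      if "u \<in> Hom J i j" for i j u
      using F that restrict_scalars_Hom[OF f] unfolding is_functor_def by blast
    show "F' (v \<cdot>\<^bsub>J\<^esub> u) = F' v \<cdot>\<^bsub>Mod_cat C A\<^esub> F' u" if "u \<in> Hom J i j" "v \<in> Hom J j k" for i j k u v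
      using F that unfolding is_functor_def Mod_Comp by blast
  qed
  have l_B: "is_cocone J (Mod_cat C B) F F' L l"
    by (rule is_colimit_cocone[OF colim])
  have l_A: "is_cocone J (Mod_cat C A) (\<lambda>i. restrict_scalars f (F i)) F' (restrict_scalars f L) l"
    unfolding is_cocone_def
  proof (intro conjI ballI allI)
    show "restrict_scalars f L \<in> Obj (Mod_cat C A)"
      using l_B restrict_scalars_module[OF f] by (simp add: is_cocone_def Mod_Obj_iff)
    show "l i \<in> Hom (Mod_cat C A) (restrict_scalars f (F i)) (restrict_scalars f L)"
      if "i \<in> Obj J" for i
      using l_B that restrict_scalars_Hom[OF f] by (simp add: is_cocone_def)
    show "l j \<cdot>\<^bsub>Mod_cat C A\<^esub> F' u = l i" if "u \<in> Hom J i j" for i j u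
      using l_B that unfolding is_cocone_def Mod_Comp by blast
  qed
  show "is_colimit J (Mod_cat C A) (\<lambda>i. restrict_scalars f (F i)) F' (restrict_scalars f L) l"
    using Mod_colimit_reflect[OF A J F_A l_A] Mod_colimit_forget[OF B J F colim] by simp
qed

end

section \<open>Colimits of hom-sets\<close>

abbreviation colim_Hom_rel ::
  "('o, 'm, 'z) cat_scheme \<Rightarrow> 'o \<Rightarrow> ('i, 'j) cat \<Rightarrow> ('i \<Rightarrow> 'o) \<Rightarrow> ('j \<Rightarrow> 'm)
    \<Rightarrow> (('i \<times> 'm) \<times> ('i \<times> 'm)) set" where
  "colim_Hom_rel C N J F F' \<equiv> (colim_Hom_step C N J F F' \<union> (colim_Hom_step C N J F F')\<inverse>)\<^sup>*"

text \<open>A step in either direction leaves the value under the cocone unchanged. Membership of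
  \<open>x\<close> is a premise because the reflexive closure also relates pairs outside the
  disjoint union.\<close>

lemma (in category) colim_Hom_rel_value:
  assumes J: "category J" and F: "is_functor J C F F'" and l: "is_cocone J C F F' L l"
    and "(x, y) \<in> colim_Hom_rel C N J F F'" "x \<in> (SIGMA i : Obj J. Hom C N (F i))"
  shows "y \<in> (SIGMA i : Obj J. Hom C N (F i)) \<and> l (fst y) \<cdot> snd y = l (fst x) \<cdot> snd x"
  using assms(4,5)
proof (induction rule: rtrancl_induct)
  case (step y z)
  have step_value: "i \<in> Obj J \<and> j \<in> Obj J \<and> F' u \<cdot> f \<in> Hom C N (F j) \<and> l j \<cdot> (F' u \<cdot> f) = l i \<cdot> f"
    if u: "u \<in> Hom J i j" and f: "f \<in> Hom C N (F i)" for i j u f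
  proof -
    have ij: "i \<in> Obj J" "j \<in> Obj J"
      using category.Hom_Obj[OF J u] by auto
    have u': "F' u \<in> Hom C (F i) (F j)"
      using F u unfolding is_functor_def by blast
    have "l j \<in> Hom C (F j) L" "l j \<cdot> F' u = l i"
      using l u ij unfolding is_cocone_def by blast+
    then show ?thesis
      using Comp_assoc[OF f u'] Comp_Hom[OF f u'] ij by metis
  qed
  from step.hyps(2) consider
      i j u f where "y = (i, f)" "z = (j, F' u \<cdot> f)" "u \<in> Hom J i j" "f \<in> Hom C N (F i)"
    | i j u f where "z = (i, f)" "y = (j, F' u \<cdot> f)" "u \<in> Hom J i j" "f \<in> Hom C N (F i)"
    unfolding colim_Hom_step_def by blast
  then show ?case
    using step.IH[OF step.prems] step_value by cases auto
qed simp

text \<open>The value under the cocone is constant on classes, so \<open>the_elem\<close> returns it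
  and bijectivity can be expressed by representatives. As \<open>J\<close> is an arbitrary category,
  chains of steps are kept and not replaced by an equality at a common later stage.\<close>

lemma (in category) Hom_preserves_colimit_iff:
  assumes J: "category J" and F: "is_functor J C F F'" and l: "is_cocone J C F F' L l"
  shows "Hom_preserves_colimit C N J F F' L l \<longleftrightarrow>
    (\<forall>g \<in> Hom C N L. \<exists>i \<in> Obj J. \<exists>f \<in> Hom C N (F i). l i \<cdot> f = g) \<and>
    (\<forall>i \<in> Obj J. \<forall>j \<in> Obj J. \<forall>f \<in> Hom C N (F i). \<forall>g \<in> Hom C N (F j).
      l i \<cdot> f = l j \<cdot> g \<longrightarrow> ((i, f), (j, g)) \<in> colim_Hom_rel C N J F F')"
proof -
  let ?S = "SIGMA i : Obj J. Hom C N (F i)"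
  let ?R = "colim_Hom_rel C N J F F'"
  let ?v = "\<lambda>x. l (fst x) \<cdot> snd x"
  let ?m = "colim_Hom_map C l"
  have sym: "sym ?R"
    by (intro sym_rtrancl) (auto simp: sym_def)
  have map_class: "?m (?R `` {x}) = ?v x" if x: "x \<in> ?S" for x
  proof -
    have "(\<lambda>(i, f). l i \<cdot> f) ` (?R `` {x}) = (\<lambda>_. ?v x) ` (?R `` {x})"
    proof (rule image_cong[OF refl])
      fix y assume "y \<in> ?R `` {x}"
      then show "(case y of (i, f) \<Rightarrow> l i \<cdot> f) = ?v x"
        using colim_Hom_rel_value[OF J F l _ x, of y] by (simp add: case_prod_beta)
    qed
    also have "\<dots> = {?v x}"
      by (rule image_constant[of x]) simp
    finally show ?thesis
      by (simp add: colim_Hom_map_def)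
  qed
  have class_eq: "?R `` {x} = ?R `` {y} \<longleftrightarrow> (x, y) \<in> ?R" for x y
  proof
    assume "?R `` {x} = ?R `` {y}"
    then show "(x, y) \<in> ?R"
      by blast
  next
    assume "(x, y) \<in> ?R"
    moreover from this have "(y, x) \<in> ?R"
      using sym by (auto dest: symD)
    ultimately show "?R `` {x} = ?R `` {y}"
      by (auto intro: rtrancl_trans)
  qed
  have quotient: "colim_Hom C N J F F' = (\<lambda>x. ?R `` {x}) ` ?S"
    by (auto simp: colim_Hom_def quotient_def)
  have "?v x \<in> Hom C N L" if "x \<in> ?S" for x
  proof -
    have "snd x \<in> Hom C N (F (fst x))" "l (fst x) \<in> Hom C (F (fst x)) L"
      using that l unfolding is_cocone_def by auto
    then show ?thesis
      by (rule Comp_Hom)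
  qed
  then have "?m ` colim_Hom C N J F F' \<subseteq> Hom C N L"
    unfolding quotient using map_class by auto
  moreover have "Hom C N L \<subseteq> ?m ` colim_Hom C N J F F' \<longleftrightarrow>
      (\<forall>g \<in> Hom C N L. \<exists>i \<in> Obj J. \<exists>f \<in> Hom C N (F i). l i \<cdot> f = g)"
  proof -
    have "?m ` colim_Hom C N J F F' = ?v ` ?S"
      unfolding quotient image_image using map_class by (rule image_cong[OF refl])
    then show ?thesis
      by force
  qed
  moreover have "inj_on ?m (colim_Hom C N J F F') \<longleftrightarrow>
      (\<forall>x \<in> ?S. \<forall>y \<in> ?S. ?v x = ?v y \<longrightarrow> (x, y) \<in> ?R)"
    unfolding quotient inj_on_def by (simp add: map_class class_eq del: mem_Sigma_iff)
  ultimately show ?thesis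
    unfolding Hom_preserves_colimit_def bij_betw_def by auto
qed


section \<open>Modules over a quotient\<close>

context base_category
begin

text \<open>The action on the pullback comes from its universal property: multiplication by
  \<open>A\<close> along \<open>k\<close> and the action on \<open>N\<close> along
  \<open>\<pi> \<boxdot> p\<close> agree in \<open>B\<close>, because \<open>\<pi>\<close> is
  multiplicative and \<open>i\<close> is linear.\<close>

lemma Mod_pullback:
  assumes \<pi>: "\<pi> \<in> Hom (Comm C) A B" "epic C (mobj A) (mobj B) \<pi>"
    and i: "i \<in> Hom (Mod_cat C B) N (regular_module B)" "monic C (fst N) (mobj B) i"
  obtains P k p where "k \<in> Hom (Mod_cat C A) P (regular_module A)" "monic C (fst P) (mobj A) k"
    "p \<in> Hom (Mod_cat C A) P (restrict_scalars \<pi> N)" "epic C (fst P) (fst N) p"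
proof -
  have A: "is_comm_monoid C A" and B: "is_comm_monoid C B"
    and \<pi>_mul: "\<pi> \<cdot> mmul A = mmul B \<cdot> (\<pi> \<boxdot> \<pi>)"
    using \<pi> by (auto simp: Comm_Hom_iff)
  have N: "is_module C B N" and i_lin: "i \<cdot> snd N = mmul B \<cdot> (Idt C (mobj B) \<boxdot> i)"
    using i by (auto simp: Mod_Hom_iff regular_module_def)
  obtain x k p where k: "monic C x (mobj A) k" and p: "epic C x (fst N) p" and sq: "\<pi> \<cdot> k = i \<cdot> p"
    and univ: "\<And>y u v. u \<in> Hom C y (mobj A) \<Longrightarrow> v \<in> Hom C y (fst N) \<Longrightarrow> \<pi> \<cdot> u = i \<cdot> v \<Longrightarrow>
      \<exists>w \<in> Hom C y x. k \<cdot> w = u \<and> p \<cdot> w = v"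
    using pullback_epic_monic[OF \<pi>(2) i(2)] by blast
  note [simp] = epicD[OF \<pi>(2)] monicD[OF i(2)] monicD[OF k] epicD[OF p]
    monoid_arr[OF A] monoid_arr[OF B] module_arr[OF N]
  have [simp]: "x \<in> Obj C"
    using src_Obj[of k] by simp
  have "(\<pi> \<cdot> mmul A) \<cdot> (Idt C (mobj A) \<boxdot> k) = (mmul B \<cdot> (Idt C (mobj B) \<boxdot> i)) \<cdot> (\<pi> \<boxdot> p)"
    unfolding \<pi>_mul by (simp add: sq)
  then have "\<pi> \<cdot> (mmul A \<cdot> (Idt C (mobj A) \<boxdot> k)) = i \<cdot> (snd N \<cdot> (\<pi> \<boxdot> p))"
    unfolding i_lin[symmetric] by simp
  then obtain a where a: "a \<in> Hom C (mobj A \<boxtimes> x) x"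
    and ka: "k \<cdot> a = mmul A \<cdot> (Idt C (mobj A) \<boxdot> k)" and pa: "p \<cdot> a = snd N \<cdot> (\<pi> \<boxdot> p)"
    using univ[of "mmul A \<cdot> (Idt C (mobj A) \<boxdot> k)" "mobj A \<boxtimes> x" "snd N \<cdot> (\<pi> \<boxdot> p)"]
    by (auto simp: in_Hom_iff)
  have P: "is_module C A (x, a)"
    using submodule[OF A regular_module[OF A] _ a] k ka by (simp add: regular_module_def)
  show thesis
  proof (rule that)
    show "k \<in> Hom (Mod_cat C A) (x, a) (regular_module A)"
      using P regular_module[OF A] ka by (simp add: Mod_Hom_iff in_Hom_iff regular_module_def)
    show "p \<in> Hom (Mod_cat C A) (x, a) (restrict_scalars \<pi> N)"
      using P restrict_scalars_module[OF \<pi>(1) N] pa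
      by (simp add: Mod_Hom_iff in_Hom_iff restrict_scalars_def)
  qed (use k p in simp_all)
qed

text \<open>
  For \<open>h : P \<rightarrow> M\<^sub>i\<close> with \<open>l\<^sub>i \<cdot> h\<close> zero on the kernel \<open>K\<close> of \<open>P \<rightarrow> N\<close>, the injectivity of
  \<open>colim Hom(K, M\<^sub>i) \<rightarrow> Hom(K, M)\<close> shows that \<open>h\<close> is zero on \<open>K\<close>: as the transition maps are monic,
  being zero is invariant under the relation that defines \<open>colim Hom(K, M\<^sub>i)\<close>. So \<open>h\<close> factors through \<open>N\<close>.
  For the same reason, chains in the relation that defines \<open>colim Hom(P, M\<^sub>i)\<close> lift to \<open>N\<close>.
\<close>

lemma finitely_generated_quotient:
  assumes \<pi>: "\<pi> \<in> Hom (Comm C) A B" "epic C (mobj A) (mobj B) \<pi>"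
    and N: "is_module C B N"
    and P: "finitely_generated U (Mod_cat C A) P"
    and p: "p \<in> Hom (Mod_cat C A) P (restrict_scalars \<pi> N)" "epic C (fst P) (fst N) p"
    and K: "finitely_generated U (Mod_cat C A) K"
    and k: "k \<in> Hom (Mod_cat C A) K P" "is_kernel C (fst P) (fst N) p (fst K) k"
  shows "finitely_generated U (Mod_cat C B) N"
  unfolding finitely_generated_def
proof (intro conjI allI impI)
  show "N \<in> Obj (Mod_cat C B)"
    using N by (simp add: Mod_Obj_iff)
  fix J :: "('u, 'u) cat" and F F' L l
  assume J: "small_cat U J" and filtered: "filtered J" and F: "is_functor J (Mod_cat C B) F F'"
    and monics: "\<forall>i j. \<forall>u\<in>Hom J i j. monic (Mod_cat C B) (F i) (F j) (F' u)"
    and colim: "is_colimit J (Mod_cat C B) F F' L l"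
  have A: "is_comm_monoid C A" and B: "is_comm_monoid C B"
    using \<pi> by (auto simp: Comm_Hom_iff)
  have J_cat: "category J"
    using J by (simp add: small_cat_def)
  let ?r = "restrict_scalars \<pi>"
  let ?G = "\<lambda>i. ?r (F i)"
  note G = restrict_scalars_colimit(1)[OF \<pi>(1) J F colim]
  note G_colim = restrict_scalars_colimit(2)[OF \<pi>(1) J F colim]
  interpret ModA: category "Mod_cat C A"
    by (rule category_Mod[OF A])
  interpret ModB: category "Mod_cat C B"
    by (rule category_Mod[OF B])
  have F_mod: "is_module C B (F i)" and l_B: "l i \<in> Hom (Mod_cat C B) (F i) L" if "i \<in> Obj J" for i
    using F is_colimit_cocone[OF colim] that by (simp_all add: is_functor_def is_cocone_def Mod_Obj_iff)
  have F'_B: "F' u \<in> Hom (Mod_cat C B) (F i) (F j)" if "u \<in> Hom J i j" for i j u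
    using F that unfolding is_functor_def by blast
  have F'_monic: "monic C (fst (F i)) (fst (F j)) (F' u)" if "u \<in> Hom J i j" for i j u
    using monics that monic_if_Mod_monic[OF B] by blast
  \<comment> \<open>A test system over \<open>B\<close> remains one over \<open>A\<close>, since
    being monic is the same for modules as in \<open>C\<close>.\<close>
  have G_monic: "monic (Mod_cat C A) (?G i) (?G j) (F' u)" if "u \<in> Hom J i j" for i j u
    using Mod_monic_if_monic[OF restrict_scalars_Hom[OF \<pi>(1) F'_B[OF that]]] F'_monic[OF that] by simp
  have preserves: "Hom_preserves_colimit (Mod_cat C A) M J ?G F' (?r L) l"
    if "finitely_generated U (Mod_cat C A) M" for M
    using that J filtered G G_monic G_colim unfolding finitely_generated_def by blast
  note preserves_iff = ModA.Hom_preserves_colimit_iff[OF J_cat G is_colimit_cocone[OF G_colim], unfolded Mod_Comp]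
  note P_preserves = preserves[OF P, unfolded preserves_iff]
  note K_preserves = preserves[OF K, unfolded preserves_iff]
  have K_mod: "is_module C A K" and P_mod: "is_module C A P"
    using k by (auto simp: Mod_Hom_iff)
  have k_C: "k \<in> Hom C (fst K) (fst P)" and p_C: "p \<in> Hom C (fst P) (fst N)"
    and pk: "p \<cdot> k = Zero C (fst K) (fst N)"
    using k p by (auto simp: Mod_Hom_iff is_kernel_def)
  have zero_iff: "snd x = Zero C (fst K) (fst (F (fst x))) \<longleftrightarrow> snd y = Zero C (fst K) (fst (F (fst y)))"
    if "(x, y) \<in> colim_Hom_rel (Mod_cat C A) K J ?G F'" for x y
    using that
  proof (induction rule: rtrancl_induct)
    case (step y z)
    have "f = Zero C (fst K) (fst (F i)) \<longleftrightarrow> F' u \<cdot> f = Zero C (fst K) (fst (F j))"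
      if u: "u \<in> Hom J i j" and f: "f \<in> Hom (Mod_cat C A) K (?G i)" for i j u f
    proof -
      have "f \<in> Hom C (fst K) (fst (F i))" "F' u \<in> Hom C (fst (F i)) (fst (F j))"
        using f F'_B[OF u] by (simp_all add: Mod_Hom_iff)
      then show ?thesis
        using monic_zero[OF F'_monic[OF u]] Comp_eq_Zero(1) by blast
    qed
    then show ?case
      using step unfolding colim_Hom_step_def Mod_Comp by auto
  qed simp
  \<comment> \<open>The descended arrow exists in \<open>C\<close>; it is \<open>A\<close>-linear
    because \<open>p\<close> is epic, and then \<open>B\<close>-linear because \<open>\<pi>\<close>
    is epic.\<close>
  have descend: "\<exists>h'. h' \<in> Hom (Mod_cat C B) N (F i) \<and> h' \<cdot> p = h"
    if i: "i \<in> Obj J" and h: "h \<in> Hom (Mod_cat C A) P (?G i)" and hk: "h \<cdot> k = Zero C (fst K) (fst (F i))"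
    for i h
  proof -
    have "h \<in> Hom C (fst P) (fst (F i))"
      using h by (simp add: Mod_Hom_iff)
    then obtain h' where h': "h' \<in> Hom C (fst N) (fst (F i))" "h' \<cdot> p = h"
      using epic_extend_kernel[OF p(2) k(2) _ hk] by blast
    have "h' \<in> Hom (Mod_cat C A) (?r N) (?G i)"
      by (rule Mod_Hom_cancel_epic[OF A p(1)])
        (use p(2) h h' restrict_scalars_module[OF \<pi>(1) F_mod[OF i]] in simp_all)
    then show ?thesis
      using restrict_scalars_full[OF \<pi> N F_mod[OF i]] h' by blast
  qed
  have "\<exists>i\<in>Obj J. \<exists>f\<in>Hom (Mod_cat C B) N (F i). l i \<cdot> f = g" if g: "g \<in> Hom (Mod_cat C B) N L" for g
  proof -
    have g_C: "g \<in> Hom C (fst N) (fst L)"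
      using g by (simp add: Mod_Hom_iff)
    have "g \<cdot> p \<in> Hom (Mod_cat C A) P (?r L)"
      using ModA.Comp_Hom[OF p(1) restrict_scalars_Hom[OF \<pi>(1) g]] by (simp add: Mod_Comp)
    then obtain i h where i: "i \<in> Obj J" and h: "h \<in> Hom (Mod_cat C A) P (?G i)" and lh: "l i \<cdot> h = g \<cdot> p"
      using P_preserves by blast
    have h_C: "h \<in> Hom C (fst P) (fst (F i))" and l_C: "l i \<in> Hom C (fst (F i)) (fst L)"
      using h l_B[OF i] by (simp_all add: Mod_Hom_iff)
    have hk: "h \<cdot> k \<in> Hom (Mod_cat C A) K (?G i)"
      using ModA.Comp_Hom[OF k(1) h] by (simp add: Mod_Comp)
    have "l i \<cdot> (h \<cdot> k) = g \<cdot> (p \<cdot> k)"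
      using Comp_assoc[OF k_C h_C l_C] Comp_assoc[OF k_C p_C g_C] lh by simp
    also have "\<dots> = Zero C (fst K) (fst L)"
      by (rule Comp_eq_Zero(1)[OF Comp_Hom[OF k_C p_C] g_C pk])
    also have "\<dots> = l i \<cdot> Zero C (fst K) (fst (F i))"
      using Comp_Zero[OF l_C] module_arr[OF K_mod] by simp
    finally have "l i \<cdot> (h \<cdot> k) = \<dots>" .
    moreover have "Zero C (fst K) (fst (F i)) \<in> Hom (Mod_cat C A) K (?G i)"
      using Mod_Zero_Hom[OF A K_mod restrict_scalars_module[OF \<pi>(1) F_mod[OF i]]] by simp
    \<comment> \<open>Both ends lie at stage \<open>i\<close>. The chain between them may visit
      other stages, but an arrow on it is zero iff its neighbour is.\<close>
    ultimately have "((i, h \<cdot> k), (i, Zero C (fst K) (fst (F i)))) \<in> colim_Hom_rel (Mod_cat C A) K J ?G F'"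
      using K_preserves i hk by blast
    then have "h \<cdot> k = Zero C (fst K) (fst (F i))"
      using zero_iff by fastforce
    then obtain h' where h': "h' \<in> Hom (Mod_cat C B) N (F i)" "h' \<cdot> p = h"
      using descend[OF i h] by blast
    have h'_C: "h' \<in> Hom C (fst N) (fst (F i))"
      using h' by (simp add: Mod_Hom_iff)
    have "(l i \<cdot> h') \<cdot> p = g \<cdot> p"
      using Comp_assoc[OF p_C h'_C l_C] h' lh by simp
    then have "l i \<cdot> h' = g"
      using p(2) Comp_Hom[OF h'_C l_C] g_C unfolding epic_def by blast
    with i h' show ?thesis
      by blast
  qed
  moreover have "((i, f), (j, g)) \<in> colim_Hom_rel (Mod_cat C B) N J F F'"
    if i: "i \<in> Obj J" and j: "j \<in> Obj J" and f: "f \<in> Hom (Mod_cat C B) N (F i)"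
      and g: "g \<in> Hom (Mod_cat C B) N (F j)" and eq: "l i \<cdot> f = l j \<cdot> g" for i j f g
  proof -
    have fp: "h \<cdot> p \<in> Hom (Mod_cat C A) P (?G i)" if "h \<in> Hom (Mod_cat C B) N (F i)" for i h
      using ModA.Comp_Hom[OF p(1) restrict_scalars_Hom[OF \<pi>(1) that]] by (simp add: Mod_Comp)
    \<comment> \<open>Along a chain that starts at \<open>f \<cdot> p\<close>, every arrow again
      factors through \<open>p\<close>, and the factors form a chain over \<open>N\<close>.\<close>
    have lift: "\<exists>f'. f' \<in> Hom (Mod_cat C B) N (F (fst y)) \<and> snd y = f' \<cdot> p \<and>
        ((i, f), (fst y, f')) \<in> colim_Hom_rel (Mod_cat C B) N J F F'"
      if "((i, f \<cdot> p), y) \<in> colim_Hom_rel (Mod_cat C A) P J ?G F'" for y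
      using that
    proof (induction rule: rtrancl_induct)
      case base
      then show ?case
        using f by auto
    next
      case (step y z)
      obtain f' where f': "f' \<in> Hom (Mod_cat C B) N (F (fst y))" "snd y = f' \<cdot> p"
        and chain: "((i, f), (fst y, f')) \<in> colim_Hom_rel (Mod_cat C B) N J F F'"
        using step.IH by blast
      have f'_C: "f' \<in> Hom C (fst N) (fst (F (fst y)))"
        using f' by (simp add: Mod_Hom_iff)
      from step.hyps(2) consider
          (forward) j u where "u \<in> Hom J (fst y) j" "z = (j, F' u \<cdot> snd y)"
        | (backward) j u h where "u \<in> Hom J j (fst y)" "z = (j, h)" "snd y = F' u \<cdot> h"
            "h \<in> Hom (Mod_cat C A) P (?G j)"
        unfolding colim_Hom_step_def Mod_Comp by auto
      then show ?case
      proof cases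
        case forward
        have u_C: "F' u \<in> Hom C (fst (F (fst y))) (fst (F j))"
          using F'_B[OF forward(1)] by (simp add: Mod_Hom_iff)
        have "((fst y, f'), (j, F' u \<cdot> f')) \<in> colim_Hom_step (Mod_cat C B) N J F F'"
          using forward f' unfolding colim_Hom_step_def Mod_Comp by blast
        then have "((i, f), (j, F' u \<cdot> f')) \<in> colim_Hom_rel (Mod_cat C B) N J F F'"
          using chain by (meson UnI1 rtrancl.rtrancl_into_rtrancl)
        moreover have "F' u \<cdot> f' \<in> Hom (Mod_cat C B) N (F j)"
          using ModB.Comp_Hom[OF f'(1) F'_B[OF forward(1)]] by (simp add: Mod_Comp)
        ultimately show ?thesis
          using forward f' Comp_assoc[OF p_C f'_C u_C] by auto
      next
        case backward
        have j: "j \<in> Obj J"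
          using category.Hom_Obj[OF J_cat backward(1)] by simp
        have u_C: "F' u \<in> Hom C (fst (F j)) (fst (F (fst y)))" and h_C: "h \<in> Hom C (fst P) (fst (F j))"
          using F'_B[OF backward(1)] backward(4) by (simp_all add: Mod_Hom_iff)
        \<comment> \<open>In a backward step \<open>h\<close> still has to descend to
          \<open>N\<close>. It vanishes on \<open>K\<close> because \<open>F' u\<close> is monic and
          \<open>F' u \<cdot> h\<close> factors through \<open>p\<close>.\<close>
        have uh: "F' u \<cdot> h = f' \<cdot> p"
          using backward f' by simp
        then have "F' u \<cdot> (h \<cdot> k) = f' \<cdot> (p \<cdot> k)"
          using Comp_assoc[OF k_C h_C u_C] Comp_assoc[OF k_C p_C f'_C] by simp
        also have "\<dots> = Zero C (fst K) (fst (F (fst y)))"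
          by (rule Comp_eq_Zero(1)[OF Comp_Hom[OF k_C p_C] f'_C pk])
        finally have "h \<cdot> k = Zero C (fst K) (fst (F j))"
          using monic_zero[OF F'_monic[OF backward(1)] Comp_Hom[OF k_C h_C]] by blast
        then obtain h' where h': "h' \<in> Hom (Mod_cat C B) N (F j)" "h' \<cdot> p = h"
          using descend[OF j backward(4)] by blast
        have h'_C: "h' \<in> Hom C (fst N) (fst (F j))"
          using h' by (simp add: Mod_Hom_iff)
        have "(F' u \<cdot> h') \<cdot> p = f' \<cdot> p"
          using Comp_assoc[OF p_C h'_C u_C] h' uh by simp
        then have "F' u \<cdot> h' = f'"
          using p(2) Comp_Hom[OF h'_C u_C] f'_C unfolding epic_def by blast
        then have "((j, h'), (fst y, f')) \<in> colim_Hom_step (Mod_cat C B) N J F F'"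
          using backward(1) h'(1) unfolding colim_Hom_step_def Mod_Comp by blast
        then have "((i, f), (j, h')) \<in> colim_Hom_rel (Mod_cat C B) N J F F'"
          using chain by (meson UnI2 converseI rtrancl.rtrancl_into_rtrancl)
        then show ?thesis
          using backward(2) h' by auto
      qed
    qed
    have C: "f \<in> Hom C (fst N) (fst (F i))" "g \<in> Hom C (fst N) (fst (F j))"
      "l i \<in> Hom C (fst (F i)) (fst L)" "l j \<in> Hom C (fst (F j)) (fst L)"
      using f g l_B[OF i] l_B[OF j] by (simp_all add: Mod_Hom_iff)
    have "l i \<cdot> (f \<cdot> p) = l j \<cdot> (g \<cdot> p)"
      using eq Comp_assoc[OF p_C C(1) C(3)] Comp_assoc[OF p_C C(2) C(4)] by simp
    then have "((i, f \<cdot> p), (j, g \<cdot> p)) \<in> colim_Hom_rel (Mod_cat C A) P J ?G F'"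
      using P_preserves i j fp[OF f] fp[OF g] by blast
    then obtain f' where f': "f' \<in> Hom (Mod_cat C B) N (F j)" "g \<cdot> p = f' \<cdot> p"
      "((i, f), (j, f')) \<in> colim_Hom_rel (Mod_cat C B) N J F F'"
      using lift by fastforce
    then have "f' = g"
      using p(2) C(2) unfolding epic_def by (auto simp: Mod_Hom_iff)
    with f' show ?thesis
      by simp
  qed
  ultimately show "Hom_preserves_colimit (Mod_cat C B) N J F F' L l"
    unfolding ModB.Hom_preserves_colimit_iff[OF J_cat F is_colimit_cocone[OF colim]] Mod_Comp by blast
qed

lemma noetherian_if_epic:
  assumes A: "noetherian U C A"
    and \<pi>: "\<pi> \<in> Hom (Comm C) A B" "epic C (mobj A) (mobj B) \<pi>"
  shows "noetherian U C B"
  unfolding noetherian_def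
proof (intro conjI allI impI)
  have A': "is_comm_monoid C A" and B': "is_comm_monoid C B"
    using \<pi> by (auto simp: Comm_Hom_iff)
  then show "B \<in> Obj (Comm C)"
    by (simp add: Comm_def)
  have sub: "finitely_generated U (Mod_cat C A) M"
    if "i \<in> Hom (Mod_cat C A) M (regular_module A)" "monic C (fst M) (mobj A) i" for M i
  proof -
    have "monic (Mod_cat C A) M (regular_module A) i"
      using Mod_monic_if_monic[OF that(1)] that(2) by (simp add: regular_module_def)
    then show ?thesis
      using A unfolding noetherian_def by blast
  qed
  fix N i
  assume i: "monic (Mod_cat C B) N (regular_module B) i"
  then have i_Mod: "i \<in> Hom (Mod_cat C B) N (regular_module B)"
    by (simp add: monic_def)
  \<comment> \<open>The pullback is formed in \<open>C\<close>, whereas the submodule is given by a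
    monic of \<open>B\<close>-modules.\<close>
  have i_monic: "monic C (fst N) (mobj B) i"
    using monic_if_Mod_monic[OF B' i] by (simp add: regular_module_def)
  have N: "is_module C B N"
    using i_Mod by (simp add: Mod_Hom_iff)
  obtain P k p where k: "k \<in> Hom (Mod_cat C A) P (regular_module A)" "monic C (fst P) (mobj A) k"
    and p: "p \<in> Hom (Mod_cat C A) P (restrict_scalars \<pi> N)" "epic C (fst P) (fst N) p"
    using Mod_pullback[OF \<pi> i_Mod i_monic] by blast
  have p_C: "p \<in> Hom C (fst P) (fst N)"
    using p by (simp add: Mod_Hom_iff)
  obtain x \<kappa> where \<kappa>: "is_kernel C (fst P) (fst N) p x \<kappa>"
    using kernels[OF p_C] by blast
  obtain a where \<kappa>_Mod: "\<kappa> \<in> Hom (Mod_cat C A) (x, a) P"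
    using Mod_kernel[OF A' p(1), of x \<kappa>] \<kappa> unfolding fst_restrict_scalars by blast
  have "k \<cdot> \<kappa> \<in> Hom (Mod_cat C A) (x, a) (regular_module A)"
    using category.Comp_Hom[OF category_Mod[OF A'] \<kappa>_Mod k(1)] by (simp add: Mod_Comp)
  moreover have "monic C x (mobj A) (k \<cdot> \<kappa>)"
    by (rule monic_Comp[OF kernel_monic[OF \<kappa> p_C] k(2)])
  ultimately have "finitely_generated U (Mod_cat C A) (x, a)"
    using sub by simp
  then show "finitely_generated U (Mod_cat C B) N"
    using finitely_generated_quotient[OF \<pi> N sub[OF k] p _ \<kappa>_Mod] \<kappa> by simp
qed

end

theorem proposition3p11:
  fixes U :: "'u set"
    and C :: "('o, 'm) sm_cat"
    and A B :: "('o, 'm) mon"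
    and I :: "'m set"
  assumes "base_category U C"
    and "noetherian U C A"
    and "ideal I (End_ring C A)"
    and "is_ideal_quotient C A I B"
  shows "noetherian U C B"
proof -
  interpret base_category U C
    by (rule assms(1))
  have "is_comm_monoid C A"
    using assms(2) by (simp add: noetherian_def Comm_def)
  moreover have "I \<subseteq> Hom (Mod_cat C A) (regular_module A) (regular_module A)"
    using ideal.Icarr[OF assms(3)] by (auto simp: End_ring_def)
  ultimately obtain \<pi> where "\<pi> \<in> Hom (Comm C) A B" "epic C (mobj A) (mobj B) \<pi>"
    using ideal_quotient_epic assms(4) by blast
  then show ?thesis
    using noetherian_if_epic assms(2) by blast
qed

end
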